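(* Let $M$ be a compact 3-manifold without boundary and let $G$ be a finite cyclic group acting on $M$ by $C^1$ diffeomorphisms. Then the quotient $M/G$ is an orbifold.
   Context: $M$ is a smooth manifold. "Orbifold" has its standard meaning: a space locally modelled on quotients of open subsets of $\mathbb{R}^3$ by finite groups acting smoothly, with compatible charts. *)

theory Defs
  imports "HOL-Analysis.Analysis" "HOL-Algebra.Elementary_Groups" "HOL-Algebra.Group_Action"
begin

section \<open>\<open>C\<^sup>k\<close> maps between Euclidean spaces\<close>

text \<open>The set is always open in the uses below, so derivatives are taken in the full space.
  As the dimension is finite, continuity of all directional derivatives \<open>x \<mapsto> f' x v\<close> is
  continuity of the total derivative.\<close>

primrec Ck_on :: "nat \<Rightarrow> ('e::euclidean_space \<Rightarrow> 'f::euclidean_space) \<Rightarrow> 'e set \<Rightarrow> bool" where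
  "Ck_on 0 f S \<longleftrightarrow> continuous_on S f"
| "Ck_on (Suc k) f S \<longleftrightarrow>
     (\<exists>f'. (\<forall>x\<in>S. (f has_derivative f' x) (at x)) \<and> (\<forall>v. Ck_on k (\<lambda>x. f' x v) S))"

definition smooth_on :: "('e::euclidean_space \<Rightarrow> 'f::euclidean_space) \<Rightarrow> 'e set \<Rightarrow> bool" where
  "smooth_on f S \<longleftrightarrow> (\<forall>k. Ck_on k f S)"

section \<open>Smooth manifolds\<close>

text \<open>Charts take values in open subsets of the whole Euclidean space, so the manifolds have no
  boundary. The atlas need not be maximal.\<close>

definition manifold_chart :: "'a topology \<Rightarrow> 'a set \<Rightarrow> ('a \<Rightarrow> 'e::euclidean_space) \<Rightarrow> bool" where
  "manifold_chart M U \<phi> \<longleftrightarrow>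
     openin M U \<and> open (\<phi> ` U) \<and> homeomorphic_map (subtopology M U) (top_of_set (\<phi> ` U)) \<phi>"

definition smooth_manifold :: "'a topology \<Rightarrow> ('a set \<times> ('a \<Rightarrow> 'e::euclidean_space)) set \<Rightarrow> bool" where
  "smooth_manifold M A \<longleftrightarrow>
     Hausdorff_space M \<and> second_countable M \<and>
     (\<forall>(U, \<phi>)\<in>A. manifold_chart M U \<phi>) \<and>
     (\<Union>(U, \<phi>)\<in>A. U) = topspace M \<and>
     (\<forall>(U, \<phi>)\<in>A. \<forall>(V, \<psi>)\<in>A. smooth_on (\<psi> \<circ> inv_into U \<phi>) (\<phi> ` (U \<inter> V)))"

definition Ck_map :: "nat \<Rightarrow> 'a topology \<Rightarrow> ('a set \<times> ('a \<Rightarrow> 'e::euclidean_space)) set \<Rightarrow>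
    'b topology \<Rightarrow> ('b set \<times> ('b \<Rightarrow> 'f::euclidean_space)) set \<Rightarrow> ('a \<Rightarrow> 'b) \<Rightarrow> bool" where
  "Ck_map k M A N B f \<longleftrightarrow>
     continuous_map M N f \<and>
     (\<forall>(U, \<phi>)\<in>A. \<forall>(V, \<psi>)\<in>B. Ck_on k (\<psi> \<circ> f \<circ> inv_into U \<phi>) (\<phi> ` {x\<in>U. f x \<in> V}))"

definition Ck_diffeomorphism :: "nat \<Rightarrow> 'a topology \<Rightarrow> ('a set \<times> ('a \<Rightarrow> 'e::euclidean_space)) set \<Rightarrow>
    'b topology \<Rightarrow> ('b set \<times> ('b \<Rightarrow> 'f::euclidean_space)) set \<Rightarrow> ('a \<Rightarrow> 'b) \<Rightarrow> bool" where
  "Ck_diffeomorphism k M A N B f \<longleftrightarrow>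
     bij_betw f (topspace M) (topspace N) \<and>
     Ck_map k M A N B f \<and> Ck_map k N B M A (inv_into (topspace M) f)"

section \<open>Orbit spaces\<close>

definition orbit_space ::
    "'a topology \<Rightarrow> ('g, 'm) monoid_scheme \<Rightarrow> ('g \<Rightarrow> 'a \<Rightarrow> 'a) \<Rightarrow> 'a set topology" where
  "orbit_space X G act =
     topology (\<lambda>\<U>. \<U> \<subseteq> orbits G (topspace X) act \<and>
                   openin X {x \<in> topspace X. orbit G act x \<in> \<U>})"

lemma openin_orbit_space:
  "openin (orbit_space X G act) \<U> \<longleftrightarrow>
     \<U> \<subseteq> orbits G (topspace X) act \<and> openin X {x \<in> topspace X. orbit G act x \<in> \<U>}"
proof -
  have "istopology (\<lambda>\<U>. \<U> \<subseteq> orbits G (topspace X) act \<and>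
                   openin X {x \<in> topspace X. orbit G act x \<in> \<U>})"
    unfolding istopology_def
  proof (rule conjI; clarify)
    fix S T
    assume "openin X {x \<in> topspace X. orbit G act x \<in> S}"
      and "openin X {x \<in> topspace X. orbit G act x \<in> T}"
    then have "openin X ({x \<in> topspace X. orbit G act x \<in> S} \<inter> {x \<in> topspace X. orbit G act x \<in> T})"
      by blast
    moreover have "{x \<in> topspace X. orbit G act x \<in> S \<inter> T} =
        {x \<in> topspace X. orbit G act x \<in> S} \<inter> {x \<in> topspace X. orbit G act x \<in> T}"
      by blast
    moreover assume "S \<subseteq> orbits G (topspace X) act"
    ultimately show "S \<inter> T \<subseteq> orbits G (topspace X) act \<and>
        openin X {x \<in> topspace X. orbit G act x \<in> S \<inter> T}"
      by auto
  next
    fix K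
    assume K: "\<forall>S\<in>K. S \<subseteq> orbits G (topspace X) act \<and> openin X {x \<in> topspace X. orbit G act x \<in> S}"
    then have "openin X (\<Union>S\<in>K. {x \<in> topspace X. orbit G act x \<in> S})"
      by blast
    moreover have "{x \<in> topspace X. orbit G act x \<in> \<Union>K} =
        (\<Union>S\<in>K. {x \<in> topspace X. orbit G act x \<in> S})"
      by blast
    ultimately show "\<Union>K \<subseteq> orbits G (topspace X) act \<and>
        openin X {x \<in> topspace X. orbit G act x \<in> \<Union>K}"
      using K by auto
  qed
  then show ?thesis
    by (simp add: orbit_space_def topology_inverse')
qed

lemma topspace_orbit_space: "topspace (orbit_space X G act) = orbits G (topspace X) act"
proof -
  have "{x \<in> topspace X. orbit G act x \<in> orbits G (topspace X) act} = topspace X"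
    by (auto simp: orbits_def)
  then have "openin (orbit_space X G act) (orbits G (topspace X) act)"
    by (simp add: openin_orbit_space)
  then show ?thesis
    by (meson openin_orbit_space openin_subset openin_topspace subset_antisym)
qed

lemma quotient_map_orbit_space: "quotient_map X (orbit_space X G act) (orbit G act)"
  unfolding quotient_map_def topspace_orbit_space
  by (auto simp: openin_orbit_space orbits_def)

section \<open>Orbifolds\<close>

text \<open>A local group \<open>\<Gamma>\<close> is given as a finite group of self-diffeomorphisms of \<open>V\<close> (its elements
  are undefined outside \<open>V\<close>), so it acts effectively. The map \<open>\<phi>\<close> is required to induce a
  homeomorphism \<open>h\<close> from \<open>V / \<Gamma>\<close> onto the open set \<open>\<phi> ` V\<close>.\<close>

definition orbifold_chart ::
    "'x topology \<Rightarrow> 'e::euclidean_space set \<Rightarrow> ('e \<Rightarrow> 'e) set \<Rightarrow> ('e \<Rightarrow> 'x) \<Rightarrow> bool" where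
  "orbifold_chart X V \<Gamma> \<phi> \<longleftrightarrow>
     open V \<and> connected V \<and>
     subgroup \<Gamma> (BijGroup V) \<and> finite \<Gamma> \<and> (\<forall>\<gamma>\<in>\<Gamma>. smooth_on \<gamma> V) \<and>
     openin X (\<phi> ` V) \<and>
     (let \<Gamma>V = (BijGroup V)\<lparr>carrier := \<Gamma>\<rparr> in
      \<exists>h. homeomorphic_map (orbit_space (top_of_set V) \<Gamma>V (\<lambda>\<gamma>. \<gamma>)) (subtopology X (\<phi> ` V)) h \<and>
          (\<forall>v\<in>V. \<phi> v = h (orbit \<Gamma>V (\<lambda>\<gamma>. \<gamma>) v)))"

definition orbifold_chart_embedding ::
    "'e::euclidean_space set \<Rightarrow> ('e \<Rightarrow> 'x) \<Rightarrow> 'e set \<Rightarrow> ('e \<Rightarrow> 'x) \<Rightarrow> ('e \<Rightarrow> 'e) \<Rightarrow> bool" where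
  "orbifold_chart_embedding W \<xi> V \<phi> j \<longleftrightarrow>
     j ` W \<subseteq> V \<and> open (j ` W) \<and> inj_on j W \<and>
     smooth_on j W \<and> smooth_on (inv_into W j) (j ` W) \<and>
     (\<forall>w\<in>W. \<phi> (j w) = \<xi> w)"

text \<open>Compatibility is local: around each common point of two charts there is an orbifold chart,
  not necessarily in the atlas, that embeds in both.\<close>

definition orbifold_atlas ::
    "'x topology \<Rightarrow> ('e::euclidean_space set \<times> ('e \<Rightarrow> 'e) set \<times> ('e \<Rightarrow> 'x)) set \<Rightarrow> bool" where
  "orbifold_atlas X \<O> \<longleftrightarrow>
     Hausdorff_space X \<and> second_countable X \<and>
     (\<forall>(V, \<Gamma>, \<phi>)\<in>\<O>. orbifold_chart X V \<Gamma> \<phi>) \<and>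
     (\<Union>(V, \<Gamma>, \<phi>)\<in>\<O>. \<phi> ` V) = topspace X \<and>
     (\<forall>(V, \<Gamma>, \<phi>)\<in>\<O>. \<forall>(V', \<Gamma>', \<phi>')\<in>\<O>. \<forall>x \<in> \<phi> ` V \<inter> \<phi>' ` V'.
        \<exists>W \<Delta> \<xi> j j'. orbifold_chart X W \<Delta> \<xi> \<and> x \<in> \<xi> ` W \<and>
          orbifold_chart_embedding W \<xi> V \<phi> j \<and> orbifold_chart_embedding W \<xi> V' \<phi>' j')"

text \<open>An orbifold structure on the orbit space that belongs to the action, rather than to the
  underlying space alone: the charts are restrictions of the projection to open subsets of \<open>M\<close>,
  i.e. they lift through it to open embeddings. This makes the local groups those induced by the
  stabilizers.\<close>

definition quotient_orbifold_atlas ::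
    "'a topology \<Rightarrow> ('g, 'm) monoid_scheme \<Rightarrow> ('g \<Rightarrow> 'a \<Rightarrow> 'a) \<Rightarrow>
     ('e::euclidean_space set \<times> ('e \<Rightarrow> 'e) set \<times> ('e \<Rightarrow> 'a set)) set \<Rightarrow> bool" where
  "quotient_orbifold_atlas M G act \<O> \<longleftrightarrow>
     orbifold_atlas (orbit_space M G act) \<O> \<and>
     (\<forall>(V, \<Gamma>, \<phi>)\<in>\<O>. \<exists>\<psi>. embedding_map (top_of_set V) M \<psi> \<and> openin M (\<psi> ` V) \<and>
        (\<forall>v\<in>V. \<phi> v = orbit G act (\<psi> v)))"

end

theory Submission
  imports Defs
begin

text \<open>A finite group of \<open>C\<^sup>1\<close> diffeomorphisms of a compact manifold acts smoothly with respect to a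
  suitable new smooth atlas, whose charts are only \<open>C\<^sup>1\<close> compatible with the given one. Near each
  point \<open>x\<close>, averaging a chart over the stabilizer \<open>H\<close> of \<open>x\<close> gives a \<open>C\<^sup>1\<close> chart \<open>h\<close> in which \<open>H\<close>
  acts linearly. Finitely many such charts cover the manifold, and they are added one at a time to
  the atlas already built. Before it is added, \<open>h\<close> is made smooth with respect to that atlas, one
  small ball at a time: in a chart of the atlas, \<open>h\<close> is replaced by \<open>(1 - \<beta>) h + \<beta> (h * \<eta>)\<close> with a
  bump function \<open>\<beta>\<close> and a mollifier \<open>\<eta>\<close>, and the correction is averaged over \<open>H\<close>. Points where
  \<open>h\<close> was smooth stay smooth, and a \<open>C\<^sup>1\<close>-small correction keeps \<open>h\<close> a chart. For the resulting
  atlas, the stabilizer of a point preserves a small connected neighbourhood, and dividing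
  these neighbourhoods by the stabilizers gives the orbifold charts.\<close>

section \<open>\<open>C\<^sup>k\<close> calculus\<close>

text \<open>The given smooth atlas cannot in general supply the charts: a local group must consist
  of smooth maps, and a \<open>C^1\<close> diffeomorphism need not be smooth in it. Changing the
  atlas is legitimate because \<open>quotient_orbifold_atlas\<close> asks of a chart only a
  topological lift to \<open>M\<close>. Linear charts at different points, however, are related by
  \<open>C^1\<close> maps alone, and making them agree must not destroy the linearity. Hence a
  correction is carried out in the coordinates of the linear chart: \<open>h\<close> is followed by
  a map \<open>z + u z\<close> of the whole coordinate space that commutes with the representation,
  where \<open>u\<close> has derivative at most 1/2. Such a map is injective with a
  \<open>C^1\<close> inverse, so the domain of \<open>h\<close> and its invariance survive.
  Averaging the correction over \<open>H\<close> adds up several copies near a point with a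
  nontrivial stabiliser; neighbourhoods that the other elements push off themselves allow for an
  exact count of the copies. Transition maps need to be made smooth in one direction only, since a
  \<open>C^1\<close> inverse of a smooth map is smooth. Compactness keeps the number of corrections
  finite, so that no limit of charts is ever formed.\<close>

lemma Ck_on_subset: "Ck_on k f S \<Longrightarrow> T \<subseteq> S \<Longrightarrow> Ck_on k f T"
proof (induction k arbitrary: f)
  case 0 then show ?case using continuous_on_subset by auto
next
  case (Suc k) then show ?case by (simp, meson subsetD)
qed

lemma Ck_on_cong:
  assumes "open S" "\<And>x. x \<in> S \<Longrightarrow> f x = g x" "Ck_on k f S"
  shows "Ck_on k g S"
  using assms(2,3)
proof (induction k arbitrary: f g)
  case 0 then show ?case using continuous_on_cong by auto
next
  case (Suc k)
  then obtain f' where f': "\<forall>x\<in>S. (f has_derivative f' x) (at x)" "\<forall>v. Ck_on k (\<lambda>x. f' x v) S"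
    by auto
  have "(g has_derivative f' x) (at x)" if "x \<in> S" for x
    using has_derivative_transform_within_open[OF _ assms(1) that] f' that Suc.prems by blast
  then show ?case using f' by auto
qed

lemma Ck_on_Suc_imp: "Ck_on (Suc k) f S \<Longrightarrow> Ck_on k f S"
proof (induction k arbitrary: f)
  case 0
  then obtain f' where "\<forall>x\<in>S. (f has_derivative f' x) (at x)" by auto
  then show ?case
    by (auto intro!: has_derivative_continuous_on[of S f f'] intro: has_derivative_at_withinI)
next
  case (Suc k) then show ?case by (metis Ck_on.simps(2))
qed

lemma Ck_on_le: "Ck_on k f S \<Longrightarrow> j \<le> k \<Longrightarrow> Ck_on j f S"
  by (induction k) (auto simp: le_Suc_eq simp del: Ck_on.simps dest: Ck_on_Suc_imp)

lemma Ck_on_imp_continuous_on: "Ck_on k f S \<Longrightarrow> continuous_on S f"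
  using Ck_on_le[of k f S 0] by simp

lemma Ck_on_const: "Ck_on k (\<lambda>x. c) S"
proof (induction k arbitrary: c)
  case (Suc k) then show ?case
    by (auto intro!: exI[where x="\<lambda>x v. 0"])
qed auto

lemma Ck_on_bounded_linear: "bounded_linear f \<Longrightarrow> Ck_on k f S"
  by (cases k) (auto simp: linear_continuous_on bounded_linear_imp_has_derivative Ck_on_const
      intro!: exI[where x="\<lambda>x. f"])

lemma Ck_on_add:
  "Ck_on k f S \<Longrightarrow> Ck_on k g S \<Longrightarrow> Ck_on k (\<lambda>x. f x + g x) S"
proof (induction k arbitrary: f g)
  case 0 then show ?case by (auto intro: continuous_on_add)
next
  case (Suc k)
  then obtain f' g' where "\<forall>x\<in>S. (f has_derivative f' x) (at x)" "\<forall>v. Ck_on k (\<lambda>x. f' x v) S"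
    "\<forall>x\<in>S. (g has_derivative g' x) (at x)" "\<forall>v. Ck_on k (\<lambda>x. g' x v) S" by auto
  then show ?case using Suc.IH
    by (auto intro!: exI[where x="\<lambda>x v. f' x v + g' x v"] has_derivative_add)
qed

lemma Ck_on_sum:
  "(\<And>i. i \<in> I \<Longrightarrow> Ck_on k (f i) S) \<Longrightarrow> Ck_on k (\<lambda>x. \<Sum>i\<in>I. f i x) S"
  by (induction I rule: infinite_finite_induct) (auto simp: Ck_on_const intro: Ck_on_add)

lemma Ck_on_bilinear:
  assumes b: "bounded_bilinear p"
  shows "Ck_on k f S \<Longrightarrow> Ck_on k g S \<Longrightarrow> Ck_on k (\<lambda>x. p (f x) (g x)) S"
proof (induction k arbitrary: f g)
  case 0 then show ?case by (auto intro: bounded_bilinear.continuous_on[OF b])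
next
  case (Suc k)
  then obtain f' g' where d: "\<forall>x\<in>S. (f has_derivative f' x) (at x)" "\<forall>v. Ck_on k (\<lambda>x. f' x v) S"
    "\<forall>x\<in>S. (g has_derivative g' x) (at x)" "\<forall>v. Ck_on k (\<lambda>x. g' x v) S" by auto
  have "Ck_on k f S" "Ck_on k g S" using Suc.prems Ck_on_Suc_imp by blast+
  then show ?case using Suc.IH d
    by (auto intro!: exI[where x="\<lambda>x v. p (f x) (g' x v) + p (f' x v) (g x)"] Ck_on_add
        bounded_bilinear.FDERIV[OF b])
qed

text \<open>\<open>Ck_on\<close> speaks of derivatives in fixed directions. This expansion reduces a
  derivative in a direction that varies with the point to finitely many of those.\<close>

lemma linear_basis_representation:
  fixes l :: "'a::euclidean_space \<Rightarrow> 'b::real_vector"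
  assumes "linear l"
  shows "l v = (\<Sum>b\<in>Basis. (v \<bullet> b) *\<^sub>R l b)"
  using linear_sum[OF assms, of "\<lambda>b. (v \<bullet> b) *\<^sub>R b" Basis] linear_scale[OF assms]
  by (simp add: euclidean_representation)

lemma Ck_on_compose:
  assumes "open S"
  shows "Ck_on k f S \<Longrightarrow> Ck_on k g T \<Longrightarrow> f ` S \<subseteq> T \<Longrightarrow> Ck_on k (\<lambda>x. g (f x)) S"
proof (induction k arbitrary: f g)
  case 0 then show ?case by (auto intro: continuous_on_compose2)
next
  case (Suc k)
  then obtain f' g' where d: "\<forall>x\<in>S. (f has_derivative f' x) (at x)" "\<forall>v. Ck_on k (\<lambda>x. f' x v) S"
    "\<forall>x\<in>T. (g has_derivative g' x) (at x)" "\<forall>v. Ck_on k (\<lambda>x. g' x v) T" by auto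
  have ck: "Ck_on k f S" using Suc.prems Ck_on_Suc_imp by blast
  have "((\<lambda>x. g (f x)) has_derivative (\<lambda>v. g' (f x) (f' x v))) (at x)" if "x \<in> S" for x
    using d that Suc.prems(3) has_derivative_compose by blast
  moreover have "Ck_on k (\<lambda>x. g' (f x) (f' x v)) S" for v
  proof -
    have eq: "g' y w = (\<Sum>b\<in>Basis. (w \<bullet> b) *\<^sub>R g' y b)" if "y \<in> T" for y w
      using d that has_derivative_linear by (intro linear_basis_representation) blast
    \<comment> \<open>In \<open>g' (f x) (f' x v)\<close> the point and the direction both vary; the
      expanded form is a sum of products of maps already known to be \<open>C^k\<close>.\<close>
    have "Ck_on k (\<lambda>x. \<Sum>b\<in>Basis. (f' x v \<bullet> b) *\<^sub>R g' (f x) b) S"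
      by (intro Ck_on_sum Ck_on_bilinear[OF bounded_bilinear_scaleR]
          Ck_on_bilinear[OF bounded_bilinear_inner] Ck_on_const Suc.IH ck)
        (use d Suc.prems in auto)
    then show ?thesis
      by (rule Ck_on_cong[OF assms, rotated]) (use eq Suc.prems(3) in force)
  qed
  ultimately have "(\<forall>x\<in>S. ((\<lambda>x. g (f x)) has_derivative (\<lambda>v. g' (f x) (f' x v))) (at x)) \<and>
      (\<forall>v. Ck_on k (\<lambda>x. g' (f x) (f' x v)) S)" by simp
  then show ?case
    unfolding Ck_on.simps by (rule exI[where x="\<lambda>x v. g' (f x) (f' x v)"])
qed

lemma Ck_on_local:
  assumes "\<And>x. x \<in> S \<Longrightarrow> \<exists>T. open T \<and> x \<in> T \<and> Ck_on k f T"
  shows "Ck_on k f S"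
  using assms
proof (induction k arbitrary: f)
  case 0
  then have "isCont f x" if "x \<in> S" for x
    using that by (metis Ck_on.simps(1) continuous_on_eq_continuous_at)
  then show ?case by (simp add: continuous_at_imp_continuous_on)
next
  case (Suc k)
  \<comment> \<open>The hypothesis gives a separate derivative on each neighbourhood. The canonical
    one agrees with all of them and so serves on the whole of \<open>S\<close>.\<close>
  let ?f = "\<lambda>x. frechet_derivative f (at x)"
  have "(f has_derivative ?f x) (at x)" if x: "x \<in> S" for x
  proof -
    obtain f' where "(f has_derivative f' x) (at x)"
      using Suc.prems[OF x] unfolding Ck_on.simps by blast
    then show ?thesis using differentiableI frechet_derivative_works by blast
  qed
  moreover have "Ck_on k (\<lambda>x. ?f x v) S" for v
  proof (rule Suc.IH)
    fix x assume "x \<in> S"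
    then obtain T f' where T: "open T" "x \<in> T" "\<forall>x\<in>T. (f has_derivative f' x) (at x)"
      "\<forall>v. Ck_on k (\<lambda>x. f' x v) T"
      using Suc.prems[of x] unfolding Ck_on.simps by blast
    then have "f' y v = ?f y v" if "y \<in> T" for y
      using frechet_derivative_at[of f "f' y" y] T(3) that by simp
    then have "Ck_on k (\<lambda>x. ?f x v) T"
      using Ck_on_cong[OF T(1), of "\<lambda>x. f' x v" "\<lambda>x. ?f x v"] T(4) by blast
    then show "\<exists>T. open T \<and> x \<in> T \<and> Ck_on k (\<lambda>x. ?f x v) T" using T by blast
  qed
  ultimately show ?case
    unfolding Ck_on.simps by (intro exI[where x="?f"]) simp
qed

section \<open>Inverses of linear families and of \<open>C^k\<close> maps\<close>

lemma linear_injective_perturbation_bound: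
  fixes A B :: "'a::euclidean_space \<Rightarrow> 'b::euclidean_space"
  assumes "linear A" "linear B" "\<And>w. norm (A w) \<ge> c * norm w"
    "\<And>b. b \<in> Basis \<Longrightarrow> norm (B b - A b) \<le> e" "e * DIM('a) \<le> c / 2"
  shows "norm (B w) \<ge> c / 2 * norm w"
proof -
  have l: "linear (\<lambda>w. B w - A w)" using assms(1,2) by (rule linear_compose_sub[rotated])
  have "norm (B w - A w) = norm (\<Sum>b\<in>Basis. (w \<bullet> b) *\<^sub>R (B b - A b))"
    by (rule arg_cong[of _ _ norm, OF linear_basis_representation[OF l]])
  also have "\<dots> \<le> (\<Sum>b\<in>(Basis::'a set). norm w * e)"
  proof (rule sum_norm_le)
    fix b :: 'a assume "b \<in> Basis"
    then show "norm ((w \<bullet> b) *\<^sub>R (B b - A b)) \<le> norm w * e"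
      using assms(4) by (auto intro!: mult_mono Basis_le_norm)
  qed
  also have "\<dots> \<le> c / 2 * norm w"
    using mult_right_mono[OF assms(5), of "norm w"] by (simp add: algebra_simps)
  finally show ?thesis using assms(3)[of w] norm_triangle_ineq2[of "A w" "B w"]
    by (simp add: norm_minus_commute)
qed

text \<open>A lower bound uniform near \<open>z\<close> yields both the injectivity of the
  neighbouring maps and the estimate for the continuity of their inverses. The filter
  \<open>at z\<close> omits \<open>z\<close> itself, hence the separate last conclusion.\<close>

lemma linear_inj_eventually_bounded_below:
  fixes A :: "'x::t2_space \<Rightarrow> 'a::euclidean_space \<Rightarrow> 'b::euclidean_space"
  assumes "\<And>x. x \<in> S \<Longrightarrow> linear (A x)" "open S" "z \<in> S" "inj (A z)"
    "\<And>b. b \<in> Basis \<Longrightarrow> continuous_on S (\<lambda>x. A x b)"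
  obtains c where "c > 0" "eventually (\<lambda>x. \<forall>w. norm (A x w) \<ge> c * norm w) (at z)"
    "\<forall>w. norm (A z w) \<ge> c * norm w"
proof -
  obtain c where c: "c > 0" "\<And>w. norm (A z w) \<ge> norm w * c"
    using linear_inj_bounded_below_pos[of "A z"] assms by (metis mult.commute)
  define e where "e = c / (2 * DIM('a))"
  have e: "e > 0" "e * DIM('a) \<le> c / 2" using c by (auto simp: e_def)
  have "eventually (\<lambda>x. \<forall>b\<in>Basis. dist (A x b) (A z b) < e) (at z)"
  proof (intro eventually_ball_finite ballI tendstoD)
    fix b :: 'a assume "b \<in> Basis"
    then have "isCont (\<lambda>x. A x b) z"
      using assms(2,3,5) continuous_on_eq_continuous_at by blast
    then show "((\<lambda>x. A x b) \<longlongrightarrow> A z b) (at z)" by (simp add: continuous_at)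
  qed (use e in auto)
  moreover have "eventually (\<lambda>x. x \<in> S) (at z)"
    using assms(2,3) eventually_at_in_open' by blast
  ultimately have "eventually (\<lambda>x. \<forall>w. norm (A x w) \<ge> c / 2 * norm w) (at z)"
  proof eventually_elim
    case (elim x)
    then show ?case using c e assms
      by (intro allI linear_injective_perturbation_bound[of "A z" _ c e])
        (auto simp: dist_norm mult.commute intro: less_imp_le)
  qed
  moreover have "\<forall>w. norm (A z w) \<ge> c / 2 * norm w"
  proof
    fix w show "norm (A z w) \<ge> c / 2 * norm w"
    proof -
      have "0 \<le> c * norm w" using c(1) by simp
      then show ?thesis using c(2)[of w] mult.commute[of "norm w" c] by linarith
    qed
  qed
  ultimately show ?thesis using that[of "c / 2"] c(1) half_gt_zero by blast
qed

text \<open>The product rule at a zero of \<open>p\<close>: there \<open>q\<close> need only be continuous, which allows differentiating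
  \<open>A\<^sup>-\<^sup>1 v\<close> before \<open>A\<^sup>-\<^sup>1\<close> is known to be differentiable.\<close>

lemma has_derivative_scaleR_vanishing:
  fixes p :: "'a::real_normed_vector \<Rightarrow> real" and q :: "'a \<Rightarrow> 'b::real_normed_vector"
  assumes p: "(p has_derivative p') (at x)" and "p x = 0" and q: "isCont q x"
  shows "((\<lambda>y. p y *\<^sub>R q y) has_derivative (\<lambda>u. p' u *\<^sub>R q x)) (at x)"
proof -
  have bl: "bounded_linear p'" using p has_derivative_bounded_linear by blast
  then obtain K where K: "K > 0" "\<And>u. norm (p' u) \<le> norm u * K"
    using bounded_linear.pos_bounded by blast
  have 1: "((\<lambda>y. (p y - p x - p' (y - x)) /\<^sub>R norm (y - x)) \<longlongrightarrow> 0) (at x)"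
    using p by (simp add: has_derivative_at_within)
  have 2: "((\<lambda>y. p' (y - x) *\<^sub>R (q y - q x) /\<^sub>R norm (y - x)) \<longlongrightarrow> 0) (at x)"
  proof (rule Lim_null_comparison)
    show "eventually (\<lambda>y. norm (p' (y - x) *\<^sub>R (q y - q x) /\<^sub>R norm (y - x)) \<le> K * norm (q y - q x)) (at x)"
    proof (rule eventuallyI)
      fix y
      have "\<bar>p' (y - x)\<bar> * inverse (norm (y - x)) \<le> K"
        using K(1) K(2)[of "y - x"] by (cases "y = x") (auto simp: field_simps)
      then show "norm ((p' (y - x) *\<^sub>R (q y - q x)) /\<^sub>R norm (y - x)) \<le> K * norm (q y - q x)"
        using mult_right_mono[of "\<bar>p' (y - x)\<bar> * inverse (norm (y - x))" K "norm (q y - q x)"]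
        by (simp add: abs_mult mult_ac)
    qed
    have "((\<lambda>y. q y - q x) \<longlongrightarrow> 0) (at x)"
      using q by (simp add: continuous_at LIM_zero_iff)
    then show "((\<lambda>y. K * norm (q y - q x)) \<longlongrightarrow> 0) (at x)"
      by (auto intro!: tendsto_mult_right_zero tendsto_norm_zero)
  qed
  have 3: "((\<lambda>y. ((p y - p x - p' (y - x)) /\<^sub>R norm (y - x)) *\<^sub>R q y) \<longlongrightarrow> 0 *\<^sub>R q x) (at x)"
    using q by (intro tendsto_scaleR 1) (simp add: continuous_at)
  have "((\<lambda>y. (p y *\<^sub>R q y - p x *\<^sub>R q x - p' (y - x) *\<^sub>R q x) /\<^sub>R norm (y - x)) \<longlongrightarrow> 0) (at x)"
    using tendsto_add[OF 3 2] assms(2) by (simp add: algebra_simps)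
  moreover have "bounded_linear (\<lambda>u. p' u *\<^sub>R q x)"
    using bl by (rule bounded_linear_scaleR_const)
  ultimately show ?thesis by (simp add: has_derivative_at_within)
qed


lemma bounded_below_inj:
  assumes "linear A" "c > 0" "\<And>w. norm (A w) \<ge> c * norm w"
  shows "inj A"
proof -
  have "w = 0" if "A w = 0" for w using assms(3)[of w] assms(2) that by (simp add: mult_le_0_iff)
  then show ?thesis using linear_injective_0[OF assms(1)] by blast
qed

lemma continuous_on_linear_inv:
  fixes A :: "'x::t2_space \<Rightarrow> 'a::euclidean_space \<Rightarrow> 'a"
  assumes lin: "\<And>x. x \<in> S \<Longrightarrow> linear (A x)" and inj: "\<And>x. x \<in> S \<Longrightarrow> inj (A x)" and S: "open S"
    and cont: "\<And>w. continuous_on S (\<lambda>x. A x w)"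
  shows "continuous_on S (\<lambda>x. inv_into UNIV (A x) v)"
proof (rule continuous_at_imp_continuous_on, rule ballI)
  fix z assume z: "z \<in> S"
  obtain c where c: "c > 0" "eventually (\<lambda>x. \<forall>w. norm (A x w) \<ge> c * norm w) (at z)"
    by (rule linear_inj_eventually_bounded_below[of S A z]) (use assms z in auto)
  have surj: "A x (inv_into UNIV (A x) v) = v" if "x \<in> S" for x v
    using lin inj that linear_injective_imp_surjective surj_f_inv_f by metis
  define b where "b = inv_into UNIV (A z) v"
  have "eventually (\<lambda>x. x \<in> S) (at z)" using z S eventually_at_in_open' by blast
  with c(2) have "eventually (\<lambda>x. norm (inv_into UNIV (A x) v - b) \<le> norm (A x b - A z b) * inverse c) (at z)"
  proof eventually_elim
    case (elim x)
    \<comment> \<open>\<open>A x\<close> and \<open>A z\<close> send their respective preimages to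
      the same \<open>v\<close>, so the error in the inverse is controlled by the variation of
      \<open>A\<close> at the fixed vector \<open>b\<close>.\<close>
    have "A x (inv_into UNIV (A x) v - b) = A z b - A x b"
      using surj[of x v] surj[OF z, of v] lin[OF elim(2)] elim(2) by (simp add: linear_diff b_def)
    then have "c * norm (inv_into UNIV (A x) v - b) \<le> norm (A x b - A z b)"
      using elim by (metis norm_minus_commute)
    then show ?case using c(1) by (simp add: field_simps)
  qed
  moreover have "((\<lambda>x. norm (A x b - A z b) * inverse c) \<longlongrightarrow> 0) (at z)"
  proof -
    have "isCont (\<lambda>x. A x b) z" using cont S z continuous_on_eq_continuous_at by blast
    then show ?thesis
      by (auto intro!: tendsto_mult_left_zero tendsto_norm_zero LIM_zero simp: continuous_at)
  qed
  ultimately have "((\<lambda>x. inv_into UNIV (A x) v - b) \<longlongrightarrow> 0) (at z)"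
    by (rule Lim_null_comparison)
  then show "isCont (\<lambda>x. inv_into UNIV (A x) v) z"
    by (simp add: continuous_at b_def LIM_zero_iff)
qed

lemma Ck_on_linear_inv:
  fixes A :: "'x::euclidean_space \<Rightarrow> 'a::euclidean_space \<Rightarrow> 'a"
  assumes S: "open S"
    and lin: "\<And>x. x \<in> S \<Longrightarrow> linear (A x)" and inj: "\<And>x. x \<in> S \<Longrightarrow> inj (A x)"
    and "\<And>w. Ck_on k (\<lambda>x. A x w) S"
  shows "Ck_on k (\<lambda>x. inv_into UNIV (A x) v) S"
  using assms(4)
proof (induction k arbitrary: v)
  case 0 then show ?case using continuous_on_linear_inv[of S A v] assms by simp
next
  case (Suc k)
  have surj: "A x (inv_into UNIV (A x) v) = v" if "x \<in> S" for x v
    using lin inj that linear_injective_imp_surjective surj_f_inv_f by metis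
  have blin: "linear (inv_into UNIV (A x))" if "x \<in> S" for x
    using inj_linear_imp_inv_linear lin inj that by blast
  obtain A' where A': "\<And>w x. x \<in> S \<Longrightarrow> ((\<lambda>x. A x w) has_derivative A' w x) (at x)"
     "\<And>w u. Ck_on k (\<lambda>x. A' w x u) S"
    using Suc.prems unfolding Ck_on.simps by metis
  define b where "b x = inv_into UNIV (A x) v" for x
  have ck: "Ck_on k (\<lambda>x. inv_into UNIV (A x) v) S" for v
    using Suc.IH Suc.prems Ck_on_Suc_imp by blast
  have cont: "continuous_on S (\<lambda>x. inv_into UNIV (A x) v)" for v
    using ck Ck_on_imp_continuous_on by blast
  have brep: "inv_into UNIV (A x) z = (\<Sum>i\<in>Basis. (z \<bullet> i) *\<^sub>R inv_into UNIV (A x) i)" if "x \<in> S" for x z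
    by (rule linear_basis_representation[OF blin[OF that]])
  \<comment> \<open>The classical differential of \<open>A^-1 v\<close>, namely
    \<open>- A^-1 (dA) A^-1 v\<close>, with the outer inverse expanded in the basis.\<close>
  define D where "D x u = - (\<Sum>i\<in>Basis. (A' (b x) x u \<bullet> i) *\<^sub>R inv_into UNIV (A x) i)" for x u
  \<comment> \<open>\<open>A'\<close> was chosen for each \<open>w\<close> separately; its linearity
    in \<open>w\<close> is recovered because it is used at \<open>w = b x\<close>, which moves with
    \<open>x\<close>.\<close>
  have Arep: "A' w x u = (\<Sum>i\<in>Basis. (w \<bullet> i) *\<^sub>R A' i x u)" if "x \<in> S" for w x u
  proof -
    have "((\<lambda>x. \<Sum>i\<in>Basis. (w \<bullet> i) *\<^sub>R A x i) has_derivative (\<lambda>u. \<Sum>i\<in>Basis. (w \<bullet> i) *\<^sub>R A' i x u)) (at x)"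
      using A'(1)[OF that] by (intro has_derivative_sum has_derivative_scaleR_right)
    moreover have "(\<Sum>i\<in>Basis. (w \<bullet> i) *\<^sub>R A y i) = A y w" if "y \<in> S" for y
      by (rule linear_basis_representation[OF lin[OF that], symmetric])
    ultimately have d: "((\<lambda>x. A x w) has_derivative (\<lambda>u. \<Sum>i\<in>Basis. (w \<bullet> i) *\<^sub>R A' i x u)) (at x)"
      by (rule has_derivative_transform_within_open[OF _ S that])
    then show ?thesis using has_derivative_unique[OF A'(1)[OF that, of w] d] by simp
  qed
  have "(b has_derivative D x) (at x)" if x: "x \<in> S" for x
  proof -
    \<comment> \<open>These are the summands of \<open>A_y^-1 (A_y (b x) - v)\<close>, which equals
      \<open>b x - b y\<close>. The bracket vanishes at \<open>y = x\<close>, so no derivative of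
      the inverse is presupposed.\<close>
    have 1: "((\<lambda>y. ((A y (b x) - v) \<bullet> i) *\<^sub>R inv_into UNIV (A y) i) has_derivative
          (\<lambda>u. (A' (b x) x u \<bullet> i) *\<^sub>R inv_into UNIV (A x) i)) (at x)" for i
    proof (rule has_derivative_scaleR_vanishing)
      have "((\<lambda>y. A y (b x) - v) has_derivative A' (b x) x) (at x)"
        using has_derivative_diff[OF A'(1)[OF x] has_derivative_const] by simp
      then show "((\<lambda>y. (A y (b x) - v) \<bullet> i) has_derivative (\<lambda>u. A' (b x) x u \<bullet> i)) (at x)"
        by (rule has_derivative_inner_left)
      show "(A x (b x) - v) \<bullet> i = 0" using surj[OF x] by (simp add: b_def)
      show "isCont (\<lambda>y. inv_into UNIV (A y) i) x" using cont S x continuous_on_eq_continuous_at by blast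
    qed
    have "((\<lambda>y. b x - (\<Sum>i\<in>Basis. ((A y (b x) - v) \<bullet> i) *\<^sub>R inv_into UNIV (A y) i)) has_derivative
        (\<lambda>u. 0 - (\<Sum>i\<in>Basis. (A' (b x) x u \<bullet> i) *\<^sub>R inv_into UNIV (A x) i))) (at x)"
      by (intro has_derivative_diff has_derivative_const has_derivative_sum 1)
    moreover have "b x - (\<Sum>i\<in>Basis. ((A y (b x) - v) \<bullet> i) *\<^sub>R inv_into UNIV (A y) i) = b y" if "y \<in> S" for y
    proof -
      have "(\<Sum>i\<in>Basis. ((A y (b x) - v) \<bullet> i) *\<^sub>R inv_into UNIV (A y) i) = inv_into UNIV (A y) (A y (b x) - v)"
        by (rule brep[OF that, symmetric])
      also have "\<dots> = b x - b y"
        using linear_diff[OF blin[OF that]] inj[OF that] by (simp add: b_def)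
      finally show ?thesis by simp
    qed
    ultimately show ?thesis
      using has_derivative_transform_within_open[OF _ S x, of _ "D x" UNIV b] by (simp add: D_def[abs_def])
  qed
  moreover have "Ck_on k (\<lambda>x. D x u) S" for u
  proof -
    have "Ck_on k (\<lambda>x. A' (b x) x u) S"
    proof (rule Ck_on_cong[OF S])
      show "Ck_on k (\<lambda>x. \<Sum>i\<in>Basis. (b x \<bullet> i) *\<^sub>R A' i x u) S"
        unfolding b_def by (intro Ck_on_sum Ck_on_bilinear[OF bounded_bilinear_scaleR]
          Ck_on_bilinear[OF bounded_bilinear_inner] Ck_on_const A' ck)
    qed (use Arep in auto)
    then have "Ck_on k (\<lambda>x. (-1) *\<^sub>R (\<Sum>i\<in>Basis. (A' (b x) x u \<bullet> i) *\<^sub>R inv_into UNIV (A x) i)) S"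
      by (intro Ck_on_sum Ck_on_bilinear[OF bounded_bilinear_scaleR]
          Ck_on_bilinear[OF bounded_bilinear_inner] Ck_on_const A' ck)
    then show ?thesis by (simp add: D_def)
  qed
  ultimately show ?case unfolding Ck_on.simps b_def by blast
qed

text \<open>Invariance of domain makes the inverse continuous. Its derivative is the inverse of
  \<open>f'\<close> at the inverse point, so each order of regularity reached for the inverse passes
  to its derivative and gives the next order.\<close>

lemma Ck_on_inv_into:
  fixes f :: "'a::euclidean_space \<Rightarrow> 'a"
  assumes S: "open S" and inj: "inj_on f S" and f: "Ck_on (Suc k) f S"
    and f': "\<And>x. x \<in> S \<Longrightarrow> (f has_derivative f' x) (at x)" "\<And>x. x \<in> S \<Longrightarrow> inj (f' x)"
  shows "Ck_on (Suc k) (inv_into S f) (f ` S)"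
proof -
  let ?g = "inv_into S f"
  have cont: "continuous_on S f" using f Ck_on_imp_continuous_on by blast
  have gc: "continuous_on (f ` S) ?g"
  proof -
    obtain g where g: "homeomorphism S (f ` S) f g"
      using invariance_of_domain_homeomorphism[OF S cont _ inj] by blast
    then have "?g y = g y" if "y \<in> f ` S" for y
      using that inj by (auto simp: homeomorphism_def)
    then show ?thesis using g continuous_on_cong homeomorphism_cont2 by metis
  qed
  have op: "open (f ` S)" using invariance_of_domain[OF cont S inj] .
  have lin: "linear (f' x)" if "x \<in> S" for x using f' that has_derivative_linear by blast
  have bij: "bij (f' x)" if "x \<in> S" for x
    using lin[OF that] f'(2)[OF that] linear_injective_imp_surjective unfolding bij_def by blast
  have d: "(?g has_derivative inv_into UNIV (f' (?g y))) (at y)" if y: "y \<in> f ` S" for y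
  proof -
    have gy: "?g y \<in> S" "f (?g y) = y" using y by (auto simp: inv_into_into f_inv_into_f)
    have "(?g has_derivative inv_into UNIV (f' (?g y))) (at (f (?g y)))"
    proof (rule has_derivative_inverse_basic_x[where f=f and x="?g y" and f'="f' (?g y)" and T="f ` S"])
      show "(f has_derivative f' (?g y)) (at (?g y))" using f' gy by auto
      show "bounded_linear (inv_into UNIV (f' (?g y)))"
        using inj_linear_imp_inv_linear lin f' gy linear_conv_bounded_linear by blast
      show "inv_into UNIV (f' (?g y)) \<circ> f' (?g y) = id" using f' gy by simp
      show "continuous (at (f (?g y))) ?g"
        using gc op y gy continuous_on_eq_continuous_at by fastforce
      show "?g (f (?g y)) = ?g y" by (simp add: gy)
      show "open (f ` S)" by fact
      show "f (?g y) \<in> f ` S" using gy by blast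
      show "\<And>y. y \<in> f ` S \<Longrightarrow> f (?g y) = y" by (rule f_inv_into_f)
    qed
    then show ?thesis by (simp add: gy)
  qed
  have "Ck_on j ?g (f ` S)" if "j \<le> Suc k" for j
    using that
  proof (induction j)
    case 0 then show ?case using gc by simp
  next
    case (Suc j)
    have g: "Ck_on j ?g (f ` S)" using Suc by simp
    obtain f'' where f'': "\<forall>x\<in>S. (f has_derivative f'' x) (at x)" "\<And>v. Ck_on k (\<lambda>x. f'' x v) S"
      using f by auto
    have eq: "f'' x = f' x" if "x \<in> S" for x
      using f'(1)[OF that] f''(1) that has_derivative_unique by blast
    have "Ck_on j (\<lambda>x. f' x v) S" for v
      by (rule Ck_on_cong[OF S _ Ck_on_le[OF f''(2)]]) (use eq Suc.prems in auto)
    then have "Ck_on j (\<lambda>y. f' (?g y) v) (f ` S)" for v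
      by (rule Ck_on_compose[OF op g]) (auto simp: inv_into_into)
    then have "Ck_on j (\<lambda>y. inv_into UNIV (f' (?g y)) v) (f ` S)" for v
      using lin f' by (intro Ck_on_linear_inv op) (auto simp: inv_into_into)
    then show ?case using d unfolding Ck_on.simps by (intro exI[of _ "\<lambda>y. inv_into UNIV (f' (?g y))"]) auto
  qed
  then show ?thesis by blast
qed


text \<open>Regularity of the germ at \<open>z\<close>. Orders in \<open>enat\<close> allow the
  \<open>C^1\<close> and the smooth case to be treated together; for \<open>\<infinity>\<close> a
  single neighbourhood serves all finite orders.\<close>

definition Ck_at :: "enat \<Rightarrow> ('e::euclidean_space \<Rightarrow> 'f::euclidean_space) \<Rightarrow> 'e \<Rightarrow> bool" where
  "Ck_at k f z \<longleftrightarrow> (\<exists>Z. open Z \<and> z \<in> Z \<and> (\<forall>j. enat j \<le> k \<longrightarrow> Ck_on j f Z))"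

lemma Ck_atI:
  "open Z \<Longrightarrow> z \<in> Z \<Longrightarrow> (\<And>j. enat j \<le> k \<Longrightarrow> Ck_on j f Z) \<Longrightarrow> Ck_at k f z"
  by (auto simp: Ck_at_def)

lemma Ck_atE:
  assumes "Ck_at k f z" "open U" "z \<in> U"
  obtains Z where "open Z" "z \<in> Z" "Z \<subseteq> U" "\<And>j. enat j \<le> k \<Longrightarrow> Ck_on j f Z"
proof -
  obtain Z where Z: "open Z" "z \<in> Z" "\<forall>j. enat j \<le> k \<longrightarrow> Ck_on j f Z"
    using assms(1) by (auto simp: Ck_at_def)
  show ?thesis
    by (rule that[of "Z \<inter> U"]) (use Z assms in \<open>auto intro: Ck_on_subset\<close>)
qed

lemma Ck_at_le: "Ck_at k f z \<Longrightarrow> j \<le> k \<Longrightarrow> Ck_at j f z"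
  unfolding Ck_at_def by (meson order_trans)

lemma Ck_at_cong:
  assumes "Ck_at k f z" "open U" "z \<in> U" "\<And>x. x \<in> U \<Longrightarrow> f x = g x"
  shows "Ck_at k g z"
proof -
  obtain Z where "open Z" "z \<in> Z" "Z \<subseteq> U" "\<And>j. enat j \<le> k \<Longrightarrow> Ck_on j f Z"
    by (rule Ck_atE[OF assms(1-3)]) blast
  then show ?thesis
    using assms(4) by (intro Ck_atI[of Z]) (auto intro: Ck_on_cong[of Z f])
qed

lemma Ck_at_eventually:
  assumes "Ck_at k f z" shows "\<exists>Z. open Z \<and> z \<in> Z \<and> (\<forall>y\<in>Z. Ck_at k f y)"
  using assms unfolding Ck_at_def by meson

lemma Ck_at_isCont: "Ck_at k f z \<Longrightarrow> isCont f z"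
  unfolding Ck_at_def
  by (metis Ck_on.simps(1) continuous_on_eq_continuous_at zero_enat_def zero_le)

lemma Ck_at_imp_Ck_on: "(\<And>z. z \<in> S \<Longrightarrow> Ck_at k f z) \<Longrightarrow> enat j \<le> k \<Longrightarrow> Ck_on j f S"
  by (rule Ck_on_local) (auto simp: Ck_at_def)

lemma smooth_on_iff_Ck_at: "open S \<Longrightarrow> smooth_on f S \<longleftrightarrow> (\<forall>z\<in>S. Ck_at \<infinity> f z)"
  unfolding smooth_on_def
  by (rule iffI) (blast intro: Ck_atI, simp add: Ck_at_imp_Ck_on[of S \<infinity>])

lemma Ck_on_1_iff_Ck_at:
  assumes "open S"
  shows "Ck_on 1 f S \<longleftrightarrow> (\<forall>z\<in>S. Ck_at 1 f z)"
proof
  assume f: "Ck_on 1 f S"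
  show "\<forall>z\<in>S. Ck_at 1 f z"
  proof
    fix z assume "z \<in> S"
    with assms show "Ck_at 1 f z"
    proof (rule Ck_atI)
      fix j assume "enat j \<le> 1"
      then have "j \<le> 1" by (simp add: one_enat_def)
      with f show "Ck_on j f S" by (rule Ck_on_le)
    qed
  qed
next
  assume "\<forall>z\<in>S. Ck_at 1 f z"
  then show "Ck_on 1 f S" using Ck_at_imp_Ck_on[of S 1 f 1] by (simp only: one_enat_def order_refl)
qed

lemma Ck_at_const: "Ck_at k (\<lambda>x. c) z"
  by (auto intro!: Ck_atI[of UNIV] Ck_on_const)

lemma Ck_at_bounded_linear: "bounded_linear f \<Longrightarrow> Ck_at k f z"
  by (auto intro!: Ck_atI[of UNIV] Ck_on_bounded_linear)

lemma Ck_at_ident: "Ck_at k (\<lambda>x. x) z"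
  by (rule Ck_at_bounded_linear) (rule bounded_linear_ident)

lemma Ck_at_bilinear:
  assumes "bounded_bilinear p" "Ck_at k f z" "Ck_at k g z"
  shows "Ck_at k (\<lambda>x. p (f x) (g x)) z"
proof -
  obtain U where U: "open U" "z \<in> U" "\<And>j. enat j \<le> k \<Longrightarrow> Ck_on j f U"
    using assms(2) by (auto simp: Ck_at_def)
  obtain V where V: "open V" "z \<in> V" "V \<subseteq> U" "\<And>j. enat j \<le> k \<Longrightarrow> Ck_on j g V"
    by (rule Ck_atE[OF assms(3) U(1,2)]) blast
  show ?thesis
    using U V by (intro Ck_atI[of V]) (auto intro!: Ck_on_bilinear[OF assms(1)] intro: Ck_on_subset)
qed

lemmas Ck_at_scaleR = Ck_at_bilinear[OF bounded_bilinear_scaleR]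

lemma Ck_at_add:
  assumes "Ck_at k f z" "Ck_at k g z"
  shows "Ck_at k (\<lambda>x. f x + g x) z"
proof -
  obtain U where U: "open U" "z \<in> U" "\<And>j. enat j \<le> k \<Longrightarrow> Ck_on j f U"
    using assms(1) by (auto simp: Ck_at_def)
  obtain V where V: "open V" "z \<in> V" "V \<subseteq> U" "\<And>j. enat j \<le> k \<Longrightarrow> Ck_on j g V"
    by (rule Ck_atE[OF assms(2) U(1,2)]) blast
  show ?thesis
    using U V by (intro Ck_atI[of V]) (auto intro!: Ck_on_add intro: Ck_on_subset)
qed

lemma Ck_at_compose:
  assumes "Ck_at k f z" "Ck_at k g (f z)"
  shows "Ck_at k (\<lambda>x. g (f x)) z"
proof -
  obtain V where V: "open V" "f z \<in> V" "\<And>j. enat j \<le> k \<Longrightarrow> Ck_on j g V"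
    using assms(2) by (auto simp: Ck_at_def)
  obtain W where W: "open W" "z \<in> W" "f ` W \<subseteq> V"
    using Ck_at_isCont[OF assms(1)] V unfolding continuous_at_open by (metis image_subsetI)
  obtain U where U: "open U" "z \<in> U" "U \<subseteq> W" "\<And>j. enat j \<le> k \<Longrightarrow> Ck_on j f U"
    by (rule Ck_atE[OF assms(1) W(1,2)]) blast
  show ?thesis
    using U V W by (intro Ck_atI[of U] Ck_on_compose[of U _ f g V]) blast+
qed

lemma Ck_at_linear_comp: "bounded_linear l \<Longrightarrow> Ck_at k f z \<Longrightarrow> Ck_at k (\<lambda>x. l (f x)) z"
  using Ck_at_compose[of k f z l] Ck_at_bounded_linear by blast

lemma Ck_at_diff: "Ck_at k f z \<Longrightarrow> Ck_at k g z \<Longrightarrow> Ck_at k (\<lambda>x. f x - g x) z"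
  using Ck_at_add[of k f z "\<lambda>x. - g x"] Ck_at_linear_comp[of uminus k g z]
  by (simp add: bounded_linear_minus[OF bounded_linear_ident])

lemma Ck_at_sum:
  "(\<And>i. i \<in> I \<Longrightarrow> Ck_at k (f i) z) \<Longrightarrow> Ck_at k (\<lambda>x. \<Sum>i\<in>I. f i x) z"
  by (induction I rule: infinite_finite_induct) (auto simp: Ck_at_const intro: Ck_at_add)

lemma Ck_at_1_has_derivative:
  assumes "Ck_at 1 f z"
  obtains f' where "(f has_derivative f') (at z)"
proof -
  obtain Z where "z \<in> Z" "Ck_on 1 f Z"
    using assms by (auto simp: Ck_at_def one_enat_def simp del: One_nat_def)
  then show ?thesis using that by auto
qed

text \<open>Injectivity of the derivative spreads from \<open>z\<close> to a neighbourhood by the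
  uniform lower bound, and \<open>Ck_on_inv_into\<close> applies there.\<close>

lemma Ck_at_inv_into:
  fixes f :: "'a::euclidean_space \<Rightarrow> 'a"
  assumes S: "open S" "z \<in> S" and inj: "inj_on f S" and f: "Ck_at k f z" and k: "k \<ge> 1"
    and f': "(f has_derivative f') (at z)" "inj f'"
  shows "Ck_at k (inv_into S f) (f z)"
proof -
  obtain Z where Z: "open Z" "z \<in> Z" "Z \<subseteq> S" "\<And>j. enat j \<le> k \<Longrightarrow> Ck_on j f Z"
    by (rule Ck_atE[OF f S]) blast
  have "enat (Suc 0) \<le> k" using k by (simp add: one_enat_def)
  then have "Ck_on (Suc 0) f Z" by (rule Z(4))
  then obtain F where F: "\<And>x. x \<in> Z \<Longrightarrow> (f has_derivative F x) (at x)" "\<And>v. continuous_on Z (\<lambda>x. F x v)"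
    unfolding Ck_on.simps by blast
  have lin: "linear (F x)" if "x \<in> Z" for x
    using F(1)[OF that] has_derivative_linear by blast
  have "F z = f'" using has_derivative_unique[OF F(1) f'(1)] Z by blast
  then obtain c where c: "c > 0" "eventually (\<lambda>x. \<forall>w. norm (F x w) \<ge> c * norm w) (at z)"
      "\<forall>w. norm (F z w) \<ge> c * norm w"
    by (rule_tac linear_inj_eventually_bounded_below[of Z F z]) (use F lin f' Z in auto)
  from c(2) obtain V where V': "open V" "z \<in> V" "\<forall>x\<in>V. x \<noteq> z \<longrightarrow> (\<forall>w. norm (F x w) \<ge> c * norm w)"
    unfolding eventually_at_topological by blast
  with c(3) have V: "open V" "z \<in> V" "\<And>x w. x \<in> V \<Longrightarrow> norm (F x w) \<ge> c * norm w"
    by (fast, fast, metis)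
  define T where "T = V \<inter> Z"
  have T: "open T" "z \<in> T" "T \<subseteq> S" using V Z by (auto simp: T_def)
  have injT: "inj_on f T" using inj T inj_on_subset by blast
  have injF: "inj (F x)" if "x \<in> T" for x
    using bounded_below_inj[OF lin c(1), of x] V that by (auto simp: T_def)
  have "Ck_on j (inv_into T f) (f ` T)" if "enat j \<le> k" for j
  proof -
    have ck: "Ck_on (Suc i) (inv_into T f) (f ` T)" if "enat (Suc i) \<le> k" for i
      using Ck_on_inv_into[OF T(1) injT Ck_on_subset[OF Z(4)[OF that]], of F] F(1) injF
      by (auto simp: T_def)
    \<comment> \<open>\<open>Ck_on_inv_into\<close> yields positive orders; order 0 is read off from
      order 1, which is available because \<open>k \<ge> 1\<close>.\<close>
    show ?thesis
    proof (cases j)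
      case 0 then show ?thesis using Ck_on_Suc_imp[OF ck[of 0]] k by (simp add: one_enat_def)
    qed (use ck that in auto)
  qed
  moreover have op: "open (f ` T)"
    using invariance_of_domain[OF _ T(1) injT] F(1) T
    by (metis Int_lower2 T_def continuous_at_imp_continuous_on has_derivative_continuous subsetD)
  ultimately have "Ck_at k (inv_into T f) (f z)" using T by (intro Ck_atI[of "f ` T"]) auto
  then show ?thesis
    by (rule Ck_at_cong[OF _ op]) (use T inj injT in \<open>auto simp: subset_iff\<close>)
qed

text \<open>By the chain rule, a \<open>C^1\<close> inverse already forces the derivative to be
  injective. This is what makes smoothness of a transition map in one direction suffice.\<close>

lemma Ck_at_inv_into_C1:
  fixes f :: "'a::euclidean_space \<Rightarrow> 'a"
  assumes S: "open S" "z \<in> S" and inj: "inj_on f S" and f: "Ck_at k f z" and k: "k \<ge> 1"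
    and g: "Ck_at 1 (inv_into S f) (f z)"
  shows "Ck_at k (inv_into S f) (f z)"
proof -
  obtain f' where f': "(f has_derivative f') (at z)"
    using Ck_at_1_has_derivative[OF Ck_at_le[OF f k]] .
  obtain g' where g': "(inv_into S f has_derivative g') (at (f z))"
    using Ck_at_1_has_derivative[OF g] .
  have "((\<lambda>x. inv_into S f (f x)) has_derivative (\<lambda>v. g' (f' v))) (at z)"
    using has_derivative_compose[OF f' g'] .
  then have "((\<lambda>x. x) has_derivative (\<lambda>v. g' (f' v))) (at z)"
    by (rule has_derivative_transform_within_open[OF _ S]) (use inj in auto)
  then have "(\<lambda>v. g' (f' v)) = (\<lambda>v. v)"
    using has_derivative_unique has_derivative_ident by blast
  then have "inj f'" by (metis injI)
  then show ?thesis using Ck_at_inv_into[OF S inj f k f'] by blast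
qed

section \<open>Smooth bumps and mollification\<close>

text \<open>The powers of \<open>1 / t\<close> make the family closed under differentiation up to
  linear combinations, so that smoothness of \<open>exp (- (1 / t))\<close> becomes an induction
  over all \<open>n\<close> at once.\<close>

definition flat_exp :: "nat \<Rightarrow> real \<Rightarrow> real" where
  "flat_exp n t = (if t > 0 then (1 / t) ^ n * exp (- (1 / t)) else 0)"

lemma flat_exp_tendsto_0: "(flat_exp n \<longlongrightarrow> 0) (at 0)"
proof -
  have "((\<lambda>t. (inverse t) ^ n / exp (inverse t)) \<longlongrightarrow> (0::real)) (at_right 0)"
    using tendsto_power_div_exp_0 filterlim_inverse_at_top_right by (rule filterlim_compose)
  moreover have "eventually (\<lambda>t. (inverse t) ^ n / exp (inverse t) = flat_exp n t) (at_right 0)"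
    by (auto simp: eventually_at_right_less flat_exp_def exp_minus divide_simps
        intro!: eventually_mono[OF eventually_at_right_less])
  ultimately have r: "(flat_exp n \<longlongrightarrow> 0) (at_right 0)" by (rule Lim_transform_eventually)
  have "(flat_exp n \<longlongrightarrow> 0) (at_left 0)"
    by (rule Lim_transform_eventually[OF tendsto_const])
      (auto simp: flat_exp_def intro!: eventually_mono[OF eventually_at_left_real[of "-1" 0]])
  with r show ?thesis by (simp add: filterlim_split_at)
qed

lemma flat_exp_derivative:
  "(flat_exp n has_real_derivative (flat_exp (n + 2) t - n * flat_exp (n + 1) t)) (at t)"
proof (cases t "0::real" rule: linorder_cases)
  case less
  have "((\<lambda>t. 0) has_real_derivative 0) (at t)" by simp
  then have "(flat_exp n has_real_derivative 0) (at t)"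
    by (rule has_field_derivative_transform_within_open[of _ _ _ "{..<0}"]) (use less in \<open>auto simp: flat_exp_def\<close>)
  then show ?thesis using less by (simp add: flat_exp_def)
next
  case equal
  \<comment> \<open>The difference quotient of \<open>flat_exp n\<close> at 0 is
    \<open>flat_exp (Suc n)\<close>, also for negative increments, where both vanish.\<close>
  have "((\<lambda>h. (flat_exp n (0 + h) - flat_exp n 0) / h) \<longlongrightarrow> 0) (at 0)"
    by (rule Lim_transform_eventually[OF flat_exp_tendsto_0[of "Suc n"]])
      (auto simp: flat_exp_def eventually_at_filter field_simps)
  then show ?thesis using equal by (simp add: DERIV_def flat_exp_def)
next
  case greater
  have "((\<lambda>t. (1 / t) ^ n * exp (- (1 / t))) has_real_derivative
      (flat_exp (n + 2) t - n * flat_exp (n + 1) t)) (at t)"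
    using greater
    by (auto intro!: derivative_eq_intros simp: flat_exp_def)
      (cases n; simp add: field_simps power2_eq_square)
  then show ?thesis
    by (rule has_field_derivative_transform_within_open[of _ _ _ "{0<..}"])
      (use greater in \<open>auto simp: flat_exp_def\<close>)
qed

lemma Ck_on_flat_exp: "Ck_on k (flat_exp n) UNIV"
proof (induction k arbitrary: n)
  case 0 show ?case
    using DERIV_isCont[OF flat_exp_derivative] by (simp add: continuous_at_imp_continuous_on)
next
  case (Suc k)
  have "(flat_exp n has_derivative (\<lambda>v. flat_exp (n + 2) t * v + flat_exp (n + 1) t * (- real n * v))) (at t)" for t
    using flat_exp_derivative[of n t] unfolding has_field_derivative_def
    by (rule has_derivative_eq_rhs) (auto simp: algebra_simps)
  moreover have "Ck_on k (\<lambda>t. flat_exp (n + 2) t * v + flat_exp (n + 1) t * (- real n * v)) UNIV" for v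
    by (intro Ck_on_add Ck_on_bilinear[OF bounded_bilinear_mult] Suc.IH Ck_on_const)
  ultimately show ?case
    unfolding Ck_on.simps
    by (intro exI[of _ "\<lambda>t v. flat_exp (n + 2) t * v + flat_exp (n + 1) t * (- real n * v)"]) blast
qed

lemma Ck_on_inverse: "Ck_on k (inverse :: real \<Rightarrow> real) (- {0})"
proof (induction k)
  case 0 show ?case by (auto intro!: continuous_intros)
next
  case (Suc k)
  have "(inverse has_derivative (\<lambda>v::real. - 1 * (inverse x * v * inverse x))) (at x)" if "x \<noteq> 0" for x
    using that by (auto intro!: derivative_eq_intros)
  moreover have "Ck_on k (\<lambda>x::real. - 1 * (inverse x * v * inverse x)) (- {0})" for v
    by (intro Ck_on_bilinear[OF bounded_bilinear_mult] Suc.IH Ck_on_const)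
  ultimately show ?case
    unfolding Ck_on.simps
    by (intro exI[of _ "\<lambda>x v. - 1 * (inverse x * v * inverse x)"]) blast
qed

lemma smooth_bump:
  fixes z :: "'e::euclidean_space"
  assumes "r > 0"
  obtains cut :: "'e \<Rightarrow> real" where "\<And>x. Ck_at \<infinity> cut x" "\<And>x. 0 \<le> cut x" "\<And>x. cut x \<le> 1"
    "\<And>x. x \<in> cball z r \<Longrightarrow> cut x = 1" "\<And>x. x \<notin> cball z (2 * r) \<Longrightarrow> cut x = 0"
proof -
  let ?e = "flat_exp 0"
  \<comment> \<open>\<open>s\<close> is a smooth step: it is 0 for \<open>t \<le> 0\<close>, where
    its numerator vanishes, and 1 for \<open>t \<ge> 1\<close>, where the second summand of the
    denominator does. The function \<open>q\<close> below is at least 1 on the inner ball and less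
    than -2 outside the outer one.\<close>
  define s where "s t = ?e t * inverse (?e t + ?e (1 + (-1) * t))" for t
  define q where "q x = 2 + (- inverse (r\<^sup>2)) * ((x - z) \<bullet> (x - z))" for x
  have nz: "?e t + ?e (1 + (-1) * t) > 0" for t
    by (cases "t > 0") (auto simp: flat_exp_def intro: add_pos_nonneg)
  have e: "Ck_at \<infinity> ?e t" for t by (rule Ck_atI[of UNIV]) (auto intro: Ck_on_flat_exp)
  have i: "Ck_at \<infinity> (inverse :: real \<Rightarrow> real) t" if "t \<noteq> 0" for t
    by (rule Ck_atI[of "- {0}"]) (use that in \<open>auto intro: Ck_on_inverse\<close>)
  have s: "Ck_at \<infinity> s t" for t
    unfolding s_def
  proof -
    have l: "Ck_at \<infinity> (\<lambda>t. ?e (1 + (-1) * t)) t"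
      by (rule Ck_at_compose[of _ "\<lambda>t. 1 + (-1) * t", OF _ e])
        (intro Ck_at_add Ck_at_bilinear[OF bounded_bilinear_mult] Ck_at_const Ck_at_ident)
    have "Ck_at \<infinity> (\<lambda>t. inverse (?e t + ?e (1 + (-1) * t))) t"
      by (rule Ck_at_compose[of _ "\<lambda>t. ?e t + ?e (1 + (-1) * t)", OF Ck_at_add[OF e l] i])
        (use nz[of t] in simp)
    then show "Ck_at \<infinity> (\<lambda>t. ?e t * inverse (?e t + ?e (1 + (-1) * t))) t"
      by (rule Ck_at_bilinear[OF bounded_bilinear_mult e])
  qed
  have q: "Ck_at \<infinity> q x" for x
    unfolding q_def
    by (intro Ck_at_bilinear[OF bounded_bilinear_mult] Ck_at_bilinear[OF bounded_bilinear_inner]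
        Ck_at_add Ck_at_diff Ck_at_const Ck_at_ident)
  have e0: "?e t \<ge> 0" for t by (simp add: flat_exp_def)
  show ?thesis
  proof (rule that[of "\<lambda>x. s (q x)"])
    show "Ck_at \<infinity> (\<lambda>x. s (q x)) x" for x using Ck_at_compose q s by blast
    show "0 \<le> s (q x)" for x using e0 nz[of "q x"] by (simp add: s_def)
    show "s (q x) \<le> 1" for x
      using e0 nz[of "q x"] by (simp add: s_def divide_simps flip: divide_inverse)
    show "s (q x) = 1" if "x \<in> cball z r" for x
    proof -
      have "(norm (x - z))\<^sup>2 \<le> r\<^sup>2" using that by (intro power_mono) (auto simp: dist_norm norm_minus_commute)
      then have "q x \<ge> 1" using assms by (simp add: q_def power2_norm_eq_inner field_simps)
      then show ?thesis using nz[of "q x"] by (simp add: s_def flat_exp_def)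
    qed
    show "s (q x) = 0" if "x \<notin> cball z (2 * r)" for x
    proof -
      have "(norm (x - z))\<^sup>2 > (2 * r)\<^sup>2" using that assms
        by (intro power_strict_mono) (auto simp: dist_norm norm_minus_commute)
      then have "4 * r\<^sup>2 < (x - z) \<bullet> (x - z)" by (simp add: power2_norm_eq_inner)
      then have "inverse (r\<^sup>2) * (4 * r\<^sup>2) < inverse (r\<^sup>2) * ((x - z) \<bullet> (x - z))"
        using assms by (intro mult_strict_left_mono) auto
      moreover have "inverse (r\<^sup>2) * (4 * r\<^sup>2) = 4" using assms by simp
      ultimately have "q x < 0" by (simp only: q_def)
      then show ?thesis by (simp add: s_def flat_exp_def)
    qed
  qed
qed

section \<open>Convolution with a smooth kernel\<close>

lemma leibniz_rule_directional:
  fixes f :: "'a::euclidean_space \<Rightarrow> 'b::euclidean_space \<Rightarrow> 'c::euclidean_space"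
  assumes D: "\<And>x t. ((\<lambda>x. f x t) has_derivative D x t) (at x)"
    and cont: "\<And>v. continuous_on (UNIV \<times> cbox a b) (\<lambda>(x, t). D x t v)"
    and f: "\<And>x. continuous_on (cbox a b) (f x)"
  shows "((\<lambda>x. integral (cbox a b) (f x)) has_derivative (\<lambda>v. integral (cbox a b) (\<lambda>t. D x t v))) (at x)"
proof -
  define fx where "fx x t = Blinfun (D x t)" for x t
  have ap: "blinfun_apply (fx x t) = D x t" for x t
    using has_derivative_bounded_linear[OF D] by (simp add: fx_def bounded_linear_Blinfun_apply)
  \<comment> \<open>In finite dimension, continuity of every directional derivative is continuity of
    the operator-valued derivative, the form in which \<open>leibniz_rule\<close> applies.\<close>
  have cf: "continuous_on (UNIV \<times> cbox a b) (\<lambda>(x, t). fx x t)"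
    using cont by (intro continuous_on_blinfun_componentwise) (simp add: case_prod_unfold ap)
  have "((\<lambda>x. integral (cbox a b) (f x)) has_derivative integral (cbox a b) (fx x)) (at x within UNIV)"
    by (rule leibniz_rule) (use D cf f in \<open>auto simp: ap intro: integrable_continuous\<close>)
  moreover have "continuous_on (cbox a b) (fx x)"
    using continuous_on_compose2[OF cf, of "cbox a b" "\<lambda>t. (x, t)"]
    by (auto simp: continuous_on_Pair continuous_on_const continuous_on_id)
  then have "blinfun_apply (integral (cbox a b) (fx x)) = (\<lambda>v. integral (cbox a b) (\<lambda>t. D x t v))"
    by (simp add: fun_eq_iff blinfun_apply_integral integrable_continuous ap)
  ultimately show ?thesis by simp
qed

lemma continuous_on_convolution_kernel:
  fixes f :: "'e::real_normed_vector \<Rightarrow> 'f::real_normed_vector"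
  assumes "continuous_on UNIV h" "continuous_on UNIV f"
  shows "continuous_on S (\<lambda>(x, y). h (x - y) *\<^sub>R f y)" "continuous_on T (\<lambda>y. h (x - y) *\<^sub>R f y)"
  unfolding case_prod_unfold
  by (intro continuous_on_scaleR continuous_on_compose2[OF assms(1)] continuous_on_compose2[OF assms(2)]
      continuous_on_diff continuous_on_fst continuous_on_snd continuous_on_id continuous_on_const; simp)+

text \<open>All derivatives fall on the kernel, so the regularity of the convolution is that of
  \<open>\<eta>\<close>.\<close>

lemma Ck_on_convolution:
  fixes f :: "'e::euclidean_space \<Rightarrow> 'f::euclidean_space"
  assumes f: "continuous_on UNIV f"
  shows "Ck_on k \<eta> UNIV \<Longrightarrow> Ck_on k (\<lambda>x. integral (cbox a b) (\<lambda>y. \<eta> (x - y) *\<^sub>R f y)) UNIV"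
proof (induction k arbitrary: \<eta>)
  case 0
  then have "continuous_on (UNIV \<times> cbox a b) (\<lambda>(x, y). \<eta> (x - y) *\<^sub>R f y)"
    using f by (intro continuous_on_convolution_kernel) auto
  then show ?case by (auto intro: integral_continuous_on_param)
next
  case (Suc k)
  then obtain \<eta>' where e: "\<And>x. (\<eta> has_derivative \<eta>' x) (at x)" "\<And>v. Ck_on k (\<lambda>x. \<eta>' x v) UNIV"
    unfolding Ck_on.simps by blast
  have c: "continuous_on UNIV \<eta>" "\<And>v. continuous_on UNIV (\<lambda>x. \<eta>' x v)"
    using Suc.prems e(2) Ck_on_imp_continuous_on by blast+
  have "((\<lambda>x. integral (cbox a b) (\<lambda>y. \<eta> (x - y) *\<^sub>R f y)) has_derivative
      (\<lambda>v. integral (cbox a b) (\<lambda>y. \<eta>' (x - y) v *\<^sub>R f y))) (at x)" for x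
  proof (rule leibniz_rule_directional)
    show "((\<lambda>x. \<eta> (x - y) *\<^sub>R f y) has_derivative (\<lambda>v. \<eta>' (x - y) v *\<^sub>R f y)) (at x)" for x y
    proof (rule has_derivative_scaleR_left)
      have "((\<lambda>x. x - y) has_derivative (\<lambda>v. v)) (at x)"
        by (auto intro!: derivative_eq_intros)
      then show "((\<lambda>x. \<eta> (x - y)) has_derivative \<eta>' (x - y)) (at x)"
        using has_derivative_compose[of "\<lambda>x. x - y" "\<lambda>v. v" x UNIV \<eta>, OF _ e(1)] by simp
    qed
    show "continuous_on (UNIV \<times> cbox a b) (\<lambda>(x, y). \<eta>' (x - y) v *\<^sub>R f y)" for v
      by (rule continuous_on_convolution_kernel[OF c(2) f])
    show "continuous_on (cbox a b) (\<lambda>y. \<eta> (x - y) *\<^sub>R f y)" for x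
      by (rule continuous_on_convolution_kernel[OF c(1) f])
  qed
  then show ?case
    unfolding Ck_on.simps using Suc.IH[OF e(2)]
    by (intro exI[of _ "\<lambda>x v. integral (cbox a b) (\<lambda>y. \<eta>' (x - y) v *\<^sub>R f y)"]) blast
qed

lemma uniformly_continuous_compact_support:
  fixes g :: "'e::euclidean_space \<Rightarrow> 'h::real_normed_vector"
  assumes g: "continuous_on UNIV g" and z: "\<And>x. x \<notin> cball z R \<Longrightarrow> g x = 0" and "\<epsilon> > 0"
  obtains \<delta> where "\<delta> > 0" "\<And>x w. norm w \<le> \<delta> \<Longrightarrow> norm (g (x - w) - g x) \<le> \<epsilon>"
proof -
  have "uniformly_continuous_on (cball z (R + 2)) g"
    using g by (intro compact_uniformly_continuous) (auto intro: continuous_on_subset)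
  then obtain d where d: "d > 0" "\<And>x y. x \<in> cball z (R + 2) \<Longrightarrow> y \<in> cball z (R + 2) \<Longrightarrow>
      dist y x < d \<Longrightarrow> dist (g y) (g x) < \<epsilon>"
    unfolding uniformly_continuous_on_def using \<open>\<epsilon> > 0\<close> by metis
  \<comment> \<open>A shift of length at most 1 leaves two cases: both points lie in the ball of
    radius \<open>R + 2\<close>, where uniform continuity holds, or both lie outside the support.
    Halving \<open>d\<close> gives the strict inequality.\<close>
  define \<delta> where "\<delta> = min 1 (d / 2)"
  have "norm (g (x - w) - g x) \<le> \<epsilon>" if w: "norm w \<le> \<delta>" for x w
  proof (cases "x \<in> cball z (R + 1)")
    case True
    have "dist z (x - w) \<le> dist z x + norm w"
      using norm_triangle_ineq[of "z - x" w] by (simp add: dist_norm algebra_simps)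
    then have "x - w \<in> cball z (R + 2)" "x \<in> cball z (R + 2)" "dist (x - w) x < d"
      using True w d(1) by (auto simp: \<delta>_def dist_norm min_le_iff_disj)
    then show ?thesis using d(2)[of x "x - w"] by (simp add: dist_norm)
  next
    case False
    have "dist z x \<le> dist z (x - w) + norm w"
      using norm_triangle_ineq[of "z - (x - w)" "- w"] by (simp add: dist_norm algebra_simps)
    then have "x - w \<notin> cball z R" "x \<notin> cball z R"
      using False w by (auto simp: \<delta>_def)
    then show ?thesis using z \<open>\<epsilon> > 0\<close> by simp
  qed
  then show ?thesis using that[of \<delta>] d(1) by (simp add: \<delta>_def)
qed


text \<open>The substitution \<open>w = x - y\<close>. With the shift in the kernel the integral is
  seen to be smooth; with the shift in \<open>f\<close> its derivative is an average of derivatives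
  of \<open>f\<close>, hence close to them. The boxes contain the supports, so both sides are
  integrals over the whole space.\<close>

lemma convolution_commute:
  fixes f :: "'e::euclidean_space \<Rightarrow> 'f::euclidean_space"
  assumes h: "continuous_on UNIV h" and f: "continuous_on UNIV f"
    and "\<And>y. y \<notin> cbox a b \<Longrightarrow> f y = 0" "\<And>y. y \<notin> cbox c d \<Longrightarrow> h y = 0"
  shows "integral (cbox a b) (\<lambda>y. h (x - y) *\<^sub>R f y) = integral (cbox c d) (\<lambda>w. h w *\<^sub>R f (x - w))"
proof -
  define I where "I = integral (cbox a b) (\<lambda>y. h (x - y) *\<^sub>R f y)"
  have "((\<lambda>y. h (x - y) *\<^sub>R f y) has_integral I) (cbox a b)"
    unfolding I_def using continuous_on_convolution_kernel(2)[OF h f]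
    by (intro integrable_integral integrable_continuous)
  then have "((\<lambda>w. h (x - ((-1) *\<^sub>R w + x)) *\<^sub>R f ((-1) *\<^sub>R w + x)) has_integral
      (1 / \<bar>-1\<bar> ^ DIM('e)) *\<^sub>R I) ((\<lambda>w. (1 / (-1)) *\<^sub>R w + - ((1 / (-1)) *\<^sub>R x)) ` cbox a b)"
    by (rule has_integral_affinity) simp
  then have "((\<lambda>w. h w *\<^sub>R f (x - w)) has_integral I) ((\<lambda>w. x - w) ` cbox a b)"
    by simp
  moreover have "f (x - w) = 0" if "w \<notin> (\<lambda>w. x - w) ` cbox a b" for w
    using that assms(3)[of "x - w"] by (metis diff_diff_eq2 add_diff_cancel_left' image_eqI)
  then have "h w *\<^sub>R f (x - w) = 0" if "w \<notin> (\<lambda>w. x - w) ` cbox a b" for w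
    using that by simp
  ultimately have "((\<lambda>w. h w *\<^sub>R f (x - w)) has_integral I) UNIV"
    by (rule has_integral_on_superset[OF _ _ subset_UNIV])
  then have "((\<lambda>w. if w \<in> cbox c d then h w *\<^sub>R f (x - w) else 0) has_integral I) UNIV"
    by (rule has_integral_eq[rotated]) (use assms(4) in auto)
  then show ?thesis by (simp only: has_integral_restrict_UNIV I_def[symmetric] integral_unique)
qed

lemma smooth_kernel:
  assumes "\<delta> > 0"
  obtains \<eta> :: "'e::euclidean_space \<Rightarrow> real" where "\<And>x. Ck_at \<infinity> \<eta> x" "\<And>x. 0 \<le> \<eta> x"
    "\<And>x. x \<notin> cball 0 \<delta> \<Longrightarrow> \<eta> x = 0"
    "\<And>c d. cball 0 \<delta> \<subseteq> cbox c d \<Longrightarrow> (\<eta> has_integral 1) (cbox c d)"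
proof -
  obtain b :: "'e \<Rightarrow> real" where b: "\<And>x. Ck_at \<infinity> b x" "\<And>x. 0 \<le> b x" "\<And>x. b x \<le> 1"
    "\<And>x. x \<in> cball 0 (\<delta> / 2) \<Longrightarrow> b x = 1" "\<And>x. x \<notin> cball 0 (2 * (\<delta> / 2)) \<Longrightarrow> b x = 0"
    using smooth_bump[of "\<delta> / 2" "0::'e"] assms by auto
  have bc: "continuous_on S b" for S
    using Ck_at_isCont[OF b(1)] by (simp add: continuous_at_imp_continuous_on)
  obtain p q :: 'e where pq: "cball 0 \<delta> \<subseteq> cbox p q"
    by (rule bounded_subset_cbox_symmetric[OF bounded_cball[of "0::'e" \<delta>]]) (rule that)
  define I where "I = integral (cbox p q) b"
  have "(b has_integral I) (cbox p q)"
    unfolding I_def by (intro integrable_integral integrable_continuous bc)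
  then have U: "(b has_integral I) UNIV"
    by (rule has_integral_on_superset) (use b(5) pq in \<open>auto simp: subset_iff\<close>)
  have I: "(b has_integral I) (cbox c d)" if "cball 0 \<delta> \<subseteq> cbox c d" for c d
  proof -
    have "((\<lambda>x. if x \<in> cbox c d then b x else 0) has_integral I) UNIV"
      by (rule has_integral_eq[OF _ U]) (use b(5) that in \<open>auto simp: subset_iff\<close>)
    then show ?thesis by (simp only: has_integral_restrict_UNIV)
  qed
  \<comment> \<open>The bump is 1 on a small box around 0, whose volume bounds \<open>I\<close> from
    below.\<close>
  have "I > 0"
  proof -
    obtain u v where u: "(0::'e) \<in> box u v" "box u v \<subseteq> ball (0::'e) (\<delta> / 2)"
      using rational_boxes[of "\<delta> / 2" "0::'e"] assms by auto
    then have "box u v \<noteq> {}" by blast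
    then have "cbox u v = closure (box u v)" by (rule closure_box[symmetric])
    also have "\<dots> \<subseteq> closure (ball (0::'e) (\<delta> / 2))" using u(2) by (rule closure_mono)
    finally have uv: "(0::'e) \<in> box u v" "cbox u v \<subseteq> cball (0::'e) (\<delta> / 2)"
      using u assms by auto
    have "cbox u v \<subseteq> cbox p q" using uv(2) pq assms by (fastforce simp: subset_iff)
    then have "integral (cbox u v) b \<le> integral (cbox p q) b"
      using b(2) by (intro integral_subset_le integrable_continuous bc) auto
    moreover have "integral (cbox u v) b = integral (cbox u v) (\<lambda>x. 1)"
      by (rule Henstock_Kurzweil_Integration.integral_cong) (use b(4) uv in \<open>auto simp: subset_iff\<close>)
    moreover have "measure lborel (cbox u v) > 0"
      using uv(1) content_pos_lt_eq[of u v] by (auto simp: mem_box intro: less_trans)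
    ultimately show ?thesis by (simp add: I_def)
  qed
  show ?thesis
  proof (rule that[of "\<lambda>x. inverse I * b x"])
    show "Ck_at \<infinity> (\<lambda>x. inverse I * b x) x" for x
      by (intro Ck_at_bilinear[OF bounded_bilinear_mult] b Ck_at_const)
    show "((\<lambda>x. inverse I * b x) has_integral 1) (cbox c d)" if "cball 0 \<delta> \<subseteq> cbox c d" for c d
      using has_integral_mult_right[OF I[OF that], of "inverse I"] \<open>I > 0\<close> by simp
  qed (use \<open>I > 0\<close> b in auto)
qed

text \<open>\<open>\<eta>\<close> is a probability density concentrated where \<open>g\<close>
  differs from \<open>g x\<close> by at most \<open>\<epsilon>\<close>.\<close>

lemma kernel_average_close:
  fixes g :: "'e::euclidean_space \<Rightarrow> 'f::euclidean_space"
  assumes \<eta>: "continuous_on UNIV \<eta>" "\<And>x. 0 \<le> \<eta> x" "\<And>x. x \<notin> cball 0 \<delta> \<Longrightarrow> \<eta> x = 0"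
      "(\<eta> has_integral 1) (cbox c d)"
    and g: "continuous_on UNIV g" and close: "\<And>w. norm w \<le> \<delta> \<Longrightarrow> norm (g (x - w) - g x) \<le> \<epsilon>"
  shows "norm (integral (cbox c d) (\<lambda>w. \<eta> w *\<^sub>R g (x - w)) - g x) \<le> \<epsilon>"
proof -
  have c: "continuous_on S (\<lambda>w. \<eta> w *\<^sub>R g (x - w))" for S
    by (intro continuous_on_scaleR continuous_on_compose2[OF g] continuous_on_subset[OF \<eta>(1)]
        continuous_on_diff continuous_on_const continuous_on_id) auto
  have g0: "((\<lambda>w. \<eta> w *\<^sub>R g x) has_integral 1 *\<^sub>R g x) (cbox c d)"
    using has_integral_scaleR_left[OF \<eta>(4)] by blast
  have g1: "((\<lambda>w. \<eta> w *\<^sub>R g (x - w)) has_integral integral (cbox c d) (\<lambda>w. \<eta> w *\<^sub>R g (x - w))) (cbox c d)"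
    using c by (intro integrable_integral integrable_continuous)
  have h: "((\<lambda>w. \<eta> w *\<^sub>R g (x - w) - \<eta> w *\<^sub>R g x) has_integral
      integral (cbox c d) (\<lambda>w. \<eta> w *\<^sub>R g (x - w)) - g x) (cbox c d)"
    using has_integral_diff[OF g1 g0] by simp
  have e: "((\<lambda>w. \<eta> w * \<epsilon>) has_integral 1 * \<epsilon>) (cbox c d)"
    using has_integral_mult_left[OF \<eta>(4)] by blast
  have "norm (integral (cbox c d) (\<lambda>w. \<eta> w *\<^sub>R g (x - w) - \<eta> w *\<^sub>R g x)) \<le> integral (cbox c d) (\<lambda>w. \<eta> w * \<epsilon>)"
  proof (rule Henstock_Kurzweil_Integration.integral_norm_bound_integral)
    fix w
    show "norm (\<eta> w *\<^sub>R g (x - w) - \<eta> w *\<^sub>R g x) \<le> \<eta> w * \<epsilon>"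
    proof (cases "norm w \<le> \<delta>")
      case True
      then show ?thesis using close[OF True] \<eta>(2)[of w]
        by (simp flip: scaleR_diff_right) (simp add: mult_left_mono)
    next
      case False then show ?thesis using \<eta>(3)[of w] by simp
    qed
  qed (use h e in auto)
  then show ?thesis unfolding integral_unique[OF h] integral_unique[OF e] by simp
qed

lemma C1_mollification:
  fixes f :: "'e::euclidean_space \<Rightarrow> 'f::euclidean_space"
  assumes f: "\<And>x. Ck_at 1 f x" and f': "\<And>x. (f has_derivative f' x) (at x)"
    and z: "\<And>x. x \<notin> cball z R \<Longrightarrow> f x = 0" and "\<epsilon> > 0"
  obtains F F' where "\<And>x. Ck_at \<infinity> F x" "\<And>x. (F has_derivative F' x) (at x)"
    "\<And>x. norm (F x - f x) \<le> \<epsilon>" "\<And>x v. norm (F' x v - f' x v) \<le> \<epsilon> * norm v"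
proof -
  have fc: "continuous_on UNIV f" using Ck_at_isCont[OF f] by (simp add: continuous_at_imp_continuous_on)
  have "Ck_on 1 f UNIV" using f Ck_on_1_iff_Ck_at[of UNIV f] by simp
  then obtain f'' where f'': "\<And>x. (f has_derivative f'' x) (at x)" "\<And>v. continuous_on UNIV (\<lambda>x. f'' x v)"
    by auto
  have "f'' x = f' x" for x using has_derivative_unique[OF f''(1) f'] .
  then have f'c: "continuous_on UNIV (\<lambda>x. f' x v)" for v using f''(2) by simp
  have f'0: "f' x = (\<lambda>v. 0)" if "x \<notin> cball z R" for x
  proof -
    have "((\<lambda>x. 0) has_derivative f' x) (at x)"
      by (rule has_derivative_transform_within_open[OF f', of "- cball z R"]) (use that z in auto)
    then show ?thesis using has_derivative_unique has_derivative_const by blast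
  qed
  \<comment> \<open>Uniform continuity is applied to the derivative as an operator, so that the
    resulting bound \<open>\<epsilon> * norm v\<close> holds with one \<open>\<delta>\<close> for
    all \<open>v\<close>.\<close>
  define Df where "Df x = Blinfun (f' x)" for x
  have Df: "blinfun_apply (Df x) = f' x" for x
    using has_derivative_bounded_linear[OF f'] by (simp add: Df_def bounded_linear_Blinfun_apply)
  have Dc: "continuous_on UNIV Df"
    using f'c by (intro continuous_on_blinfun_componentwise) (simp add: Df)
  have D0: "Df x = 0" if "x \<notin> cball z R" for x
    using f'0[OF that] Df[of x] by (metis blinfun_eqI zero_blinfun.rep_eq)
  obtain \<delta>1 where d1: "\<delta>1 > 0" "\<And>x w. norm w \<le> \<delta>1 \<Longrightarrow> norm (f (x - w) - f x) \<le> \<epsilon>"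
    by (rule uniformly_continuous_compact_support[OF fc z \<open>\<epsilon> > 0\<close>]) auto
  obtain \<delta>2 where d2: "\<delta>2 > 0" "\<And>x w. norm w \<le> \<delta>2 \<Longrightarrow> norm (Df (x - w) - Df x) \<le> \<epsilon>"
    by (rule uniformly_continuous_compact_support[OF Dc D0 \<open>\<epsilon> > 0\<close>]) auto
  define \<delta> where "\<delta> = min \<delta>1 \<delta>2"
  have "\<delta> > 0" using d1 d2 by (simp add: \<delta>_def)
  then obtain \<eta> :: "'e \<Rightarrow> real" where \<eta>: "\<And>x. Ck_at \<infinity> \<eta> x" "\<And>x. 0 \<le> \<eta> x"
    "\<And>x. x \<notin> cball 0 \<delta> \<Longrightarrow> \<eta> x = 0"
    "\<And>c d. cball 0 \<delta> \<subseteq> cbox c d \<Longrightarrow> (\<eta> has_integral 1) (cbox c d)"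
    by (rule smooth_kernel) blast
  have \<eta>c: "continuous_on UNIV \<eta>" using Ck_at_isCont[OF \<eta>(1)] by (simp add: continuous_at_imp_continuous_on)
  obtain a b :: 'e where ab: "cball z R \<subseteq> cbox a b"
    by (rule bounded_subset_cbox_symmetric[OF bounded_cball[of z R]]) (rule that)
  obtain c d :: 'e where cd: "cball 0 \<delta> \<subseteq> cbox c d"
    by (rule bounded_subset_cbox_symmetric[OF bounded_cball[of "0::'e" \<delta>]]) (rule that)
  define F where "F x = integral (cbox a b) (\<lambda>y. \<eta> (x - y) *\<^sub>R f y)" for x
  define F' where "F' x v = integral (cbox c d) (\<lambda>w. \<eta> w *\<^sub>R f' (x - w) v)" for x v
  have F2: "F = (\<lambda>x. integral (cbox c d) (\<lambda>w. \<eta> w *\<^sub>R f (x - w)))"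
  proof
    fix x show "F x = integral (cbox c d) (\<lambda>w. \<eta> w *\<^sub>R f (x - w))"
      unfolding F_def by (rule convolution_commute[OF \<eta>c fc z \<eta>(3)]) (use ab cd in auto)
  qed
  show ?thesis
  proof (rule that)
    show "Ck_at \<infinity> F x" for x
    proof (rule Ck_atI[of UNIV])
      fix j
      have "Ck_on j \<eta> UNIV" by (rule Ck_at_imp_Ck_on[OF \<eta>(1)]) simp
      then show "Ck_on j F UNIV" unfolding F_def by (rule Ck_on_convolution[OF fc])
    qed auto
    show "(F has_derivative F' x) (at x)" for x
      unfolding F2 F'_def[abs_def]
    proof (rule leibniz_rule_directional)
      show "((\<lambda>x. \<eta> w *\<^sub>R f (x - w)) has_derivative (\<lambda>v. \<eta> w *\<^sub>R f' (x - w) v)) (at x)" for x w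
      proof (rule has_derivative_scaleR_right)
        have "((\<lambda>x. x - w) has_derivative (\<lambda>v. v)) (at x)"
          by (auto intro!: derivative_eq_intros)
        then show "((\<lambda>x. f (x - w)) has_derivative f' (x - w)) (at x)"
          using has_derivative_compose[of "\<lambda>x. x - w" "\<lambda>v. v" x UNIV f, OF _ f'] by simp
      qed
      show "continuous_on (UNIV \<times> cbox c d) (\<lambda>(x, w). \<eta> w *\<^sub>R f' (x - w) v)" for v
        unfolding case_prod_unfold
        by (intro continuous_on_scaleR continuous_on_compose2[OF \<eta>c] continuous_on_compose2[OF f'c]
            continuous_on_diff continuous_on_fst continuous_on_snd continuous_on_id) auto
      show "continuous_on (cbox c d) (\<lambda>w. \<eta> w *\<^sub>R f (x - w))" for x
        by (intro continuous_on_scaleR continuous_on_compose2[OF \<eta>c] continuous_on_compose2[OF fc]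
            continuous_on_diff continuous_on_const continuous_on_id) auto
    qed
    show "norm (F x - f x) \<le> \<epsilon>" for x
      unfolding F2
    proof (rule kernel_average_close[OF \<eta>c \<eta>(2) \<eta>(3) \<eta>(4)[OF cd] fc])
      fix w :: 'e assume "norm w \<le> \<delta>"
      then show "norm (f (x - w) - f x) \<le> \<epsilon>" using d1(2) by (simp add: \<delta>_def)
    qed
    show "norm (F' x v - f' x v) \<le> \<epsilon> * norm v" for x v
      unfolding F'_def
    proof (rule kernel_average_close[OF \<eta>c \<eta>(2) \<eta>(3) \<eta>(4)[OF cd] f'c])
      fix w :: 'e assume "norm w \<le> \<delta>"
      then have "norm (Df (x - w) - Df x) \<le> \<epsilon>" using d2 by (simp add: \<delta>_def)
      then have "norm (Df (x - w) - Df x) * norm v \<le> \<epsilon> * norm v" by (rule mult_right_mono) simp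
      then have "norm (blinfun_apply (Df (x - w) - Df x) v) \<le> \<epsilon> * norm v"
        by (rule order_trans[OF norm_blinfun])
      then show "norm (f' (x - w) v - f' x v) \<le> \<epsilon> * norm v"
        by (simp add: blinfun.diff_left Df)
    qed
  qed
qed

section \<open>Local smoothing and \<open>C\<^sup>1\<close> inverses\<close>

text \<open>On a compact set each of the finitely many basis derivatives is bounded by continuity,
  and the sum of these bounds serves for all directions.\<close>

lemma Ck_at_derivative_bounded:
  assumes "compact Q" and f: "\<And>z. z \<in> Q \<Longrightarrow> Ck_at 1 f z"
  obtains C where "C \<ge> 0" "\<And>z D v. z \<in> Q \<Longrightarrow> (f has_derivative D) (at z) \<Longrightarrow> norm (D v) \<le> C * norm v"
proof -
  define S where "S = {z. Ck_at 1 f z}"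
  have "open S"
  proof (rule Topological_Spaces.openI)
    fix z assume "z \<in> S"
    then have "Ck_at 1 f z" by (simp add: S_def)
    from Ck_at_eventually[OF this] show "\<exists>T. open T \<and> z \<in> T \<and> T \<subseteq> S"
      by (auto simp: S_def subset_iff)
  qed
  then have "Ck_on 1 f S" by (subst Ck_on_1_iff_Ck_at) (auto simp: S_def)
  then obtain f' where f': "\<And>z. z \<in> S \<Longrightarrow> (f has_derivative f' z) (at z)" "\<And>v. continuous_on S (\<lambda>z. f' z v)"
    by auto
  have QS: "Q \<subseteq> S" using f by (auto simp: S_def)
  have "\<exists>B. \<forall>z\<in>Q. norm (f' z b) \<le> B" for b
  proof -
    have "compact ((\<lambda>z. f' z b) ` Q)"
      using f'(2) QS assms(1) by (meson compact_continuous_image continuous_on_subset)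
    then show ?thesis using compact_imp_bounded by (fastforce simp: bounded_iff)
  qed
  then obtain B where B: "\<And>b z. z \<in> Q \<Longrightarrow> norm (f' z b) \<le> B b" by metis
  define C where "C = (\<Sum>b\<in>Basis. \<bar>B b\<bar>)"
  have "norm (D v) \<le> C * norm v" if "z \<in> Q" "(f has_derivative D) (at z)" for z D v
  proof -
    have "D = f' z" using has_derivative_unique[OF that(2) f'(1)] that QS by blast
    moreover have l: "linear (f' z)" using f'(1) QS that has_derivative_linear by blast
    have "f' z v = (\<Sum>b\<in>Basis. (v \<bullet> b) *\<^sub>R f' z b)"
      by (rule linear_basis_representation[OF l])
    moreover have "norm (\<Sum>b\<in>Basis. (v \<bullet> b) *\<^sub>R f' z b) \<le> (\<Sum>b\<in>Basis. \<bar>B b\<bar> * norm v)"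
    proof (rule sum_norm_le)
      fix b :: 'a assume "b \<in> Basis"
      then have "\<bar>v \<bullet> b\<bar> \<le> norm v" using Basis_le_norm by blast
      moreover have "norm (f' z b) \<le> \<bar>B b\<bar>" using B[OF that(1), of b] by simp
      ultimately show "norm ((v \<bullet> b) *\<^sub>R f' z b) \<le> \<bar>B b\<bar> * norm v"
        by (simp add: mult.commute mult_mono)
    qed
    ultimately show ?thesis by (simp add: C_def sum_distrib_right)
  qed
  moreover have "C \<ge> 0" by (simp add: C_def sum_nonneg)
  ultimately show ?thesis using that by blast
qed

text \<open>The radii are nested: \<open>f\<close> is controlled up to \<open>4 * r\<close>, the
  correction \<open>p\<close> lives within \<open>2 * r\<close>, and \<open>f + p\<close> is smooth
  within \<open>r\<close>. The last clause speaks of \<open>p\<close> alone because translates of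
  \<open>p\<close> will be summed without \<open>f\<close>.\<close>

lemma local_smoothing:
  fixes f :: "'e::euclidean_space \<Rightarrow> 'f::euclidean_space"
  assumes r: "r > 0" and f: "\<And>z. z \<in> cball c (4 * r) \<Longrightarrow> Ck_at 1 f z" and "\<epsilon> > 0"
  obtains p where "\<And>z. Ck_at 1 p z" "\<And>z. z \<notin> cball c (2 * r) \<Longrightarrow> p z = 0"
    "\<And>z D v. (p has_derivative D) (at z) \<Longrightarrow> norm (D v) \<le> \<epsilon> * norm v"
    "\<And>z. z \<in> ball c r \<Longrightarrow> Ck_at \<infinity> (\<lambda>z. f z + p z) z"
    "\<And>z. Ck_at \<infinity> f z \<Longrightarrow> Ck_at \<infinity> p z"
proof -
  obtain \<beta> :: "'e \<Rightarrow> real" where \<beta>: "\<And>x. Ck_at \<infinity> \<beta> x" "\<And>x. 0 \<le> \<beta> x" "\<And>x. \<beta> x \<le> 1"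
    "\<And>x. x \<in> cball c r \<Longrightarrow> \<beta> x = 1" "\<And>x. x \<notin> cball c (2 * r) \<Longrightarrow> \<beta> x = 0"
    by (rule smooth_bump[OF r, of c]) (rule that)
  have r2: "2 * r > 0" using r by simp
  obtain \<beta>2 :: "'e \<Rightarrow> real" where \<beta>2: "\<And>x. Ck_at \<infinity> \<beta>2 x"
    "\<And>x. x \<in> cball c (2 * r) \<Longrightarrow> \<beta>2 x = 1" "\<And>x. x \<notin> cball c (2 * (2 * r)) \<Longrightarrow> \<beta>2 x = 0"
    by (rule smooth_bump[OF r2, of c]) (rule that)
  \<comment> \<open>Mollification wants a compactly supported map on the whole space. The cut-off
    \<open>\<beta>2\<close> is 1 on the ball that carries \<open>p\<close>, so nothing changes
    there.\<close>
  define f0 where "f0 z = \<beta>2 z *\<^sub>R f z" for z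
  have f0: "Ck_at 1 f0 z" for z
  proof (cases "z \<in> cball c (4 * r)")
    case True
    then show ?thesis unfolding f0_def using Ck_at_le[OF \<beta>2(1), of 1] by (intro Ck_at_scaleR f) auto
  next
    case False
    show ?thesis
      by (rule Ck_at_cong[OF Ck_at_const[of _ 0], of "- cball c (4 * r)"]) (use False \<beta>2 in \<open>auto simp: f0_def\<close>)
  qed
  have "\<exists>D. (f0 has_derivative D) (at z)" for z using Ck_at_1_has_derivative[OF f0] by blast
  then obtain f0' where f0': "\<And>z. (f0 has_derivative f0' z) (at z)" by metis
  have z0: "f0 z = 0" if "z \<notin> cball c (4 * r)" for z using that \<beta>2(3)[of z] by (simp add: f0_def)
  obtain C where C: "C \<ge> 0" "\<And>z D v. z \<in> cball c (2 * r) \<Longrightarrow> (\<beta> has_derivative D) (at z) \<Longrightarrow>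
      norm (D v) \<le> C * norm v"
    by (rule Ck_at_derivative_bounded[of "cball c (2 * r)" \<beta>])
      (use Ck_at_le[OF \<beta>(1), of 1] in \<open>auto intro: that\<close>)
  \<comment> \<open>The derivative of \<open>p\<close> has the parts
    \<open>\<beta> (F' - f0')\<close> and \<open>d\<beta> (F - f0)\<close>, bounded by
    \<open>e\<close> and \<open>C * e\<close> times \<open>norm v\<close>.\<close>
  define e where "e = \<epsilon> / (C + 1)"
  have e: "e > 0" "e * (C + 1) = \<epsilon>" using C(1) \<open>\<epsilon> > 0\<close> by (auto simp: e_def)
  obtain F F' where F: "\<And>x. Ck_at \<infinity> F x" "\<And>x. (F has_derivative F' x) (at x)"
    "\<And>x. norm (F x - f0 x) \<le> e" "\<And>x v. norm (F' x v - f0' x v) \<le> e * norm v"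
    by (rule C1_mollification[OF f0 f0' z0 e(1)]) (assumption, rule that)
  define p where "p z = \<beta> z *\<^sub>R (F z - f0 z)" for z
  have p0: "p z = 0" if "z \<notin> cball c (2 * r)" for z using \<beta>(5) that by (simp add: p_def)
  show ?thesis
  proof (rule that[of p])
    show "Ck_at 1 p z" for z
      unfolding p_def using Ck_at_le[OF \<beta>(1), of 1] Ck_at_le[OF F(1), of 1]
      by (intro Ck_at_scaleR Ck_at_diff f0) auto
    show "norm (D v) \<le> \<epsilon> * norm v" if D: "(p has_derivative D) (at z)" for z D v
    proof (cases "z \<in> cball c (2 * r)")
      case True
      obtain b where b: "(\<beta> has_derivative b) (at z)"
        using Ck_at_1_has_derivative[OF Ck_at_le[OF \<beta>(1), of 1]] by auto
      have dp: "(p has_derivative (\<lambda>v. \<beta> z *\<^sub>R (F' z v - f0' z v) + b v *\<^sub>R (F z - f0 z))) (at z)"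
        unfolding p_def[abs_def] by (intro has_derivative_scaleR b has_derivative_diff F(2) f0')
      then have "D v = \<beta> z *\<^sub>R (F' z v - f0' z v) + b v *\<^sub>R (F z - f0 z)"
        using has_derivative_unique[OF D dp] by simp
      moreover have "norm (\<beta> z *\<^sub>R (F' z v - f0' z v)) \<le> 1 * (e * norm v)"
        unfolding norm_scaleR using \<beta>(2,3)[of z] F(4)[of z v] by (intro mult_mono) auto
      moreover have "norm (b v *\<^sub>R (F z - f0 z)) \<le> (C * norm v) * e"
        unfolding norm_scaleR using C(2)[OF True b, of v] F(3)[of z] C(1) by (intro mult_mono) auto
      ultimately have "norm (D v) \<le> 1 * (e * norm v) + (C * norm v) * e"
        using norm_triangle_mono by metis
      also have "\<dots> = \<epsilon> * norm v" unfolding e(2)[symmetric] by (simp add: algebra_simps)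
      finally show ?thesis .
    next
      case False
      have "((\<lambda>z. 0) has_derivative D) (at z)"
        by (rule has_derivative_transform_within_open[OF D, of "- cball c (2 * r)"]) (use False p0 in auto)
      then have "D = (\<lambda>v. 0)" using has_derivative_unique has_derivative_const by blast
      then show ?thesis using \<open>\<epsilon> > 0\<close> by simp
    qed
    show "Ck_at \<infinity> (\<lambda>z. f z + p z) z" if "z \<in> ball c r" for z
      by (rule Ck_at_cong[OF F(1), of "ball c r"]) (use that \<beta>(4) \<beta>2(2) r in \<open>auto simp: p_def f0_def\<close>)
    show "Ck_at \<infinity> p z" if "Ck_at \<infinity> f z" for z
      unfolding p_def f0_def by (intro Ck_at_scaleR Ck_at_diff \<beta>(1) \<beta>2(1) F(1) that)
  qed (use p0 in auto)
qed

text \<open>\<open>u\<close> is Lipschitz with constant 1/2, so \<open>T\<close> cannot identify two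
  points; the same bound keeps \<open>v + u' z v\<close> away from 0 for nonzero
  \<open>v\<close>.\<close>

lemma inverse_of_C1_perturbation_of_ident:
  fixes u :: "'e::euclidean_space \<Rightarrow> 'e"
  assumes u: "\<And>z. Ck_at 1 u z" and D: "\<And>z D v. (u has_derivative D) (at z) \<Longrightarrow> norm (D v) \<le> norm v / 2"
  defines "T \<equiv> \<lambda>z. z + u z"
  shows "inj T" "Ck_at 1 T z" "Ck_at 1 (inv_into UNIV T) (T z)"
proof -
  have "\<exists>D. (u has_derivative D) (at z)" for z using Ck_at_1_has_derivative[OF u] by blast
  then obtain u' where u': "\<And>z. (u has_derivative u' z) (at z)" by metis
  have "dist (u x) (u y) \<le> 1 / 2 * dist x y" for x y
    unfolding dist_norm
  proof (rule differentiable_bound[of UNIV u u'])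
    show "onorm (u' x) \<le> 1 / 2" for x using D[OF u'] by (intro onorm_le) simp
  qed (use u' in auto)
  show inj: "inj T"
  proof (rule injI)
    fix x y assume "T x = T y"
    then have "u x - u y = y - x" by (simp add: T_def algebra_simps)
    then have "norm (x - y) = dist (u x) (u y)" by (simp add: dist_norm norm_minus_commute)
    with \<open>dist (u x) (u y) \<le> 1 / 2 * dist x y\<close> show "x = y" by (simp add: dist_norm)
  qed
  show T: "Ck_at 1 T z" unfolding T_def by (intro Ck_at_add Ck_at_ident u)
  have T': "(T has_derivative (\<lambda>v. v + u' z v)) (at z)"
    unfolding T_def by (intro has_derivative_add has_derivative_ident u')
  have "inj (\<lambda>v. v + u' z v)"
  proof -
    have l: "linear (\<lambda>v. v + u' z v)" using T' has_derivative_linear by blast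
    have "v = 0" if "v + u' z v = 0" for v
    proof -
      have "norm (u' z v) = norm v" using that by (metis add_eq_0_iff norm_minus_cancel)
      then show ?thesis using D[OF u'[of z], of v] by simp
    qed
    then show ?thesis using linear_injective_0[OF l] by blast
  qed
  then show "Ck_at 1 (inv_into UNIV T) (T z)"
    by (intro Ck_at_inv_into[OF _ _ inj T _ T']) auto
qed

text \<open>Meant for averaged charts, whose derivative at the centre is the identity; the identity
  is then also the inverse of the derivative that the inverse function theorem asks for.\<close>

lemma local_C1_inverse:
  fixes f :: "'e::euclidean_space \<Rightarrow> 'e"
  assumes f: "Ck_at 1 f a" and d: "(f has_derivative (\<lambda>v. v)) (at a)"
  obtains Z where "open Z" "a \<in> Z" "inj_on f Z" "\<And>z. z \<in> Z \<Longrightarrow> Ck_at 1 f z"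
    "\<And>z. z \<in> Z \<Longrightarrow> Ck_at 1 (inv_into Z f) (f z)"
proof -
  obtain U where U: "open U" "a \<in> U" "\<And>z. z \<in> U \<Longrightarrow> Ck_at 1 f z"
    using Ck_at_eventually[OF f] by blast
  then have "Ck_on 1 f U" by (subst Ck_on_1_iff_Ck_at) auto
  then obtain f' where f': "\<And>z. z \<in> U \<Longrightarrow> (f has_derivative f' z) (at z)" "\<And>v. continuous_on U (\<lambda>z. f' z v)"
    by auto
  define B where "B z = Blinfun (f' z)" for z
  have B: "blinfun_apply (B z) = f' z" if "z \<in> U" for z
    using has_derivative_bounded_linear[OF f'(1)[OF that]] by (simp add: B_def bounded_linear_Blinfun_apply)
  have Bc: "continuous_on U B"
  proof (rule continuous_on_blinfun_componentwise)
    fix i show "continuous_on U (\<lambda>z. blinfun_apply (B z) i)"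
      by (rule continuous_on_eq[OF f'(2)[of i]]) (simp add: B)
  qed
  have "f' a = (\<lambda>v. v)" using has_derivative_unique[OF f'(1)[OF U(2)] d] .
  then have id: "id_blinfun o\<^sub>L B a = id_blinfun"
    by (intro blinfun_eqI) (simp add: B U)
  have dB: "(f has_derivative blinfun_apply (B z)) (at z)" if "z \<in> U" for z using f'(1) B that by simp
  obtain Z V g g' where Z: "open Z" "Z \<subseteq> U" "a \<in> Z" "homeomorphism Z V f g"
      "\<And>y. y \<in> V \<Longrightarrow> bij (blinfun_apply (B (g y)))"
    by (rule inverse_function_theorem[OF U(1) dB Bc U(2) id]) (assumption, rule that)
  have inj: "inj_on f Z" using Z(4) by (metis homeomorphism_def inj_on_def)
  have "Ck_at 1 (inv_into Z f) (f z)" if z: "z \<in> Z" for z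
  proof (rule Ck_at_inv_into[OF Z(1) z inj])
    show "Ck_at 1 f z" "(f has_derivative f' z) (at z)" using U f' Z z by auto
    have "f z \<in> V" "g (f z) = z" using Z(4) z by (auto simp: homeomorphism_def)
    then show "inj (f' z)" using Z(5)[of "f z"] B z Z(2) by (auto simp: bij_def)
  qed auto
  then show ?thesis using that[OF Z(1,3) inj] U Z by blast
qed

section \<open>Charts adapted to a group of \<open>C\<^sup>1\<close> diffeomorphisms\<close>

text \<open>Trades the homeomorphism between subspaces for conditions on open sets of
  \<open>M\<close> and of the Euclidean space, the form in which new charts are verified
  below.\<close>

lemma manifold_chart_iff:
  "manifold_chart M U \<phi> \<longleftrightarrow> openin M U \<and> inj_on \<phi> U \<and>
     (\<forall>W. openin M W \<longrightarrow> W \<subseteq> U \<longrightarrow> open (\<phi> ` W)) \<and> (\<forall>T. open T \<longrightarrow> openin M {y\<in>U. \<phi> y \<in> T})"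
proof (cases "openin M U")
  case True
  then have ts: "topspace (subtopology M U) = U"
    by (intro topspace_subtopology_subset openin_subset)
  show ?thesis
  proof
    assume "manifold_chart M U \<phi>"
    then have op: "open (\<phi> ` U)" and h: "homeomorphic_map (subtopology M U) (top_of_set (\<phi> ` U)) \<phi>"
      by (auto simp: manifold_chart_def)
    have "inj_on \<phi> U" using homeomorphic_imp_injective_map[OF h] ts by simp
    moreover have "open (\<phi> ` W)" if "openin M W" "W \<subseteq> U" for W
      using homeomorphic_map_openness[OF h, of W] that True op openin_subset[OF that(1)]
      by (simp add: ts openin_open_subtopology openin_open_eq)
    moreover have "openin M {y\<in>U. \<phi> y \<in> T}" if "open T" for T
    proof -
      have "openin (top_of_set (\<phi> ` U)) (\<phi> ` U \<inter> T)" using that by (simp add: openin_open_Int)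
      then have "openin (subtopology M U) {y\<in>U. \<phi> y \<in> \<phi> ` U \<inter> T}"
        using homeomorphic_imp_continuous_map[OF h] openin_continuous_map_preimage ts by force
      moreover have "{y\<in>U. \<phi> y \<in> \<phi> ` U \<inter> T} = {y\<in>U. \<phi> y \<in> T}" by auto
      ultimately show ?thesis using True by (simp add: openin_open_subtopology)
    qed
    ultimately show "openin M U \<and> inj_on \<phi> U \<and> (\<forall>W. openin M W \<longrightarrow> W \<subseteq> U \<longrightarrow> open (\<phi> ` W)) \<and>
        (\<forall>T. open T \<longrightarrow> openin M {y\<in>U. \<phi> y \<in> T})" using True by blast
  next
    assume h: "openin M U \<and> inj_on \<phi> U \<and> (\<forall>W. openin M W \<longrightarrow> W \<subseteq> U \<longrightarrow> open (\<phi> ` W)) \<and>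
        (\<forall>T. open T \<longrightarrow> openin M {y\<in>U. \<phi> y \<in> T})"
    then have op: "open (\<phi> ` U)" by blast
    have "continuous_map (subtopology M U) (top_of_set (\<phi> ` U)) \<phi>"
      unfolding continuous_map_def ts
    proof (intro conjI allI impI)
      fix T assume "openin (top_of_set (\<phi> ` U)) T"
      then have "open T" using op by (simp add: openin_open_eq)
      then show "openin (subtopology M U) {x \<in> U. \<phi> x \<in> T}"
        using h True by (simp add: openin_open_subtopology)
    qed auto
    moreover have "open_map (subtopology M U) (top_of_set (\<phi> ` U)) \<phi>"
      using h op unfolding open_map_def
      by (auto simp: openin_open_subtopology[OF True] openin_open_eq)
    ultimately have "homeomorphic_map (subtopology M U) (top_of_set (\<phi> ` U)) \<phi>"
    proof (rule bijective_open_imp_homeomorphic_map)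
      show "\<phi> ` topspace (subtopology M U) = topspace (top_of_set (\<phi> ` U))" unfolding ts by simp
      show "inj_on \<phi> (topspace (subtopology M U))" unfolding ts using h by blast
    qed
    then show "manifold_chart M U \<phi>" using h op by (simp add: manifold_chart_def)
  qed
qed (auto simp: manifold_chart_def)

lemma manifold_chartD:
  assumes "manifold_chart M U \<phi>"
  shows "openin M U" "inj_on \<phi> U" "\<And>W. openin M W \<Longrightarrow> W \<subseteq> U \<Longrightarrow> open (\<phi> ` W)"
    "\<And>T. open T \<Longrightarrow> openin M {y\<in>U. \<phi> y \<in> T}" "open (\<phi> ` U)" "U \<subseteq> topspace M"
  using assms openin_subset[of M U] by (auto simp: manifold_chart_iff)

text \<open>\<open>f\<close> read in the chart. The arbitrary values of
  \<open>inv_into U \<phi>\<close> off the image of \<open>U\<close> do no harm: for a chart this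
  image is open, and only the germ at \<open>\<phi> y\<close> counts.\<close>

definition fun_at ::
    "enat \<Rightarrow> 'a set \<Rightarrow> ('a \<Rightarrow> 'e::euclidean_space) \<Rightarrow> ('a \<Rightarrow> 'f::euclidean_space) \<Rightarrow> 'a \<Rightarrow> bool" where
  "fun_at k U \<phi> f y \<longleftrightarrow> Ck_at k (\<lambda>z. f (inv_into U \<phi> z)) (\<phi> y)"

lemma fun_at_cong:
  assumes "manifold_chart M U \<phi>" "fun_at k U \<phi> f y" "openin M W" "y \<in> W" "y \<in> U"
    "\<And>x. x \<in> W \<Longrightarrow> x \<in> U \<Longrightarrow> f x = g x"
  shows "fun_at k U \<phi> g y"
  unfolding fun_at_def
proof (rule Ck_at_cong)
  show "Ck_at k (\<lambda>z. f (inv_into U \<phi> z)) (\<phi> y)" using assms(2) by (simp add: fun_at_def)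
  show "open (\<phi> ` (W \<inter> U))" using manifold_chartD[OF assms(1)] assms(3) by (simp add: openin_Int)
  show "f (inv_into U \<phi> z) = g (inv_into U \<phi> z)" if "z \<in> \<phi> ` (W \<inter> U)" for z
    using that assms(6) manifold_chartD(2)[OF assms(1)] by auto
qed (use assms in auto)

lemma fun_at_restrict:
  assumes c: "manifold_chart M U \<phi>" and W: "openin M W" "W \<subseteq> U" "y \<in> W"
  shows "fun_at k W \<phi> f y \<longleftrightarrow> fun_at k U \<phi> f y"
proof -
  have op: "open (\<phi> ` W)" using manifold_chartD[OF c] W by blast
  have eq: "inv_into W \<phi> z = inv_into U \<phi> z" if "z \<in> \<phi> ` W" for z
    using that W(2) manifold_chartD(2)[OF c] by (auto simp: inv_into_f_f inj_on_subset subset_iff)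
  show ?thesis
    unfolding fun_at_def using W(3) eq
    by (auto intro: Ck_at_cong[OF _ op])
qed

lemma fun_at_ident:
  assumes "manifold_chart M U \<phi>" "y \<in> U"
  shows "fun_at k U \<phi> \<phi> y"
  unfolding fun_at_def
  by (rule Ck_at_cong[OF Ck_at_ident manifold_chartD(5)[OF assms(1)]])
    (use assms in \<open>auto simp: f_inv_into_f\<close>)

lemma fun_at_post:
  assumes "manifold_chart M U \<phi>" "y \<in> U" "fun_at k U \<phi> f y" "Ck_at k F (f y)"
  shows "fun_at k U \<phi> (\<lambda>y. F (f y)) y"
  using Ck_at_compose[of k "\<lambda>z. f (inv_into U \<phi> z)" "\<phi> y" F] assms manifold_chartD(2)[OF assms(1)]
  by (simp add: fun_at_def)

text \<open>The chain rule through a chart around \<open>a y\<close>. With \<open>a\<close> the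
  identity it is the change of charts.\<close>

lemma fun_at_compose:
  assumes U: "manifold_chart M U \<phi>" and V: "manifold_chart M V \<psi>"
    and a: "continuous_map M M a" and y: "y \<in> U" "a y \<in> V"
    and 1: "fun_at k U \<phi> (\<lambda>y. \<psi> (a y)) y" and 2: "fun_at k V \<psi> f (a y)"
  shows "fun_at k U \<phi> (\<lambda>y. f (a y)) y"
proof (rule fun_at_cong[OF U])
  show "fun_at k U \<phi> (\<lambda>y. f (inv_into V \<psi> (\<psi> (a y)))) y"
    by (rule fun_at_post[OF U y(1) 1]) (use 2 in \<open>simp add: fun_at_def\<close>)
  show "openin M {y \<in> topspace M. a y \<in> V}"
    using a manifold_chartD(1)[OF V] openin_continuous_map_preimage by blast
  show "y \<in> {y \<in> topspace M. a y \<in> V}" using y manifold_chartD(6)[OF U] by auto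
qed (use y manifold_chartD(2)[OF V] in auto)

section \<open>The action, and charts compatible with the given atlas to first order\<close>

locale C1_action = group G + group_action G "topspace M" act
  for G :: "('g, 'm) monoid_scheme" (structure) and M :: "'a topology" and act +
  fixes A :: "('a set \<times> ('a \<Rightarrow> 'e::euclidean_space)) set"
  assumes manifold: "smooth_manifold M A" and compact: "compact_space M"
    and finite_G: "finite (carrier G)"
    and C1_act: "\<And>g. g \<in> carrier G \<Longrightarrow> Ck_diffeomorphism 1 M A M A (act g)"
begin

lemma Hausdorff: "Hausdorff_space M"
  using manifold by (simp add: smooth_manifold_def)

lemma normal: "normal_space M"
  using compact Hausdorff compact_Hausdorff_or_regular_imp_normal_space by blast

lemma act_closed: "g \<in> carrier G \<Longrightarrow> x \<in> topspace M \<Longrightarrow> act g x \<in> topspace M"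
  using element_image by blast

lemma act_one: "x \<in> topspace M \<Longrightarrow> act \<one> x = x"
  using id_eq_one by (metis restrict_apply')

lemma act_inv:
  assumes "g \<in> carrier G" "x \<in> topspace M"
  shows "act (inv g) (act g x) = x" "act g (act (inv g) x) = x"
  using orbit_sym_aux[of g x] orbit_sym_aux[of "inv g" x] assms by auto

lemma continuous_act: "g \<in> carrier G \<Longrightarrow> continuous_map M M (act g)"
  using C1_act by (auto simp: Ck_diffeomorphism_def Ck_map_def)

lemma openin_act_preimage:
  "g \<in> carrier G \<Longrightarrow> openin M W \<Longrightarrow> openin M {x \<in> topspace M. act g x \<in> W}"
  using continuous_act openin_continuous_map_preimage by blast

lemma act_image_eq:
  assumes "g \<in> carrier G" "W \<subseteq> topspace M"
  shows "act g ` W = {x \<in> topspace M. act (inv g) x \<in> W}"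
proof -
  have "x \<in> act g ` W" if "x \<in> topspace M" "act (inv g) x \<in> W" for x
    using that assms act_inv(2)[of g x] by (metis image_eqI)
  then show ?thesis using assms act_inv act_closed by (auto simp: subset_iff)
qed

lemma openin_act: "g \<in> carrier G \<Longrightarrow> openin M W \<Longrightarrow> openin M (act g ` W)"
  using act_image_eq[of g W, OF _ openin_subset] openin_act_preimage[of "inv g" W] by simp

lemma closedin_act: "g \<in> carrier G \<Longrightarrow> closedin M W \<Longrightarrow> closedin M (act g ` W)"
  using act_image_eq[of g W] closedin_continuous_map_preimage[OF continuous_act[of "inv g"], of W]
    closedin_subset by force

lemma chart_cover:
  assumes "x \<in> topspace M" shows "\<exists>U \<phi>. (U, \<phi>) \<in> A \<and> x \<in> U"
proof -
  have "x \<in> (\<Union>(U, \<phi>)\<in>A. U)" using manifold assms by (simp add: smooth_manifold_def)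
  then show ?thesis by auto
qed

lemma atlas_chart: "(U, \<phi>) \<in> A \<Longrightarrow> manifold_chart M U \<phi>"
  using manifold by (auto simp: smooth_manifold_def)

lemma atlas_act_C1:
  assumes "(U, \<phi>) \<in> A" "(V, \<psi>) \<in> A" "g \<in> carrier G" "y \<in> U" "act g y \<in> V"
  shows "fun_at 1 U \<phi> (\<lambda>y. \<psi> (act g y)) y"
proof -
  have "Ck_on 1 (\<psi> \<circ> act g \<circ> inv_into U \<phi>) (\<phi> ` {x\<in>U. act g x \<in> V})"
    using C1_act[OF assms(3)] assms(1,2) unfolding Ck_diffeomorphism_def Ck_map_def by fast
  moreover have "open (\<phi> ` {x\<in>U. act g x \<in> V})"
  proof (rule manifold_chartD(3)[OF atlas_chart[OF assms(1)]])
    have "{x\<in>U. act g x \<in> V} = {x \<in> topspace M. act g x \<in> V} \<inter> U"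
      using manifold_chartD(6)[OF atlas_chart[OF assms(1)]] by auto
    then show "openin M {x\<in>U. act g x \<in> V}"
      using openin_act_preimage[OF assms(3)] manifold_chartD(1)[OF atlas_chart] assms(1,2)
      by (simp add: openin_Int)
  qed auto
  ultimately have "Ck_at 1 (\<psi> \<circ> act g \<circ> inv_into U \<phi>) (\<phi> y)"
    using assms(4,5) Ck_on_1_iff_Ck_at by blast
  then show ?thesis by (simp add: fun_at_def o_def)
qed

text \<open>The charts of the maximal \<open>C^1\<close> atlas containing \<open>A\<close>. Every
  chart built below stays in it, which is how the action remains \<open>C^1\<close> in new
  coordinates.\<close>

definition C1chart :: "'a set \<Rightarrow> ('a \<Rightarrow> 'e) \<Rightarrow> bool" where
  "C1chart U \<phi> \<longleftrightarrow> manifold_chart M U \<phi> \<and>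
     (\<forall>V \<psi>. (V, \<psi>) \<in> A \<longrightarrow> (\<forall>y \<in> U \<inter> V. fun_at 1 U \<phi> \<psi> y \<and> fun_at 1 V \<psi> \<phi> y))"

lemma C1chart_imp_chart: "C1chart U \<phi> \<Longrightarrow> manifold_chart M U \<phi>"
  by (simp add: C1chart_def)

lemma atlas_C1chart:
  assumes "(U, \<phi>) \<in> A" shows "C1chart U \<phi>"
proof -
  have "fun_at 1 U' \<phi>' \<psi> y" if "(U', \<phi>') \<in> A" "(V, \<psi>) \<in> A" "y \<in> U' \<inter> V" for U' \<phi>' V \<psi> y
  proof -
    have *: "y \<in> topspace M" using that manifold_chartD(6)[OF atlas_chart] by blast
    \<comment> \<open>A transition map of \<open>A\<close> is the coordinate form of the action of
      the unit.\<close>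
    have "fun_at 1 U' \<phi>' (\<lambda>y. \<psi> (act \<one> y)) y"
      using that act_one[OF *] by (intro atlas_act_C1[where V=V]) auto
    then show ?thesis
      by (rule fun_at_cong[OF atlas_chart[OF that(1)] _ openin_topspace]) (use that * act_one in auto)
  qed
  then show ?thesis using assms atlas_chart by (auto simp: C1chart_def)
qed

lemma C1chart_act:
  assumes U: "C1chart U \<phi>" and V: "C1chart V \<psi>" and g: "g \<in> carrier G" and y: "y \<in> U" "act g y \<in> V"
  shows "fun_at 1 U \<phi> (\<lambda>y. \<psi> (act g y)) y"
proof -
  have yM: "y \<in> topspace M" "act g y \<in> topspace M"
    using y manifold_chartD(6) C1chart_imp_chart[OF U] C1chart_imp_chart[OF V] by blast+
  obtain U0 \<phi>0 where U0: "(U0, \<phi>0) \<in> A" "y \<in> U0" using chart_cover yM by blast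
  obtain V0 \<psi>0 where V0: "(V0, \<psi>0) \<in> A" "act g y \<in> V0" using chart_cover yM by blast
  have "fun_at 1 U \<phi> \<phi>0 y" using U U0 y by (auto simp: C1chart_def)
  then have "fun_at 1 U \<phi> (\<lambda>y. \<psi>0 (act g y)) y"
    using fun_at_compose[of M U \<phi> U0 \<phi>0 "\<lambda>x. x" y 1 "\<lambda>y. \<psi>0 (act g y)"]
      C1chart_imp_chart[OF U] atlas_chart[OF U0(1)] atlas_act_C1[OF U0(1) V0(1) g U0(2) V0(2)] y U0
    by simp
  moreover have "fun_at 1 V0 \<psi>0 \<psi> (act g y)" using V V0 y by (auto simp: C1chart_def)
  ultimately show ?thesis
    using fun_at_compose[OF C1chart_imp_chart[OF U] atlas_chart[OF V0(1)] continuous_act[OF g] y(1) V0(2)]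
    by blast
qed

text \<open>Applied with \<open>Z\<close> a neighbourhood from \<open>local_C1_inverse\<close>, for
  the averaged chart, and with \<open>Z = UNIV\<close>, for the correction of a chart. For this
  reason the inverse is taken on \<open>Z\<close> and not on the image of \<open>W\<close>.\<close>

lemma C1chart_post:
  assumes U: "C1chart U \<phi>" and W: "openin M W" "W \<subseteq> U"
    and Z: "\<phi> ` W \<subseteq> Z" and injZ: "inj_on f Z"
    and f: "\<And>z. z \<in> \<phi> ` W \<Longrightarrow> Ck_at 1 f z"
    and f': "\<And>z. z \<in> \<phi> ` W \<Longrightarrow> Ck_at 1 (inv_into Z f) (f z)"
  shows "C1chart W (\<lambda>y. f (\<phi> y))"
proof -
  note c = manifold_chartD[OF C1chart_imp_chart[OF U]]
  have inj: "inj_on f (\<phi> ` W)" using injZ Z by (rule inj_on_subset)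
  have ZW: "\<phi> x \<in> Z" if "x \<in> W" for x using Z that by blast
  have injW: "inj_on \<phi> W" using c(2) W(2) by (rule inj_on_subset)
  have injfW: "inj_on (\<lambda>y. f (\<phi> y)) W"
    using comp_inj_on[OF injW inj] by (simp add: o_def)
  have cont: "continuous_on (\<phi> ` W) f"
    using Ck_at_isCont[OF f] by (simp add: continuous_at_imp_continuous_on)
  have op: "open ((\<lambda>y. f (\<phi> y)) ` W')" if "openin M W'" "W' \<subseteq> W" for W'
  proof -
    have "open (f ` (\<phi> ` W'))"
    proof (rule invariance_of_domain)
      show "continuous_on (\<phi> ` W') f" using cont that(2) by (meson continuous_on_subset image_mono)
      show "open (\<phi> ` W')" using c(3) that W by blast
      show "inj_on f (\<phi> ` W')" using inj that(2) by (meson inj_on_subset image_mono)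
    qed
    then show ?thesis by (simp add: image_image)
  qed
  have mc: "manifold_chart M W (\<lambda>y. f (\<phi> y))"
    unfolding manifold_chart_iff
  proof (intro conjI allI impI)
    fix T :: "'e set" assume "open T"
    then have "open (\<phi> ` W \<inter> f -` T)"
      using continuous_open_preimage[OF cont c(3)[OF W]] by blast
    then have "openin M ({y\<in>U. \<phi> y \<in> \<phi> ` W \<inter> f -` T})" by (rule c(4))
    moreover have "{y\<in>U. \<phi> y \<in> \<phi> ` W \<inter> f -` T} = {y\<in>W. f (\<phi> y) \<in> T}"
      using W(2) c(2) by (auto dest: inj_onD)
    ultimately show "openin M {y\<in>W. f (\<phi> y) \<in> T}" by simp
  qed (use W injfW op in auto)
  have 1: "fun_at 1 W (\<lambda>y. f (\<phi> y)) \<psi> y" if "(V, \<psi>) \<in> A" "y \<in> W" "y \<in> V" for V \<psi> y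
    unfolding fun_at_def
  proof (rule Ck_at_cong)
    have "Ck_at 1 (\<lambda>z. \<psi> (inv_into U \<phi> z)) (\<phi> y)"
      using U that W by (auto simp: C1chart_def fun_at_def)
    moreover have "inv_into Z f (f (\<phi> y)) = \<phi> y" using that injZ ZW by auto
    ultimately show "Ck_at 1 (\<lambda>z. \<psi> (inv_into U \<phi> (inv_into Z f z))) (f (\<phi> y))"
      using Ck_at_compose[OF f'[of "\<phi> y"], of "\<lambda>z. \<psi> (inv_into U \<phi> z)"] that by simp
    show "open ((\<lambda>y. f (\<phi> y)) ` W)" using op W by blast
    show "\<psi> (inv_into U \<phi> (inv_into Z f z)) = \<psi> (inv_into W (\<lambda>y. f (\<phi> y)) z)"
      if "z \<in> (\<lambda>y. f (\<phi> y)) ` W" for z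
    proof -
      from that obtain x where x: "x \<in> W" "z = f (\<phi> x)" by blast
      have "inv_into W (\<lambda>y. f (\<phi> y)) z = x" unfolding x(2) by (rule inv_into_f_f[OF injfW x(1)])
      then show ?thesis using x injZ ZW c(2) W(2) by auto
    qed
  qed (use that in auto)
  have 2: "fun_at 1 V \<psi> (\<lambda>y. f (\<phi> y)) y" if "(V, \<psi>) \<in> A" "y \<in> W" "y \<in> V" for V \<psi> y
    using fun_at_post[OF atlas_chart[OF that(1)] that(3), of 1 \<phi> f] U that W(2) f
    by (auto simp: C1chart_def)
  show ?thesis using mc 1 2 by (auto simp: C1chart_def)
qed


text \<open>The chart pulled back along \<open>act g\<close>. Reading \<open>f\<close> in it at
  \<open>y\<close> amounts to reading \<open>f\<close> moved by \<open>inv g\<close> in the old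
  chart at \<open>act g y\<close>.\<close>

lemma chart_translate:
  assumes U: "C1chart U \<phi>" and g: "g \<in> carrier G"
  defines "V \<equiv> {y \<in> topspace M. act g y \<in> U}" and "tphi \<equiv> \<lambda>y. \<phi> (act g y)"
  shows "C1chart V tphi"
    and "y \<in> V \<Longrightarrow> fun_at k U \<phi> (\<lambda>u. f (act (inv g) u)) (act g y) \<Longrightarrow> fun_at k V tphi f y"
proof -
  note c = manifold_chartD[OF C1chart_imp_chart[OF U]]
  have im: "tphi ` W = \<phi> ` (act g ` W)" for W by (auto simp: tphi_def)
  have inj: "inj_on tphi V"
  proof (rule inj_onI)
    fix x y assume xy: "x \<in> V" "y \<in> V" "tphi x = tphi y"
    then have "act g x = act g y" using c(2) by (auto simp: V_def tphi_def dest: inj_onD)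
    then show "x = y" using inj_prop[OF g] xy by (auto simp: V_def dest: inj_onD)
  qed
  have mc: "manifold_chart M V tphi"
    unfolding manifold_chart_iff
  proof (intro conjI allI impI)
    show "openin M V" unfolding V_def by (rule openin_act_preimage[OF g c(1)])
    show "open (tphi ` W)" if "openin M W" "W \<subseteq> V" for W
      unfolding im by (rule c(3)[OF openin_act[OF g that(1)]]) (use that(2) in \<open>auto simp: V_def\<close>)
    show "openin M {y \<in> V. tphi y \<in> T}" if "open T" for T
      using openin_act_preimage[OF g c(4)[OF that]] by (simp add: V_def tphi_def conj_assoc)
  qed (rule inj)
  have iv: "inv_into V tphi z = act (inv g) (inv_into U \<phi> z)" if "z \<in> tphi ` V" for z
  proof -
    from that obtain x where x: "x \<in> V" "z = tphi x" by blast
    have "inv_into V tphi z = x" unfolding x(2) by (rule inv_into_f_f[OF inj x(1)])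
    moreover have "inv_into U \<phi> z = act g x" using x c(2) by (simp add: V_def tphi_def)
    ultimately show ?thesis using x(1) act_inv[OF g] by (simp add: V_def)
  qed
  have tr: "fun_at k V tphi f y" if "y \<in> V" "fun_at k U \<phi> (\<lambda>u. f (act (inv g) u)) (act g y)"
    for y k and f :: "'a \<Rightarrow> 'x::euclidean_space"
    unfolding fun_at_def
  proof (rule Ck_at_cong)
    show "Ck_at k (\<lambda>z. f (act (inv g) (inv_into U \<phi> z))) (tphi y)"
      using that(2) by (simp add: fun_at_def tphi_def)
    show "open (tphi ` V)" using manifold_chartD(5)[OF mc] .
  qed (use that(1) iv in auto)
  show "y \<in> V \<Longrightarrow> fun_at k U \<phi> (\<lambda>u. f (act (inv g) u)) (act g y) \<Longrightarrow> fun_at k V tphi f y"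
    by (rule tr)
  show "C1chart V tphi"
    unfolding C1chart_def
  proof (intro conjI allI impI ballI mc)
    fix W \<psi> y assume W: "(W, \<psi>) \<in> A" and y: "y \<in> V \<inter> W"
    have "fun_at 1 U \<phi> (\<lambda>u. \<psi> (act (inv g) u)) (act g y)"
      using y act_inv[OF g] g by (intro C1chart_act[OF U atlas_C1chart[OF W]]) (auto simp: V_def)
    then show "fun_at 1 V tphi \<psi> y" using tr y by blast
    show "fun_at 1 W \<psi> tphi y"
      unfolding tphi_def using y by (intro C1chart_act[OF atlas_C1chart[OF W] U g]) (auto simp: V_def)
  qed
qed

text \<open>\<open>\<rho>\<close> is a linear representation of \<open>H\<close>; its values outside \<open>H\<close> are irrelevant.\<close>

definition lin_chart :: "'g set \<Rightarrow> ('g \<Rightarrow> 'e \<Rightarrow> 'e) \<Rightarrow> 'a set \<Rightarrow> ('a \<Rightarrow> 'e) \<Rightarrow> bool" where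
  "lin_chart H \<rho> U h \<longleftrightarrow> C1chart U h \<and> subgroup H G \<and> (\<forall>g\<in>H. bounded_linear (\<rho> g)) \<and>
     (\<forall>g\<in>H. \<forall>k\<in>H. \<forall>v. \<rho> (g \<otimes> k) v = \<rho> g (\<rho> k v)) \<and> (\<forall>v. \<rho> \<one> v = v) \<and>
     (\<forall>g\<in>H. \<forall>y\<in>U. act g y \<in> U \<and> h (act g y) = \<rho> g (h y)) \<and>
     (\<forall>g\<in>carrier G - H. \<forall>y\<in>U. act g y \<notin> U)"

text \<open>One condition for two demands: \<open>g = \<one>\<close> gives smooth transition maps,
  general \<open>g\<close> a smooth action. The domains may leave part of \<open>M\<close>
  uncovered, so that the system can grow chart by chart from the empty one.\<close>

definition smooth_system :: "('a set \<times> ('a \<Rightarrow> 'e)) set \<Rightarrow> bool" where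
  "smooth_system S \<longleftrightarrow> (\<forall>U \<phi>. (U, \<phi>) \<in> S \<longrightarrow> C1chart U \<phi>) \<and>
     (\<forall>U \<phi> V \<psi> g y. (U, \<phi>) \<in> S \<longrightarrow> (V, \<psi>) \<in> S \<longrightarrow> g \<in> carrier G \<longrightarrow> y \<in> U \<longrightarrow> act g y \<in> V \<longrightarrow>
        fun_at \<infinity> U \<phi> (\<lambda>y. \<psi> (act g y)) y)"

lemma smooth_systemD:
  assumes "smooth_system S"
  shows "(U, \<phi>) \<in> S \<Longrightarrow> C1chart U \<phi>"
    "(U, \<phi>) \<in> S \<Longrightarrow> (V, \<psi>) \<in> S \<Longrightarrow> g \<in> carrier G \<Longrightarrow> y \<in> U \<Longrightarrow> act g y \<in> V \<Longrightarrow>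
      fun_at \<infinity> U \<phi> (\<lambda>y. \<psi> (act g y)) y"
  using assms by (auto simp: smooth_system_def)

definition covered :: "('a set \<times> ('a \<Rightarrow> 'e)) set \<Rightarrow> 'a \<Rightarrow> bool" where
  "covered S x \<longleftrightarrow> (\<exists>U \<phi> g. (U, \<phi>) \<in> S \<and> g \<in> carrier G \<and> act g x \<in> U)"

text \<open>The system \<open>S\<close> need not be closed under translation, so its translates by \<open>g\<close> are used as charts too.\<close>

definition smooth_wrt :: "('a set \<times> ('a \<Rightarrow> 'e)) set \<Rightarrow> ('a \<Rightarrow> 'e) \<Rightarrow> 'a \<Rightarrow> bool" where
  "smooth_wrt S f y \<longleftrightarrow> (\<forall>U \<psi> g u. (U, \<psi>) \<in> S \<longrightarrow> g \<in> carrier G \<longrightarrow> u \<in> U \<longrightarrow> act g u = y \<longrightarrow>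
     fun_at \<infinity> U \<psi> (\<lambda>u. f (act g u)) u)"

lemma smooth_wrt_cong:
  assumes S: "smooth_system S" and "smooth_wrt S f y" "openin M W" "y \<in> W" "\<And>x. x \<in> W \<Longrightarrow> f x = f' x"
  shows "smooth_wrt S f' y"
  unfolding smooth_wrt_def
proof (intro allI impI)
  fix U \<psi> g u assume *: "(U, \<psi>) \<in> S" "g \<in> carrier G" "u \<in> U" "act g u = y"
  have c: "manifold_chart M U \<psi>" using smooth_systemD(1)[OF S *(1)] C1chart_imp_chart by blast
  show "fun_at \<infinity> U \<psi> (\<lambda>u. f' (act g u)) u"
  proof (rule fun_at_cong[OF c])
    show "fun_at \<infinity> U \<psi> (\<lambda>u. f (act g u)) u" using assms(2) * by (auto simp: smooth_wrt_def)
    show "openin M {x \<in> topspace M. act g x \<in> W}" by (rule openin_act_preimage[OF *(2) assms(3)])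
  qed (use * assms(4,5) manifold_chartD(6)[OF c] in auto)
qed

lemma smooth_wrt_const: "smooth_wrt S (\<lambda>y. c) y"
  by (simp add: smooth_wrt_def fun_at_def Ck_at_const)

lemma smooth_wrt_linear: "bounded_linear l \<Longrightarrow> smooth_wrt S f y \<Longrightarrow> smooth_wrt S (\<lambda>y. l (f y)) y"
  unfolding smooth_wrt_def fun_at_def using Ck_at_linear_comp[of l] by blast

lemma smooth_wrt_add: "smooth_wrt S f y \<Longrightarrow> smooth_wrt S f' y \<Longrightarrow> smooth_wrt S (\<lambda>y. f y + f' y) y"
  by (simp add: smooth_wrt_def fun_at_def Ck_at_add)

lemma smooth_wrt_sum:
  "(\<And>i. i \<in> I \<Longrightarrow> smooth_wrt S (f i) y) \<Longrightarrow> smooth_wrt S (\<lambda>y. \<Sum>i\<in>I. f i y) y"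
  by (simp add: smooth_wrt_def fun_at_def Ck_at_sum)

text \<open>The translate by \<open>g\<close> of a chart, seen around \<open>y\<close>, becomes its
  translate by \<open>k \<otimes> g\<close>, seen around \<open>act k y\<close>; the latter is among
  those on which \<open>smooth_wrt\<close> tests \<open>f\<close>.\<close>

lemma smooth_wrt_act:
  assumes S: "smooth_system S" and k: "k \<in> carrier G" and f: "smooth_wrt S f (act k y)"
  shows "smooth_wrt S (\<lambda>y. f (act k y)) y"
  unfolding smooth_wrt_def
proof (intro allI impI)
  fix U \<psi> g u assume *: "(U, \<psi>) \<in> S" "g \<in> carrier G" "u \<in> U" "act g u = y"
  have c: "manifold_chart M U \<psi>" using smooth_systemD(1)[OF S *(1)] C1chart_imp_chart by blast
  have comp: "act (k \<otimes> g) x = act k (act g x)" if "x \<in> topspace M" for x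
    using composition_rule[OF that k *(2)] .
  have u: "u \<in> topspace M" using *(3) manifold_chartD(6)[OF c] by blast
  show "fun_at \<infinity> U \<psi> (\<lambda>u. f (act k (act g u))) u"
  proof (rule fun_at_cong[OF c _ openin_topspace u *(3)])
    show "fun_at \<infinity> U \<psi> (\<lambda>u. f (act (k \<otimes> g) u)) u"
      by (rule f[unfolded smooth_wrt_def, rule_format, OF *(1) m_closed[OF k *(2)] *(3)])
        (simp add: comp[OF u] *(4))
  qed (simp add: comp)
qed

text \<open>Some translate of a chart of \<open>S\<close> contains \<open>x\<close> itself. The last
  two conclusions let smoothness with respect to \<open>S\<close> be exchanged for ordinary
  smoothness in this single chart.\<close>

lemma adapted_chart:
  assumes S: "smooth_system S" and x: "covered S x" "x \<in> topspace M"
  obtains V \<psi> where "C1chart V \<psi>" "x \<in> V"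
    "\<And>y F. y \<in> V \<Longrightarrow> Ck_at \<infinity> F (\<psi> y) \<Longrightarrow> smooth_wrt S (\<lambda>y. F (\<psi> y)) y"
    "\<And>y f. y \<in> V \<Longrightarrow> smooth_wrt S f y \<Longrightarrow> fun_at \<infinity> V \<psi> f y"
proof -
  obtain U \<phi> g where U: "(U, \<phi>) \<in> S" and g: "g \<in> carrier G" and gx: "act g x \<in> U"
    using x(1) by (auto simp: covered_def)
  define V where "V = {y \<in> topspace M. act g y \<in> U}"
  note C = smooth_systemD(1)[OF S U]
  show ?thesis
  proof (rule that[of V "\<lambda>y. \<phi> (act g y)"])
    show "C1chart V (\<lambda>y. \<phi> (act g y))" unfolding V_def by (rule chart_translate(1)[OF C g])
    show "x \<in> V" using x gx by (simp add: V_def)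
    show "smooth_wrt S (\<lambda>y. F (\<phi> (act g y))) y" if y: "y \<in> V" and F: "Ck_at \<infinity> F (\<phi> (act g y))" for y F
    proof (rule smooth_wrt_act[OF S g])
      show "smooth_wrt S (\<lambda>y. F (\<phi> y)) (act g y)"
        unfolding smooth_wrt_def
      proof (intro allI impI)
        fix W \<psi> k w assume *: "(W, \<psi>) \<in> S" "k \<in> carrier G" "w \<in> W" "act k w = act g y"
        show "fun_at \<infinity> W \<psi> (\<lambda>u. F (\<phi> (act k u))) w"
        proof (rule fun_at_post[of M W \<psi> w \<infinity> "\<lambda>u. \<phi> (act k u)" F])
          show "manifold_chart M W \<psi>" using smooth_systemD(1)[OF S *(1)] C1chart_imp_chart by blast
          show "fun_at \<infinity> W \<psi> (\<lambda>u. \<phi> (act k u)) w"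
            by (rule smooth_systemD(2)[OF S *(1) U *(2,3)]) (use y *(4) in \<open>simp add: V_def\<close>)
        qed (use F *(3,4) in simp_all)
      qed
    qed
    show "fun_at \<infinity> V (\<lambda>y. \<phi> (act g y)) f y" if y: "y \<in> V" and f: "smooth_wrt S f y" for y f
      unfolding V_def
    proof (rule chart_translate(2)[OF C g])
      show "fun_at \<infinity> U \<phi> (\<lambda>u. f (act (inv g) u)) (act g y)"
        by (rule f[unfolded smooth_wrt_def, rule_format, OF U]) (use g y act_inv[OF g] in \<open>auto simp: V_def\<close>)
    qed (use y in \<open>auto simp: V_def\<close>)
  qed
qed

end

section \<open>Smoothing a linearised chart\<close>

context C1_action begin

lemma lin_chartD:
  assumes "lin_chart H \<rho> U h"
  shows "C1chart U h" "subgroup H G" "\<And>g. g \<in> H \<Longrightarrow> bounded_linear (\<rho> g)"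
    "\<And>g k v. g \<in> H \<Longrightarrow> k \<in> H \<Longrightarrow> \<rho> (g \<otimes> k) v = \<rho> g (\<rho> k v)" "\<And>v. \<rho> \<one> v = v"
    "\<And>g y. g \<in> H \<Longrightarrow> y \<in> U \<Longrightarrow> act g y \<in> U" "\<And>g y. g \<in> H \<Longrightarrow> y \<in> U \<Longrightarrow> h (act g y) = \<rho> g (h y)"
    "\<And>g y. g \<in> carrier G \<Longrightarrow> y \<in> U \<Longrightarrow> act g y \<in> U \<Longrightarrow> g \<in> H"
    "\<And>g. g \<in> H \<Longrightarrow> g \<in> carrier G" "finite H" "\<And>g. g \<in> H \<Longrightarrow> inv g \<in> H"
    "U \<subseteq> topspace M" "openin M U"
proof -
  show s: "subgroup H G" using assms by (simp add: lin_chart_def)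
  show c: "C1chart U h" using assms by (simp add: lin_chart_def)
  show "finite H" using finite_subset[OF subgroup.subset[OF s] finite_G] .
  show "\<And>g. g \<in> H \<Longrightarrow> inv g \<in> H" by (rule subgroup.m_inv_closed[OF s])
  show "\<And>g. g \<in> H \<Longrightarrow> g \<in> carrier G" by (rule subgroup.mem_carrier[OF s])
  show "U \<subseteq> topspace M" "openin M U" using manifold_chartD(1,6)[OF C1chart_imp_chart[OF c]] by auto
qed (use assms[unfolded lin_chart_def] in blast)+

lemma C1chart_transition:
  assumes U: "C1chart U \<phi>" and V: "C1chart V \<psi>" and y: "y \<in> U" "y \<in> V"
  shows "fun_at 1 U \<phi> \<psi> y"
proof (rule fun_at_cong[OF C1chart_imp_chart[OF U] _ openin_topspace])
  show yM: "y \<in> topspace M" using y manifold_chartD(6)[OF C1chart_imp_chart[OF U]] by blast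
  show "fun_at 1 U \<phi> (\<lambda>y. \<psi> (act \<one> y)) y"
    by (rule C1chart_act[OF U V]) (use y act_one[OF yM] in auto)
qed (use y act_one in auto)

text \<open>Replacing \<open>g\<close> by \<open>g \<otimes> inv k\<close> turns
  \<open>\<rho> (inv g)\<close> into \<open>\<rho> (k \<otimes> inv g)\<close>, from which
  \<open>\<rho> k\<close> factors out. It serves twice: for linearising a chart and for averaging a
  correction.\<close>

lemma equivariant_average:
  fixes f :: "'a \<Rightarrow> 'e"
  assumes H: "subgroup H G" and bl: "\<And>g. g \<in> H \<Longrightarrow> bounded_linear (\<rho> g)"
    and hom: "\<And>g k v. g \<in> H \<Longrightarrow> k \<in> H \<Longrightarrow> \<rho> (g \<otimes> k) v = \<rho> g (\<rho> k v)"
    and k: "k \<in> H" and y: "y \<in> topspace M"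
  shows "(\<Sum>g\<in>H. \<rho> (inv g) (f (act g (act k y)))) = \<rho> k (\<Sum>g\<in>H. \<rho> (inv g) (f (act g y)))"
proof -
  have HG: "g \<in> carrier G" "inv g \<in> H" if "g \<in> H" for g
    using subgroup.mem_carrier[OF H] subgroup.m_inv_closed[OF H] that by auto
  have "(\<Sum>g\<in>H. \<rho> (inv g) (f (act g (act k y)))) = (\<Sum>g\<in>H. \<rho> (k \<otimes> inv g) (f (act g y)))"
  proof (rule sum.reindex_bij_witness[of _ "\<lambda>g. g \<otimes> inv k" "\<lambda>g. g \<otimes> k"])
    fix g assume g: "g \<in> H"
    have c: "g \<in> carrier G" "k \<in> carrier G" using g k HG by auto
    show "g \<otimes> k \<otimes> inv k = g" "g \<otimes> inv k \<otimes> k = g" using c by (simp_all add: m_assoc)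
    show "g \<otimes> k \<in> H" "g \<otimes> inv k \<in> H"
      using subgroup.m_closed[OF H] g k HG by auto
    have "k \<otimes> inv (g \<otimes> k) = inv g"
      using c by (simp add: inv_mult_group) (simp add: m_assoc[symmetric])
    then show "\<rho> (k \<otimes> inv (g \<otimes> k)) (f (act (g \<otimes> k) y)) = \<rho> (inv g) (f (act g (act k y)))"
      using composition_rule[OF y c] by simp
  qed
  also have "\<dots> = (\<Sum>g\<in>H. \<rho> k (\<rho> (inv g) (f (act g y))))"
    using hom[OF k HG(2)] by simp
  also have "\<dots> = \<rho> k (\<Sum>g\<in>H. \<rho> (inv g) (f (act g y)))"
    by (rule linear_sum[OF bounded_linear.linear[OF bl[OF k]], symmetric])
  finally show ?thesis .
qed

lemma lin_chart_inverse:
  assumes "lin_chart H \<rho> U h" "g \<in> H"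
  shows "\<rho> (inv g) (\<rho> g v) = v" "\<rho> g (\<rho> (inv g) v) = v"
  using lin_chartD(4)[OF assms(1) lin_chartD(11)[OF assms(1)] , of g g v]
    lin_chartD(4)[OF assms(1) _ lin_chartD(11)[OF assms(1)], of g g v]
    lin_chartD(5,9)[OF assms(1)] assms(2) by auto

text \<open>On \<open>U\<close> the map \<open>h\<close> equals
  \<open>\<rho> g \<circ> h \<circ> act (inv g)\<close>, which transports smoothness from
  \<open>y\<close> to \<open>act g y\<close>.\<close>

lemma smooth_wrt_lin_chart_act:
  assumes S: "smooth_system S" and L: "lin_chart H \<rho> U h" and g: "g \<in> H" and y: "y \<in> U"
    and sm: "smooth_wrt S h y"
  shows "smooth_wrt S h (act g y)"
proof (rule smooth_wrt_cong[OF S _ lin_chartD(13)[OF L] lin_chartD(6)[OF L g y]])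
  have gG: "g \<in> carrier G" and UM: "U \<subseteq> topspace M" using lin_chartD(9,12)[OF L] g by auto
  have "smooth_wrt S h (act (inv g) (act g y))" using sm act_inv(1)[OF gG, of y] y UM by auto
  then have "smooth_wrt S (\<lambda>x. h (act (inv g) x)) (act g y)"
    by (rule smooth_wrt_act[OF S inv_closed[OF gG]])
  then show "smooth_wrt S (\<lambda>x. \<rho> g (h (act (inv g) x))) (act g y)"
    by (rule smooth_wrt_linear[OF lin_chartD(3)[OF L g]])
  fix x assume x: "x \<in> U"
  then have "\<rho> g (h (act (inv g) x)) = h (act g (act (inv g) x))"
    using lin_chartD(6,7)[OF L] lin_chartD(11)[OF L g] g by auto
  also have "\<dots> = h x" using act_inv(2)[OF gG, of x] x UM by auto
  finally show "\<rho> g (h (act (inv g) x)) = h x" .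
qed

lemma separating_nhd:
  assumes x: "x \<in> topspace M" and H: "H \<subseteq> carrier G" and V: "openin M V" "x \<in> V"
  obtains N where "openin M N" "x \<in> N" "N \<subseteq> V"
    "\<And>g y. g \<in> H \<Longrightarrow> act g x \<noteq> x \<Longrightarrow> y \<in> N \<Longrightarrow> act g y \<notin> N"
proof -
  have "\<exists>N. openin M N \<and> x \<in> N \<and> (act g x \<noteq> x \<longrightarrow> (\<forall>y\<in>N. act g y \<notin> N))" if g: "g \<in> H" for g
  proof (cases "act g x = x")
    case False
    have gG: "g \<in> carrier G" using g H by blast
    obtain P Q where PQ: "openin M P" "openin M Q" "x \<in> P" "act g x \<in> Q" "disjnt P Q"
      using Hausdorff x act_closed[OF gG x] False unfolding Hausdorff_space_def by metis
    have "openin M (P \<inter> {y \<in> topspace M. act g y \<in> Q})"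
      using PQ openin_act_preimage[OF gG] by blast
    then show ?thesis
      using PQ x by (intro exI[of _ "P \<inter> {y \<in> topspace M. act g y \<in> Q}"]) (auto simp: disjnt_iff)
  qed (use x in blast)
  then obtain N where N: "\<And>g. g \<in> H \<Longrightarrow> openin M (N g) \<and> x \<in> N g \<and>
      (act g x \<noteq> x \<longrightarrow> (\<forall>y\<in>N g. act g y \<notin> N g))" by metis
  have fin: "finite H" using H finite_G finite_subset by blast
  \<comment> \<open>Inserting \<open>V\<close> keeps the family nonempty even if \<open>H\<close> is
    empty.\<close>
  have "openin M (V \<inter> \<Inter>(insert V (N ` H)))"
    using N V fin by (intro openin_Int openin_Inter) auto
  then show ?thesis
    by (rule that) (use N V in auto)
qed

text \<open>The neighbourhood \<open>W\<close> does not depend on \<open>h\<close>, so a compact set can be covered in advance by finitely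
  many of them, and the smoothings are then performed one after the other.\<close>

lemma smoothing_at_point:
  assumes S: "smooth_system S" and x: "x \<in> U" and cov: "covered S x" and L0: "lin_chart H \<rho> U h0"
  obtains W where "openin M W" "x \<in> W"
    "\<And>h. lin_chart H \<rho> U h \<Longrightarrow> \<exists>h'. lin_chart H \<rho> U h' \<and>
       (\<forall>y\<in>U. smooth_wrt S h y \<or> y \<in> W \<longrightarrow> smooth_wrt S h' y)"
proof -
  have UM: "U \<subseteq> topspace M" "openin M U" and HG: "H \<subseteq> carrier G" and finH: "finite H"
    using lin_chartD[OF L0] by auto
  have xM: "x \<in> topspace M" using x UM by auto
  obtain V \<psi> where V: "C1chart V \<psi>" "x \<in> V"
    and sm1: "\<And>y F. y \<in> V \<Longrightarrow> Ck_at \<infinity> F (\<psi> y) \<Longrightarrow> smooth_wrt S (\<lambda>y. F (\<psi> y)) y"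
    and sm2: "\<And>y f. y \<in> V \<Longrightarrow> smooth_wrt S f y \<Longrightarrow> fun_at \<infinity> V \<psi> f y"
    by (rule adapted_chart[OF S cov xM]) (rule that)
  note cV = manifold_chartD[OF C1chart_imp_chart[OF V(1)]]
  have "openin M (U \<inter> V)" using UM cV by blast
  \<comment> \<open>Elements of \<open>H\<close> that move \<open>x\<close> push \<open>N\<close>
    off itself, so that on \<open>W\<close> the averaged correction only feels the stabiliser
    \<open>Hx\<close>.\<close>
  then obtain N where N: "openin M N" "x \<in> N" "N \<subseteq> U \<inter> V"
    "\<And>g y. g \<in> H \<Longrightarrow> act g x \<noteq> x \<Longrightarrow> y \<in> N \<Longrightarrow> act g y \<notin> N"
    by (rule separating_nhd[OF xM HG]) (use x V in auto)
  define c where "c = \<psi> x"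
  have "open (\<psi> ` N)" "c \<in> \<psi> ` N" using cV(3) N by (auto simp: c_def)
  then obtain R where R: "R > 0" "cball c R \<subseteq> \<psi> ` N" using open_contains_cball by blast
  define r where "r = R / 4"
  have r: "r > 0" "cball c (4 * r) \<subseteq> \<psi> ` N" using R by (auto simp: r_def)
  define Hx where "Hx = {g \<in> H. act g x = x}"
  have Hx: "finite Hx" "Hx \<subseteq> H" "\<one> \<in> Hx"
    using finH act_one[OF xM] subgroup.one_closed[OF lin_chartD(2)[OF L0]] by (auto simp: Hx_def)
  have cardHx: "card Hx > 0" using Hx by (auto simp: card_gt_0_iff)
  define B where "B = {y \<in> N. \<psi> y \<in> ball c r}"
  have B: "openin M B" "x \<in> B"
  proof -
    have "B = N \<inter> {y \<in> V. \<psi> y \<in> ball c r}" using N by (auto simp: B_def)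
    then show "openin M B" using N(1) cV(4)[of "ball c r"] by auto
  qed (use N r in \<open>auto simp: B_def c_def\<close>)
  \<comment> \<open>The averaged chart at \<open>y\<close> involves \<open>act g y\<close> for every
    \<open>g \<in> Hx\<close>. On \<open>W\<close> all these points lie in \<open>B\<close>, where
    \<open>f + p\<close> will be smooth.\<close>
  define W where "W = N \<inter> \<Inter>((\<lambda>g. {y \<in> topspace M. act g y \<in> B}) ` Hx)"
  have W: "openin M W" "x \<in> W"
  proof -
    show "openin M W" unfolding W_def
      using Hx HG B by (intro openin_Int N openin_Inter) (auto intro!: openin_act_preimage)
    show "x \<in> W" using N B xM by (auto simp: W_def Hx_def)
  qed
  \<comment> \<open>The part of \<open>M\<close> that carries the correction. Its compactness gives
    the derivative bound \<open>C\<close> and a closed set outside which the correction is extended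
    by 0.\<close>
  define Q where "Q = {y \<in> N. \<psi> y \<in> cball c (2 * r)}"
  have inv\<psi>: "inv_into V \<psi> (\<psi> y) = y" if "y \<in> N" for y using that N cV(2) by auto
  have Qim: "Q = inv_into V \<psi> ` cball c (2 * r)"
  proof
    show "Q \<subseteq> inv_into V \<psi> ` cball c (2 * r)" using inv\<psi> by (force simp: Q_def)
    show "inv_into V \<psi> ` cball c (2 * r) \<subseteq> Q"
    proof
      fix y assume "y \<in> inv_into V \<psi> ` cball c (2 * r)"
      then obtain z where z: "z \<in> cball c (2 * r)" "y = inv_into V \<psi> z" by blast
      then have "z \<in> \<psi> ` N" using r by (auto simp: subset_iff)
      then show "y \<in> Q" using z inv\<psi> by (auto simp: Q_def)
    qed
  qed
  show ?thesis
  proof (rule that[OF W])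
    fix h assume L: "lin_chart H \<rho> U h"
    note hC = lin_chartD(1)[OF L]
    note ch = manifold_chartD[OF C1chart_imp_chart[OF hC]]
    define f where "f z = h (inv_into V \<psi> z)" for z
    have f\<psi>: "f (\<psi> y) = h y" if "y \<in> N" for y using inv\<psi>[OF that] by (simp add: f_def)
    have fC1: "Ck_at 1 f z" if z: "z \<in> cball c (4 * r)" for z
    proof -
      obtain y where y: "y \<in> N" "z = \<psi> y" using z r by blast
      have "fun_at 1 V \<psi> h y" by (rule C1chart_transition[OF V(1) hC]) (use y N in auto)
      then show ?thesis by (simp add: fun_at_def f_def[abs_def] y(2))
    qed
    have Qsub: "h ` Q \<subseteq> h ` N" by (auto simp: Q_def)
    \<comment> \<open>The passage from \<open>h\<close>-coordinates to
      \<open>\<psi>\<close>-coordinates. The mollification takes place in the latter, where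
      smoothness with respect to \<open>S\<close> is visible, the averaging in the former, where
      \<open>H\<close> acts linearly.\<close>
    define \<kappa> where "\<kappa> w = \<psi> (inv_into U h w)" for w
    have \<kappa>h: "\<kappa> (h y) = \<psi> y" if "y \<in> N" for y using that N ch(2) by (auto simp: \<kappa>_def)
    have \<kappa>C1: "Ck_at 1 \<kappa> w" if w: "w \<in> h ` N" for w
    proof -
      obtain y where y: "y \<in> N" "w = h y" using w by blast
      have "fun_at 1 U h \<psi> y" by (rule C1chart_transition[OF hC V(1)]) (use y N in auto)
      then show ?thesis by (simp add: fun_at_def \<kappa>_def[abs_def] y(2))
    qed
    have cQ: "compact (h ` Q)"
    proof -
      have "h ` Q = f ` cball c (2 * r)" by (simp add: Qim f_def image_image)
      moreover have "continuous_on (cball c (2 * r)) f"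
        using Ck_at_isCont[OF fC1] r(1) by (auto intro!: continuous_at_imp_continuous_on)
      ultimately show ?thesis by (simp add: compact_continuous_image)
    qed
    have ohN: "open (h ` N)" using ch(3) N by blast
    obtain C where C: "C \<ge> 0" "\<And>z D v. z \<in> h ` Q \<Longrightarrow> (\<kappa> has_derivative D) (at z) \<Longrightarrow> norm (D v) \<le> C * norm v"
      by (rule Ck_at_derivative_bounded[OF cQ]) (use \<kappa>C1 Qsub in blast, rule that)
    obtain K where K: "K > 0" "\<And>g v. g \<in> H \<Longrightarrow> norm (\<rho> g v) \<le> K * norm v"
    proof -
      have "\<exists>K. \<forall>v. norm (\<rho> g v) \<le> norm v * K" if "g \<in> H" for g
        using bounded_linear.bounded[OF lin_chartD(3)[OF L that]] by blast
      then obtain k where k: "\<And>g v. g \<in> H \<Longrightarrow> norm (\<rho> g v) \<le> norm v * k g" by metis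
      define K where "K = (\<Sum>g\<in>H. \<bar>k g\<bar>) + 1"
      have "norm (\<rho> g v) \<le> K * norm v" if "g \<in> H" for g v
      proof -
        have "k g \<le> K" using member_le_sum[OF that, of "\<lambda>g. \<bar>k g\<bar>"] finH by (simp add: K_def)
        then have "norm v * k g \<le> norm v * K" by (rule mult_left_mono) simp
        then show ?thesis using k[OF that, of v] by (simp add: mult.commute)
      qed
      then show ?thesis using that[of K] by (simp add: K_def sum_nonneg add_nonneg_pos)
    qed
    \<comment> \<open>chosen so that the correction \<open>u\<close> below has derivative of norm at most \<open>1/2\<close>\<close>
    define \<epsilon> where "\<epsilon> = 1 / (2 * (card H * (K * (C + 1) * K)))"
    have cardH: "card H > 0" using Hx finH by (auto simp: card_gt_0_iff)
    have \<epsilon>: "\<epsilon> > 0" unfolding \<epsilon>_def using K(1) C(1) cardH by (intro divide_pos_pos mult_pos_pos) auto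
    obtain p where p: "\<And>z. Ck_at 1 p z" "\<And>z. z \<notin> cball c (2 * r) \<Longrightarrow> p z = 0"
      "\<And>z D v. (p has_derivative D) (at z) \<Longrightarrow> norm (D v) \<le> \<epsilon> * norm v"
      "\<And>z. z \<in> ball c r \<Longrightarrow> Ck_at \<infinity> (\<lambda>z. f z + p z) z"
      "\<And>z. Ck_at \<infinity> f z \<Longrightarrow> Ck_at \<infinity> p z"
      by (rule local_smoothing[OF r(1) fC1 \<epsilon>]) (assumption, rule that)
    \<comment> \<open>The correction moved to \<open>h\<close>-coordinates. Extension by 0 stays
      \<open>C^1\<close> because \<open>p (\<kappa> w)\<close> already vanishes off the image of
      \<open>Q\<close>, which is closed.\<close>
    define q where "q w = (if w \<in> h ` N then p (\<kappa> w) else 0)" for w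
    have NU: "N \<subseteq> U" using N by blast
    have q0: "q w = 0" if w: "w \<notin> h ` Q" for w
    proof (cases "w \<in> h ` N")
      case True
      then obtain y where y: "y \<in> N" "w = h y" by blast
      then have "y \<notin> Q" using w by blast
      then have "\<psi> y \<notin> cball c (2 * r)" using y by (simp add: Q_def)
      then show ?thesis using p(2) \<kappa>h[OF y(1)] y by (simp add: q_def)
    qed (simp add: q_def)
    have qh: "q (h y) = p (\<psi> y)" if "y \<in> N" for y using that \<kappa>h by (simp add: q_def)
    have clQ: "closed (h ` Q)" using cQ by (rule compact_imp_closed)
    have qC1: "Ck_at 1 q w" for w
    proof (cases "w \<in> h ` N")
      case True
      show ?thesis
        by (rule Ck_at_cong[OF Ck_at_compose[OF \<kappa>C1[OF True] p(1)] ohN True]) (simp add: q_def)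
    next
      case False
      show ?thesis
        by (rule Ck_at_cong[OF Ck_at_const[of _ 0], of "- (h ` Q)"]) (use False Qsub clQ q0 in auto)
    qed
    have qD: "norm (D v) \<le> \<epsilon> * C * norm v" if D: "(q has_derivative D) (at w)" for w D v
    proof (cases "w \<in> h ` Q")
      case True
      then have wN: "w \<in> h ` N" using Qsub by blast
      obtain k where k: "(\<kappa> has_derivative k) (at w)" using Ck_at_1_has_derivative[OF \<kappa>C1[OF wN]] .
      obtain d where d: "(p has_derivative d) (at (\<kappa> w))" using Ck_at_1_has_derivative[OF p(1)] .
      have "(q has_derivative (\<lambda>v. d (k v))) (at w)"
        by (rule has_derivative_transform_within_open[OF has_derivative_compose[OF k d] ohN wN])
          (simp add: q_def)
      then have "D v = d (k v)" using has_derivative_unique[OF D] by simp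
      also have "norm (d (k v)) \<le> \<epsilon> * norm (k v)" by (rule p(3)[OF d])
      also have "\<dots> \<le> \<epsilon> * (C * norm v)" using C(2)[OF True k, of v] \<epsilon> by (intro mult_left_mono) auto
      finally show ?thesis by (simp add: mult.assoc)
    next
      case False
      have "((\<lambda>w. 0) has_derivative D) (at w)"
        by (rule has_derivative_transform_within_open[OF D, of "- (h ` Q)"]) (use False clQ q0 in auto)
      then have "D = (\<lambda>v. 0)" using has_derivative_unique has_derivative_const by blast
      then show ?thesis using \<epsilon> C(1) by simp
    qed
    \<comment> \<open>Translates of \<open>q\<close> by \<open>g \<notin> Hx\<close> are supported away from \<open>N\<close>; hence the weight \<open>1 / card Hx\<close>.\<close>
    define u where "u w = (1 / real (card Hx)) *\<^sub>R (\<Sum>g\<in>H. \<rho> (inv g) (q (\<rho> g w)))" for w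
    note bl = lin_chartD(3)[OF L] and invH = lin_chartD(11)[OF L]
    have uC1: "Ck_at 1 u w" for w
      unfolding u_def
    proof (intro Ck_at_scaleR Ck_at_const Ck_at_sum)
      fix g assume g: "g \<in> H"
      have "Ck_at 1 (\<lambda>w. q (\<rho> g w)) w" by (rule Ck_at_compose[OF Ck_at_bounded_linear[OF bl[OF g]] qC1])
      then show "Ck_at 1 (\<lambda>w. \<rho> (inv g) (q (\<rho> g w))) w" by (rule Ck_at_linear_comp[OF bl[OF invH[OF g]]])
    qed
    have uD: "norm (D v) \<le> norm v / 2" if D: "(u has_derivative D) (at w)" for w D v
    proof -
      have "\<exists>D. (q has_derivative D) (at w)" for w using Ck_at_1_has_derivative[OF qC1] by blast
      then obtain q' where q': "\<And>w. (q has_derivative q' w) (at w)" by metis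
      have "(u has_derivative (\<lambda>v. (1 / real (card Hx)) *\<^sub>R (\<Sum>g\<in>H. \<rho> (inv g) (q' (\<rho> g w) (\<rho> g v))))) (at w)"
        unfolding u_def[abs_def]
      proof (intro has_derivative_scaleR_right has_derivative_sum)
        fix g assume g: "g \<in> H"
        show "((\<lambda>w. \<rho> (inv g) (q (\<rho> g w))) has_derivative (\<lambda>v. \<rho> (inv g) (q' (\<rho> g w) (\<rho> g v)))) (at w)"
          by (rule bounded_linear.has_derivative[OF bl[OF invH[OF g]]
                has_derivative_compose[OF bounded_linear_imp_has_derivative[OF bl[OF g]] q']])
      qed
      then have "D v = (1 / real (card Hx)) *\<^sub>R (\<Sum>g\<in>H. \<rho> (inv g) (q' (\<rho> g w) (\<rho> g v)))"
        using has_derivative_unique[OF D] by simp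
      also have "norm \<dots> \<le> 1 * norm (\<Sum>g\<in>H. \<rho> (inv g) (q' (\<rho> g w) (\<rho> g v)))"
        unfolding norm_scaleR using cardHx by (intro mult_right_mono) auto
      also have "norm (\<Sum>g\<in>H. \<rho> (inv g) (q' (\<rho> g w) (\<rho> g v))) \<le> (\<Sum>g\<in>H. K * (\<epsilon> * C * (K * norm v)))"
      proof (rule sum_norm_le)
        fix g assume g: "g \<in> H"
        have "norm (\<rho> (inv g) (q' (\<rho> g w) (\<rho> g v))) \<le> K * norm (q' (\<rho> g w) (\<rho> g v))"
          by (rule K(2)[OF invH[OF g]])
        also have "\<dots> \<le> K * (\<epsilon> * C * norm (\<rho> g v))" using K(1) qD[OF q'] by (intro mult_left_mono) auto
        also have "\<dots> \<le> K * (\<epsilon> * C * (K * norm v))"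
          using K \<epsilon> C(1) g by (intro mult_left_mono) auto
        finally show "norm (\<rho> (inv g) (q' (\<rho> g w) (\<rho> g v))) \<le> K * (\<epsilon> * C * (K * norm v))" .
      qed
      also have "(\<Sum>g\<in>H. K * (\<epsilon> * C * (K * norm v))) = \<epsilon> * (card H * (K * C * K)) * norm v"
        by simp
      also have "\<dots> \<le> \<epsilon> * (card H * (K * (C + 1) * K)) * norm v"
        using \<epsilon> K(1) C(1) by (intro mult_right_mono mult_left_mono) auto
      also have "\<epsilon> * (card H * (K * (C + 1) * K)) = 1 / 2"
      proof -
        define t where "t = real (card H) * (K * (C + 1) * K)"
        have "t > 0" unfolding t_def using K(1) C(1) cardH by (intro mult_pos_pos) auto
        then show ?thesis by (simp add: \<epsilon>_def flip: t_def)
      qed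
      finally show ?thesis by simp
    qed
    \<comment> \<open>Following \<open>h\<close> by a map of the whole coordinate space leaves the
      domain \<open>U\<close> and its invariance untouched; \<open>uact\<close> supplies the
      equivariance.\<close>
    define T where "T z = z + u z" for z
    have T: "inj T" "\<And>z. Ck_at 1 T z" "\<And>z. Ck_at 1 (inv_into UNIV T) (T z)"
      unfolding T_def by (rule inverse_of_C1_perturbation_of_ident; (rule uC1 | erule uD))+
    have C1h': "C1chart U (\<lambda>y. T (h y))"
      by (rule C1chart_post[OF hC UM(2) subset_refl subset_UNIV T])
    have uh: "u (h y) = (1 / real (card Hx)) *\<^sub>R (\<Sum>g\<in>H. \<rho> (inv g) (q (h (act g y))))" if "y \<in> U" for y
      unfolding u_def using lin_chartD(7)[OF L _ that] by (simp cong: sum.cong)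
    have uact: "u (h (act k y)) = \<rho> k (u (h y))" if k: "k \<in> H" and y: "y \<in> U" for k y
    proof -
      have "(\<Sum>g\<in>H. \<rho> (inv g) (q (h (act g (act k y))))) = \<rho> k (\<Sum>g\<in>H. \<rho> (inv g) (q (h (act g y))))"
        by (rule equivariant_average[OF lin_chartD(2)[OF L] bl lin_chartD(4)[OF L] k])
          (use y UM in auto)
      then show ?thesis
        unfolding uh[OF y] uh[OF lin_chartD(6)[OF L k y]]
        using linear_scale[OF bounded_linear.linear[OF bl[OF k]]] by simp
    qed
    have L': "lin_chart H \<rho> U (\<lambda>y. T (h y))"
      unfolding lin_chart_def
    proof (intro conjI ballI)
      show "act g y \<in> U" "T (h (act g y)) = \<rho> g (T (h y))" if "g \<in> H" "y \<in> U" for g y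
        using lin_chartD(6,7)[OF L] that uact[OF that] linear_add[OF bounded_linear.linear[OF bl[OF that(1)]]]
        by (auto simp: T_def)
    qed (use C1h' L in \<open>auto simp: lin_chart_def\<close>)
    have h'eq: "T (h y) = h y + (1 / real (card Hx)) *\<^sub>R (\<Sum>g\<in>H. \<rho> (inv g) (q (h (act g y))))" if "y \<in> U" for y
      by (simp add: T_def uh[OF that])
    \<comment> \<open>On \<open>N\<close> the correction is \<open>p\<close> read in
      \<open>\<psi>\<close>, smooth wherever \<open>f\<close> is; off \<open>N\<close> it vanishes
      near \<open>y\<close>.\<close>
    have smq: "smooth_wrt S (\<lambda>y. q (h y)) y" if y: "y \<in> U" and sm: "smooth_wrt S h y" for y
    proof (cases "y \<in> N")
      case True
      then have yV: "y \<in> V" using N by blast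
      have "Ck_at \<infinity> f (\<psi> y)" using sm2[OF yV sm] by (simp add: fun_at_def f_def[abs_def])
      then have "smooth_wrt S (\<lambda>y. p (\<psi> y)) y" by (intro sm1[OF yV] p(5))
      then show ?thesis by (rule smooth_wrt_cong[OF S _ N(1) True]) (simp add: qh)
    next
      case False
      have "openin M {y \<in> U. h y \<in> - (h ` Q)}" using ch(4) clQ by blast
      moreover have "y \<in> {y \<in> U. h y \<in> - (h ` Q)}"
        using False y ch(2) NU by (auto simp: Q_def dest: inj_onD)
      ultimately show ?thesis by (rule smooth_wrt_cong[OF S smooth_wrt_const[of _ 0]]) (use q0 in auto)
    qed
    \<comment> \<open>Each summand looks at \<open>h\<close> near \<open>act g y\<close>, and
      equivariance carries the smoothness assumed at \<open>y\<close> to that point.\<close>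
    have old: "smooth_wrt S (\<lambda>y. T (h y)) y" if y: "y \<in> U" and sm: "smooth_wrt S h y" for y
    proof (rule smooth_wrt_cong[OF S _ UM(2) y])
      show "smooth_wrt S (\<lambda>y. h y + (1 / real (card Hx)) *\<^sub>R (\<Sum>g\<in>H. \<rho> (inv g) (q (h (act g y))))) y"
      proof (intro smooth_wrt_add sm smooth_wrt_linear[OF bounded_linear_scaleR_right] smooth_wrt_sum)
        fix g assume g: "g \<in> H"
        have "smooth_wrt S (\<lambda>y. q (h y)) (act g y)"
          by (rule smq[OF lin_chartD(6)[OF L g y] smooth_wrt_lin_chart_act[OF S L g y sm]])
        then have "smooth_wrt S (\<lambda>y. q (h (act g y))) y"
          by (rule smooth_wrt_act[OF S lin_chartD(9)[OF L g], of "\<lambda>y. q (h y)"])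
        then show "smooth_wrt S (\<lambda>y. \<rho> (inv g) (q (h (act g y)))) y"
          by (rule smooth_wrt_linear[OF bl[OF invH[OF g]]])
      qed
    qed (simp add: h'eq)
    have WD: "x \<in> N" "\<And>g. g \<in> Hx \<Longrightarrow> act g x \<in> B" if "x \<in> W" for x using that by (auto simp: W_def)
    \<comment> \<open>On \<open>W\<close> the unsmoothed \<open>h\<close> cancels. For
      \<open>g \<in> Hx\<close> the term \<open>\<rho> (inv g) (f (\<psi> (act g x)))\<close> equals
      \<open>h x\<close>, so \<open>h x\<close> is itself the average of these terms over
      \<open>Hx\<close>, and adding the averaged \<open>p\<close> leaves the average of the smooth
      \<open>f + p\<close>.\<close>
    have h'W: "T (h x) = (1 / real (card Hx)) *\<^sub>R (\<Sum>g\<in>Hx. \<rho> (inv g) (f (\<psi> (act g x)) + p (\<psi> (act g x))))"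
      if xW: "x \<in> W" for x
    proof -
      have xU: "x \<in> U" using WD(1)[OF xW] NU by blast
      have z: "q (h (act g x)) = 0" if "g \<in> H - Hx" for g
      proof -
        have "act g x \<notin> N" using N(4)[of g x] that WD(1)[OF xW] by (auto simp: Hx_def)
        moreover have "act g x \<in> U" using lin_chartD(6)[OF L] that xU by blast
        ultimately have "h (act g x) \<notin> h ` N" using ch(2) NU by (auto dest: inj_onD)
        then show ?thesis by (simp add: q_def)
      qed
      have l0: "\<rho> (inv g) 0 = 0" if "g \<in> H" for g
        using linear_0[OF bounded_linear.linear[OF bl[OF invH[OF that]]]] .
      have "(\<Sum>g\<in>H. \<rho> (inv g) (q (h (act g x)))) = (\<Sum>g\<in>Hx. \<rho> (inv g) (q (h (act g x))))"
        by (rule sum.mono_neutral_right[OF finH Hx(2)]) (use z l0 in auto)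
      also have "\<dots> = (\<Sum>g\<in>Hx. \<rho> (inv g) (f (\<psi> (act g x)) + p (\<psi> (act g x))) - h x)"
      proof (rule sum.cong[OF refl])
        fix g assume g: "g \<in> Hx"
        then have gH: "g \<in> H" using Hx by blast
        have gN: "act g x \<in> N" using WD(2)[OF xW g] by (simp add: B_def)
        have "\<rho> (inv g) (f (\<psi> (act g x)) + p (\<psi> (act g x))) =
            \<rho> (inv g) (\<rho> g (h x)) + \<rho> (inv g) (p (\<psi> (act g x)))"
          unfolding f\<psi>[OF gN] lin_chartD(7)[OF L gH xU]
          by (rule linear_add[OF bounded_linear.linear[OF bl[OF invH[OF gH]]]])
        then show "\<rho> (inv g) (q (h (act g x))) = \<rho> (inv g) (f (\<psi> (act g x)) + p (\<psi> (act g x))) - h x"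
          by (simp add: lin_chart_inverse[OF L gH] qh[OF gN])
      qed
      also have "\<dots> = (\<Sum>g\<in>Hx. \<rho> (inv g) (f (\<psi> (act g x)) + p (\<psi> (act g x)))) - real (card Hx) *\<^sub>R h x"
        by (simp add: sum_subtractf sum_constant_scaleR)
      finally show ?thesis using cardHx by (simp add: h'eq[OF xU] scaleR_diff_right)
    qed
    have new: "smooth_wrt S (\<lambda>y. T (h y)) y" if yW: "y \<in> W" for y
    proof (rule smooth_wrt_cong[OF S _ W(1) yW])
      show "smooth_wrt S (\<lambda>x. (1 / real (card Hx)) *\<^sub>R
          (\<Sum>g\<in>Hx. \<rho> (inv g) (f (\<psi> (act g x)) + p (\<psi> (act g x))))) y"
      proof (intro smooth_wrt_linear[OF bounded_linear_scaleR_right] smooth_wrt_sum)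
        fix g assume g: "g \<in> Hx"
        then have gH: "g \<in> H" using Hx by blast
        have gB: "act g y \<in> V" "\<psi> (act g y) \<in> ball c r" using WD(2)[OF yW g] N by (auto simp: B_def)
        have "smooth_wrt S (\<lambda>x. f (\<psi> x) + p (\<psi> x)) (act g y)"
          by (rule sm1[OF gB(1) p(4)[OF gB(2)]])
        then have "smooth_wrt S (\<lambda>x. f (\<psi> (act g x)) + p (\<psi> (act g x))) y"
          by (rule smooth_wrt_act[OF S lin_chartD(9)[OF L gH], of "\<lambda>x. f (\<psi> x) + p (\<psi> x)"])
        then show "smooth_wrt S (\<lambda>x. \<rho> (inv g) (f (\<psi> (act g x)) + p (\<psi> (act g x)))) y"
          by (rule smooth_wrt_linear[OF bl[OF invH[OF gH]]])
      qed
    qed (simp add: h'W)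
    show "\<exists>h'. lin_chart H \<rho> U h' \<and> (\<forall>y\<in>U. smooth_wrt S h y \<or> y \<in> W \<longrightarrow> smooth_wrt S h' y)"
      using L' old new by blast
  qed
qed

end

section \<open>A smooth atlas on which the group acts smoothly\<close>

context C1_action begin

lemma smoothing_on_compact:
  assumes S: "smooth_system S" and L: "lin_chart H \<rho> U h" and C: "compactin M C" "C \<subseteq> U"
    and cov: "\<And>x. x \<in> C \<Longrightarrow> covered S x"
  obtains h' W where "lin_chart H \<rho> U h'" "openin M W" "C \<subseteq> W"
    "\<And>y. y \<in> U \<Longrightarrow> y \<in> W \<Longrightarrow> smooth_wrt S h' y"
proof -
  have "\<exists>W. openin M W \<and> x \<in> W \<and> (\<forall>h. lin_chart H \<rho> U h \<longrightarrow> (\<exists>h'. lin_chart H \<rho> U h' \<and>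
       (\<forall>y\<in>U. smooth_wrt S h y \<or> y \<in> W \<longrightarrow> smooth_wrt S h' y)))" if x: "x \<in> C" for x
    by (rule smoothing_at_point[OF S _ cov[OF x] L]) (use x C in blast)+
  then obtain W where W: "\<And>x. x \<in> C \<Longrightarrow> openin M (W x)" "\<And>x. x \<in> C \<Longrightarrow> x \<in> W x"
    "\<And>x h. x \<in> C \<Longrightarrow> lin_chart H \<rho> U h \<Longrightarrow> \<exists>h'. lin_chart H \<rho> U h' \<and>
       (\<forall>y\<in>U. smooth_wrt S h y \<or> y \<in> W x \<longrightarrow> smooth_wrt S h' y)"
    by metis
  have "\<exists>\<F>. finite \<F> \<and> \<F> \<subseteq> W ` C \<and> C \<subseteq> \<Union>\<F>"
    by (rule compactinD[OF C(1)]) (use W in auto)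
  then obtain \<F> where \<F>: "finite \<F>" "\<F> \<subseteq> W ` C" "C \<subseteq> \<Union>\<F>" by blast
  then obtain F where F: "finite F" "F \<subseteq> C" "C \<subseteq> \<Union>(W ` F)"
    using finite_subset_image[OF \<F>(1,2)] by blast
  have "\<exists>h'. lin_chart H \<rho> U h' \<and> (\<forall>y\<in>U. y \<in> \<Union>(W ` F) \<longrightarrow> smooth_wrt S h' y)"
    using F(1,2)
  proof (induction F)
    case empty then show ?case using L by auto
  next
    case (insert x F)
    then obtain h' where h': "lin_chart H \<rho> U h'" "\<forall>y\<in>U. y \<in> \<Union>(W ` F) \<longrightarrow> smooth_wrt S h' y" by auto
    obtain h'' where "lin_chart H \<rho> U h''" "\<forall>y\<in>U. smooth_wrt S h' y \<or> y \<in> W x \<longrightarrow> smooth_wrt S h'' y"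
      using W(3)[OF _ h'(1), of x] insert.prems by blast
    then show ?case using h'(2) by (intro exI[of _ h'']) auto
  qed
  then show ?thesis using that[of _ "\<Union>(W ` F)"] F W(1) by blast
qed

text \<open>The inverse is \<open>C^1\<close> because both charts lie in the \<open>C^1\<close>
  atlas, and \<open>Ck_at_inv_into_C1\<close> raises this to smoothness. A smoothed chart is thus
  compared with the old ones in one direction, and the other follows.\<close>

lemma fun_at_inverse:
  assumes U: "C1chart U \<phi>" and V: "C1chart V \<psi>" and g: "g \<in> carrier G" and u: "u \<in> U" "act g u \<in> V"
    and sm: "fun_at \<infinity> U \<phi> (\<lambda>u. \<psi> (act g u)) u"
  shows "fun_at \<infinity> V \<psi> (\<lambda>y. \<phi> (act (inv g) y)) (act g u)"
proof -
  note cU = manifold_chartD[OF C1chart_imp_chart[OF U]] and cV = manifold_chartD[OF C1chart_imp_chart[OF V]]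
  define W where "W = U \<inter> {x \<in> topspace M. act g x \<in> V}"
  have W: "openin M W" "W \<subseteq> U" "u \<in> W" "W \<subseteq> topspace M"
    using cU cV(1) openin_act_preimage[OF g] u by (auto simp: W_def)
  define f where "f z = \<psi> (act g (inv_into U \<phi> z))" for z
  have f\<phi>: "f (\<phi> x) = \<psi> (act g x)" if "x \<in> U" for x using that cU(2) by (simp add: f_def)
  have img: "f ` \<phi> ` W = \<psi> ` act g ` W"
    unfolding image_image by (rule image_cong) (use f\<phi> W(2) in auto)
  have opS: "open (\<phi> ` W)" using cU(3) W by blast
  have opf: "open (f ` \<phi> ` W)"
    unfolding img by (rule cV(3)[OF openin_act[OF g W(1)]]) (auto simp: W_def)
  have inj: "inj_on f (\<phi> ` W)"
  proof (rule inj_onI)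
    fix z z' assume z: "z \<in> \<phi> ` W" "z' \<in> \<phi> ` W" "f z = f z'"
    then obtain x x' where x: "x \<in> W" "z = \<phi> x" "x' \<in> W" "z' = \<phi> x'" by blast
    then have "\<psi> (act g x) = \<psi> (act g x')" using z(3) f\<phi>[of x] f\<phi>[of x'] subsetD[OF W(2)] by auto
    then have "act g x = act g x'" using inj_onD[OF cV(2)] x by (auto simp: W_def)
    then have "x = x'" using inj_onD[OF inj_prop[OF g]] x W(4) by blast
    then show "z = z'" using x by simp
  qed
  have eq: "inv_into (\<phi> ` W) f z = \<phi> (act (inv g) (inv_into V \<psi> z))" if z: "z \<in> f ` \<phi> ` W" for z
  proof -
    obtain x where x: "x \<in> W" "z = f (\<phi> x)" using z by blast
    have "inv_into (\<phi> ` W) f z = \<phi> x" unfolding x(2) using x(1) inj by (intro inv_into_f_f) auto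
    moreover have "inv_into V \<psi> z = act g x"
      using x f\<phi>[of x] W(2) cV(2) by (auto simp: W_def)
    ultimately show ?thesis using act_inv(1)[OF g, of x] x W by auto
  qed
  have fu: "f (\<phi> u) = \<psi> (act g u)" using f\<phi> u by blast
  have "fun_at 1 V \<psi> (\<lambda>y. \<phi> (act (inv g) y)) (act g u)"
    by (rule C1chart_act[OF V U]) (use g u act_inv(1)[OF g, of u] W in auto)
  then have "Ck_at 1 (\<lambda>z. \<phi> (act (inv g) (inv_into V \<psi> z))) (f (\<phi> u))"
    by (simp add: fun_at_def fu)
  then have iv1: "Ck_at 1 (inv_into (\<phi> ` W) f) (f (\<phi> u))"
    by (rule Ck_at_cong[OF _ opf]) (use W(3) eq in auto)
  have fs: "Ck_at \<infinity> f (\<phi> u)" using sm by (simp add: fun_at_def f_def[abs_def])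
  have "\<phi> u \<in> \<phi> ` W" using W(3) by blast
  then have "Ck_at \<infinity> (inv_into (\<phi> ` W) f) (f (\<phi> u))"
    by (rule Ck_at_inv_into_C1[OF opS _ inj fs _ iv1]) simp
  then have "Ck_at \<infinity> (\<lambda>z. \<phi> (act (inv g) (inv_into V \<psi> z))) (f (\<phi> u))"
    by (rule Ck_at_cong[OF _ opf]) (use W(3) eq in auto)
  then show ?thesis by (simp add: fun_at_def fu)
qed

lemma C1chart_restrict:
  assumes U: "C1chart U \<phi>" and W: "openin M W" "W \<subseteq> U"
  shows "C1chart W \<phi>"
proof -
  note c = manifold_chartD[OF C1chart_imp_chart[OF U]]
  have mc: "manifold_chart M W \<phi>"
    unfolding manifold_chart_iff
  proof (intro conjI allI impI)
    fix T :: "'e set" assume "open T"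
    then have "openin M (W \<inter> {y\<in>U. \<phi> y \<in> T})" using c(4) W by blast
    moreover have "W \<inter> {y\<in>U. \<phi> y \<in> T} = {y\<in>W. \<phi> y \<in> T}" using W by auto
    ultimately show "openin M {y\<in>W. \<phi> y \<in> T}" by simp
  qed (use W c inj_on_subset[OF c(2) W(2)] in auto)
  show ?thesis
    unfolding C1chart_def
  proof (intro conjI allI impI ballI mc)
    fix V \<psi> y assume *: "(V, \<psi>) \<in> A" "y \<in> W \<inter> V"
    then have "fun_at 1 U \<phi> \<psi> y" "fun_at 1 V \<psi> \<phi> y" using U W(2) by (auto simp: C1chart_def)
    then show "fun_at 1 W \<phi> \<psi> y" "fun_at 1 V \<psi> \<phi> y"
      using fun_at_restrict[OF C1chart_imp_chart[OF U] W, of y 1 \<psi>] * by auto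
  qed
qed

text \<open>The old charts are restricted to an invariant neighbourhood \<open>N\<close> of \<open>K\<close> that meets the new chart
  domain \<open>P\<close> only where the new chart has been smoothed.\<close>

lemma extend_smooth_system:
  assumes S: "smooth_system S" and K: "closedin M K" "\<And>g x. g \<in> carrier G \<Longrightarrow> x \<in> K \<Longrightarrow> act g x \<in> K"
    and cov: "\<And>x. x \<in> K \<Longrightarrow> covered S x"
    and L: "lin_chart H \<rho> U h" and K': "closedin M K'" "K' \<subseteq> U"
  obtains S' where "smooth_system S'" "\<And>x. x \<in> K \<union> K' \<Longrightarrow> covered S' x"
proof -
  have UM: "U \<subseteq> topspace M" "openin M U" using lin_chartD[OF L] by auto
  \<comment> \<open>After shrinking the new domain to \<open>P\<close>, the overlap of its closure
    with \<open>K\<close> is a compact subset of \<open>U\<close>, so finitely many smoothings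
    suffice.\<close>
  have "\<exists>P. openin M P \<and> K' \<subseteq> P \<and> M closure_of P \<subseteq> U"
    using normal K' UM(2) by (simp add: normal_space_alt)
  then obtain P where P: "openin M P" "K' \<subseteq> P" "M closure_of P \<subseteq> U" by blast
  have clP: "closedin M (M closure_of P)" "P \<subseteq> M closure_of P"
    using closure_of_subset[OF openin_subset[OF P(1)]] by auto
  have cpt: "compactin M (K \<inter> M closure_of P)"
    using K(1) clP compact by (meson closedin_Int closedin_compact_space)
  have sub: "K \<inter> M closure_of P \<subseteq> U" using P by blast
  have cov': "covered S x" if "x \<in> K \<inter> M closure_of P" for x using cov that by blast
  obtain h' W where h': "lin_chart H \<rho> U h'" and W: "openin M W" "K \<inter> M closure_of P \<subseteq> W"
    and sm: "\<And>y. y \<in> U \<Longrightarrow> y \<in> W \<Longrightarrow> smooth_wrt S h' y"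
    by (rule smoothing_on_compact[OF S L cpt sub cov']) (assumption, rule that)
  \<comment> \<open>\<open>D\<close> is where the new chart may still fail to be smooth. Removing
    the whole orbit of \<open>D\<close> makes \<open>N\<close> invariant and costs no point of
    \<open>K\<close>, because \<open>K\<close> is invariant and misses \<open>D\<close>.\<close>
  define D where "D = M closure_of P - W"
  define N where "N = topspace M - (\<Union>g\<in>carrier G. act g ` D)"
  have D: "closedin M D" unfolding D_def using clP W by blast
  have DM: "D \<subseteq> topspace M" using closedin_subset[OF D] .
  have N: "openin M N"
    unfolding N_def using finite_G closedin_act[OF _ D]
    by (intro openin_diff closedin_Union) auto
  have Nact: "act g y \<in> N" if g: "g \<in> carrier G" and y: "y \<in> N" for g y
  proof -
    have "act g y \<notin> act k ` D" if k: "k \<in> carrier G" for k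
    proof
      assume "act g y \<in> act k ` D"
      then obtain d where d: "d \<in> D" "act g y = act k d" by blast
      have "y = act (inv g) (act k d)" using act_inv(1)[OF g, of y] y d(2) by (auto simp: N_def)
      also have "\<dots> = act (inv g \<otimes> k) d" using composition_rule[of d "inv g" k] d g k DM by auto
      finally show False using y d g k by (auto simp: N_def)
    qed
    then show ?thesis using act_closed[OF g] y by (auto simp: N_def)
  qed
  have KN: "K \<subseteq> N"
  proof
    fix x assume x: "x \<in> K"
    have xM: "x \<in> topspace M" using closedin_subset[OF K(1)] x by blast
    have "x \<notin> act g ` D" if g: "g \<in> carrier G" for g
    proof
      assume "x \<in> act g ` D"
      then obtain d where d: "d \<in> D" "x = act g d" by blast
      then have "d \<in> K" using K(2)[of "inv g" x] g x act_inv(1)[OF g, of d] DM by auto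
      then show False using d W by (auto simp: D_def)
    qed
    then show "x \<in> N" using xM by (auto simp: N_def)
  qed
  have NP: "y \<in> W" if "y \<in> N" "y \<in> P" for y
  proof (rule ccontr)
    assume "y \<notin> W"
    then have "y \<in> D" using that clP by (auto simp: D_def)
    then have "y \<in> act \<one> ` D" using act_one[of y] DM by (metis image_eqI subsetD)
    then show False using that by (auto simp: N_def)
  qed
  have PU: "P \<subseteq> U" using P clP by blast
  have hP: "C1chart P h'" by (rule C1chart_restrict[OF lin_chartD(1)[OF h'] P(1) PU])
  define S' where "S' = insert (P, h') ((\<lambda>(V, \<psi>). (V \<inter> N, \<psi>)) ` S)"
  have res: "C1chart (V \<inter> N) \<psi>" and rf: "\<And>y f. y \<in> V \<Longrightarrow> y \<in> N \<Longrightarrow> fun_at \<infinity> V \<psi> f y \<Longrightarrow> fun_at \<infinity> (V \<inter> N) \<psi> (f::'a \<Rightarrow> 'e) y"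
    if "(V, \<psi>) \<in> S" for V \<psi>
  proof -
    note c = smooth_systemD(1)[OF S that]
    have o: "openin M (V \<inter> N)" using manifold_chartD(1)[OF C1chart_imp_chart[OF c]] N by blast
    show "C1chart (V \<inter> N) \<psi>" by (rule C1chart_restrict[OF c o]) auto
    show "\<And>y f. y \<in> V \<Longrightarrow> y \<in> N \<Longrightarrow> fun_at \<infinity> V \<psi> f y \<Longrightarrow> fun_at \<infinity> (V \<inter> N) \<psi> (f::'a \<Rightarrow> 'e) y"
      using fun_at_restrict[OF C1chart_imp_chart[OF c] o] by auto
  qed
  have a: "fun_at \<infinity> (V \<inter> N) \<psi> (\<lambda>y. h' (act g y)) y"
    if "(V, \<psi>) \<in> S" "g \<in> carrier G" "y \<in> V \<inter> N" "act g y \<in> P" for V \<psi> g y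
  proof (rule rf[OF that(1)])
    have "act g y \<in> W" using NP[OF Nact] that by blast
    then have "smooth_wrt S h' (act g y)" using sm that(4) PU by blast
    then show "fun_at \<infinity> V \<psi> (\<lambda>y. h' (act g y)) y" using that by (auto simp: smooth_wrt_def)
  qed (use that in auto)
  have b: "fun_at \<infinity> P h' (\<lambda>y. \<psi> (act g y)) y"
    if V: "(V, \<psi>) \<in> S" and g: "g \<in> carrier G" and y: "y \<in> P" "act g y \<in> V \<inter> N" for V \<psi> g y
  proof -
    have yM: "y \<in> topspace M" using y PU UM by blast
    have *: "act (inv g) (act g y) = y" using act_inv(1)[OF g yM] .
    have "fun_at \<infinity> P h' (\<lambda>y. \<psi> (act (inv (inv g)) y)) (act (inv g) (act g y))"
      by (rule fun_at_inverse[OF res[OF V] hP _ y(2) _ a[OF V]]) (use g y * in auto)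
    then show ?thesis using g by (simp add: *)
  qed
  \<comment> \<open>An element that returns a point of \<open>P\<close> to \<open>P\<close> lies in
    \<open>H\<close>, hence acts linearly in \<open>h'\<close>: the new chart agrees with its own
    translates.\<close>
  have c: "fun_at \<infinity> P h' (\<lambda>y. h' (act g y)) y"
    if g: "g \<in> carrier G" and y: "y \<in> P" "act g y \<in> P" for g y
  proof -
    have gH: "g \<in> H" using lin_chartD(8)[OF h' g] y PU by blast
    have "fun_at \<infinity> P h' (\<lambda>y. \<rho> g (h' y)) y"
      by (rule fun_at_post[OF C1chart_imp_chart[OF hP] y(1) fun_at_ident[OF C1chart_imp_chart[OF hP] y(1)]])
        (rule Ck_at_bounded_linear[OF lin_chartD(3)[OF h' gH]])
    then show ?thesis
      by (rule fun_at_cong[OF C1chart_imp_chart[OF hP] _ P(1) y(1) y(1)])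
        (use lin_chartD(7)[OF h' gH] PU in auto)
  qed
  have d: "fun_at \<infinity> (V \<inter> N) \<psi> (\<lambda>y. \<psi>' (act g y)) y"
    if "(V, \<psi>) \<in> S" "(V', \<psi>') \<in> S" "g \<in> carrier G" "y \<in> V \<inter> N" "act g y \<in> V'" for V \<psi> V' \<psi>' g y
    by (rule rf[OF that(1)]) (use that smooth_systemD(2)[OF S that(1,2,3)] in auto)
  have "smooth_system S'"
    unfolding smooth_system_def
  proof (intro conjI allI impI)
    show "C1chart V \<psi>" if "(V, \<psi>) \<in> S'" for V \<psi> using that res hP by (auto simp: S'_def)
    show "fun_at \<infinity> V \<psi> (\<lambda>y. \<psi>' (act g y)) y"
      if "(V, \<psi>) \<in> S'" "(V', \<psi>') \<in> S'" "g \<in> carrier G" "y \<in> V" "act g y \<in> V'" for V \<psi> V' \<psi>' g y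
      using that a b c d by (auto simp: S'_def)
  qed
  moreover have "covered S' x" if "x \<in> K \<union> K'" for x
  proof (cases "x \<in> K'")
    case True
    then have xP: "x \<in> P" using P(2) by blast
    then have "act \<one> x = x" using PU UM(1) by (intro act_one) blast
    with xP have "act \<one> x \<in> P" by simp
    then show ?thesis unfolding covered_def S'_def using one_closed by blast
  next
    case False
    then have x: "x \<in> K" using that by blast
    then obtain V \<psi> g where V: "(V, \<psi>) \<in> S" "g \<in> carrier G" "act g x \<in> V"
      using cov[OF x] unfolding covered_def by blast
    then have "act g x \<in> V \<inter> N" using Nact KN x by blast
    moreover have "(V \<inter> N, \<psi>) \<in> S'" using V(1) by (force simp: S'_def)
    ultimately show ?thesis unfolding covered_def using V(2) by blast
  qed
  ultimately show ?thesis using that by blast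
qed


section \<open>Linear charts at every point, and the global system\<close>

lemma lin_chart_exists:
  assumes x: "x \<in> topspace M"
  obtains H \<rho> U h where "lin_chart H \<rho> U h" "x \<in> U"
proof -
  obtain U0 \<phi> where U0: "(U0, \<phi>) \<in> A" "x \<in> U0" using chart_cover[OF x] by blast
  note C0 = atlas_C1chart[OF U0(1)]
  note c0 = manifold_chartD[OF C1chart_imp_chart[OF C0]]
  define H where "H = stabilizer G act x"
  have H: "subgroup H G" unfolding H_def by (rule stabilizer_subgroup[OF x])
  have Hx: "g \<in> H \<longleftrightarrow> g \<in> carrier G \<and> act g x = x" for g by (simp add: H_def stabilizer_def)
  have finH: "finite H" using finite_subset[OF subgroup.subset[OF H] finite_G] .
  have invH: "inv g \<in> H" if "g \<in> H" for g using subgroup.m_inv_closed[OF H that] .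
  have oneH: "\<one> \<in> H" using subgroup.one_closed[OF H] .
  have cardH: "card H > 0" using finH oneH by (auto simp: card_gt_0_iff)
  define a where "a = \<phi> x"
  have inva: "inv_into U0 \<phi> a = x" using c0(2) U0(2) by (simp add: a_def)
  \<comment> \<open>The action in coordinates. All elements of the stabiliser fix \<open>a\<close>,
    so by the chain rule their derivatives at \<open>a\<close> multiply: \<open>\<rho>\<close> is
    the representation on the tangent space at \<open>x\<close>.\<close>
  define \<theta> where "\<theta> g z = \<phi> (act g (inv_into U0 \<phi> z))" for g z
  have \<theta>a: "\<theta> g a = a" if "g \<in> H" for g using that Hx by (simp add: \<theta>_def inva) (simp add: a_def)
  have \<theta>C1: "Ck_at 1 (\<theta> g) a" if "g \<in> H" for g
    using C1chart_act[OF C0 C0, of g x] that U0 Hx by (simp add: fun_at_def \<theta>_def[abs_def] a_def)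
  have "\<exists>D. (\<theta> g has_derivative D) (at a)" if "g \<in> H" for g using Ck_at_1_has_derivative[OF \<theta>C1[OF that]] by blast
  then obtain \<rho> where \<rho>: "\<And>g. g \<in> H \<Longrightarrow> (\<theta> g has_derivative \<rho> g) (at a)" by metis
  have bl: "bounded_linear (\<rho> g)" if "g \<in> H" for g using has_derivative_bounded_linear[OF \<rho>[OF that]] .
  have \<rho>1: "\<rho> \<one> v = v" for v
  proof -
    have "((\<lambda>z. z) has_derivative \<rho> \<one>) (at a)"
      by (rule has_derivative_transform_within_open[OF \<rho>[OF oneH] c0(5)])
        (use U0(2) act_one c0(6) c0(2) in \<open>auto simp: a_def \<theta>_def subset_iff\<close>)
    then show ?thesis using has_derivative_unique[OF _ has_derivative_ident] by metis
  qed
  have \<rho>m: "\<rho> (g \<otimes> k) v = \<rho> g (\<rho> k v)" if g: "g \<in> H" and k: "k \<in> H" for g k v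
  proof -
    have gk: "g \<otimes> k \<in> H" using subgroup.m_closed[OF H g k] .
    have G: "g \<in> carrier G" "k \<in> carrier G" using g k Hx by auto
    define W where "W = U0 \<inter> {y \<in> topspace M. act k y \<in> U0}"
    have W: "openin M W" "W \<subseteq> U0" "x \<in> W" using c0(1) openin_act_preimage[OF G(2)] U0 x k Hx by (auto simp: W_def)
    have "(\<theta> g has_derivative \<rho> g) (at (\<theta> k a))" using \<rho>[OF g] by (simp add: \<theta>a[OF k])
    then have "((\<lambda>z. \<theta> g (\<theta> k z)) has_derivative (\<lambda>v. \<rho> g (\<rho> k v))) (at a)"
      by (rule has_derivative_compose[OF \<rho>[OF k]])
    then have d: "(\<theta> (g \<otimes> k) has_derivative (\<lambda>v. \<rho> g (\<rho> k v))) (at a)"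
    proof (rule has_derivative_transform_within_open)
      show "open (\<phi> ` W)" using c0(3) W by blast
      show "a \<in> \<phi> ` W" using W by (simp add: a_def)
      fix z assume "z \<in> \<phi> ` W"
      then obtain y where y: "y \<in> W" "z = \<phi> y" by blast
      then have "y \<in> U0" "act k y \<in> U0" "y \<in> topspace M" by (auto simp: W_def)
      then show "\<theta> g (\<theta> k z) = \<theta> (g \<otimes> k) z"
        using y(2) c0(2) composition_rule[of y g k] G by (simp add: \<theta>_def)
    qed
    show ?thesis using has_derivative_unique[OF \<rho>[OF gk] d] by simp
  qed
  \<comment> \<open>Keeps the elements outside the stabiliser from returning a point, for the last
    clause of \<open>lin_chart\<close>.\<close>
  obtain N0 where N0: "openin M N0" "x \<in> N0" "N0 \<subseteq> U0"
    "\<And>g y. g \<in> carrier G \<Longrightarrow> act g x \<noteq> x \<Longrightarrow> y \<in> N0 \<Longrightarrow> act g y \<notin> N0"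
    by (rule separating_nhd[OF x subset_refl c0(1) U0(2)]) (rule that)
  \<comment> \<open>The twist by \<open>\<rho> (inv g)\<close> has two effects: the average becomes
    equivariant, and every summand has the identity as derivative at \<open>a\<close>, so that
    \<open>F\<close> is invertible near \<open>a\<close>.\<close>
  define F where "F z = (1 / real (card H)) *\<^sub>R (\<Sum>g\<in>H. \<rho> (inv g) (\<theta> g z))" for z
  have FC1: "Ck_at 1 F a"
    unfolding F_def[abs_def]
    by (intro Ck_at_scaleR Ck_at_const Ck_at_sum Ck_at_linear_comp[OF bl[OF invH] \<theta>C1])
  have "(F has_derivative (\<lambda>v. (1 / real (card H)) *\<^sub>R (\<Sum>g\<in>H. \<rho> (inv g) (\<rho> g v)))) (at a)"
    unfolding F_def[abs_def]
    by (intro has_derivative_scaleR_right has_derivative_sum bounded_linear.has_derivative[OF bl[OF invH] \<rho>])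
  moreover have "\<rho> (inv g) (\<rho> g v) = v" if "g \<in> H" for g v
    using \<rho>m[OF invH[OF that] that, of v] \<rho>1 Hx that by simp
  ultimately have Fd: "(F has_derivative (\<lambda>v. v)) (at a)"
    using cardH by (simp add: sum_constant_scaleR cong: sum.cong)
  obtain Z where Z: "open Z" "a \<in> Z" "inj_on F Z" "\<And>z. z \<in> Z \<Longrightarrow> Ck_at 1 F z"
    "\<And>z. z \<in> Z \<Longrightarrow> Ck_at 1 (inv_into Z F) (F z)"
    by (rule local_C1_inverse[OF FC1 Fd]) (rule that)
  define W where "W = N0 \<inter> {y \<in> U0. \<phi> y \<in> Z}"
  have W: "openin M W" "x \<in> W" "W \<subseteq> N0" using N0 c0(4)[OF Z(1)] Z(2) U0 by (auto simp: W_def a_def)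
  \<comment> \<open>The points whose \<open>H\<close>-translates all stay in \<open>W\<close>: an
    open neighbourhood of \<open>x\<close> that \<open>H\<close> preserves.\<close>
  define U where "U = topspace M \<inter> \<Inter>((\<lambda>g. {y \<in> topspace M. act g y \<in> W}) ` H)"
  have Uo: "openin M U"
    unfolding U_def using finH W(1) Hx oneH
    by (intro openin_Int openin_topspace openin_Inter) (auto intro!: openin_act_preimage)
  have xU: "x \<in> U" using x W(2) Hx by (auto simp: U_def)
  have UW: "act g y \<in> W" if "g \<in> H" "y \<in> U" for g y using that by (auto simp: U_def)
  have UM: "U \<subseteq> topspace M" by (auto simp: U_def)
  have UsubW: "U \<subseteq> W"
  proof
    fix y assume "y \<in> U"
    then show "y \<in> W" using UW[OF oneH, of y] act_one[of y] UM by auto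
  qed
  have UU0: "U \<subseteq> U0" using UsubW by (auto simp: W_def)
  have C1: "C1chart U (\<lambda>y. F (\<phi> y))"
    by (rule C1chart_post[OF C0 Uo UU0 _ Z(3)]) (use UsubW Z in \<open>auto simp: W_def\<close>)
  have hF: "F (\<phi> y) = (1 / real (card H)) *\<^sub>R (\<Sum>g\<in>H. \<rho> (inv g) (\<phi> (act g y)))" if "y \<in> U" for y
    using that UU0 c0(2) by (auto simp: F_def \<theta>_def subset_iff)
  have Uact: "act k y \<in> U" if k: "k \<in> H" and y: "y \<in> U" for k y
  proof -
    have kG: "k \<in> carrier G" and yM: "y \<in> topspace M" using k y Hx UM by auto
    have "act g (act k y) \<in> W" if "g \<in> H" for g
      using UW[OF subgroup.m_closed[OF H that k] y] composition_rule[OF yM, of g k] that Hx kG by auto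
    then show ?thesis using act_closed[OF kG yM] act_closed Hx by (auto simp: U_def)
  qed
  have "lin_chart H \<rho> U (\<lambda>y. F (\<phi> y))"
    unfolding lin_chart_def
  proof (intro conjI ballI allI C1 H bl \<rho>m \<rho>1 Uact)
    fix k y assume k: "k \<in> H" and y: "y \<in> U"
    have yM: "y \<in> topspace M" using y UM by blast
    show "F (\<phi> (act k y)) = \<rho> k (F (\<phi> y))"
      unfolding hF[OF y] hF[OF Uact[OF k y]]
      using equivariant_average[OF H bl \<rho>m k yM, of \<phi>]
      by (simp add: linear_scale[OF bounded_linear.linear[OF bl[OF k]]])
  next
    fix g y assume g: "g \<in> carrier G - H" and y: "y \<in> U"
    then have "act g x \<noteq> x" using Hx by blast
    then have "act g y \<notin> N0" using N0(4)[of g y] g y UsubW W(3) by blast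
    then show "act g y \<notin> U" using UsubW W(3) by blast
  qed
  then show ?thesis using that xU by blast
qed

lemma global_smooth_system:
  obtains S where "smooth_system S" "\<And>x. x \<in> topspace M \<Longrightarrow> covered S x"
proof -
  have "\<exists>H \<rho> U h P. lin_chart H \<rho> U h \<and> openin M P \<and> x \<in> P \<and> M closure_of P \<subseteq> U" if x: "x \<in> topspace M" for x
  proof -
    obtain H \<rho> U h where L: "lin_chart H \<rho> U h" "x \<in> U" by (rule lin_chart_exists[OF x])
    have "closedin M {x} \<and> openin M U \<and> {x} \<subseteq> U"
      using closedin_Hausdorff_sing_eq[OF Hausdorff] x lin_chartD(13)[OF L(1)] L(2) by blast
    then have "\<exists>P. openin M P \<and> {x} \<subseteq> P \<and> M closure_of P \<subseteq> U"
      using normal unfolding normal_space_alt by blast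
    then show ?thesis using L(1) by blast
  qed
  then obtain H \<rho> U h P where L: "\<And>x. x \<in> topspace M \<Longrightarrow> lin_chart (H x) (\<rho> x) (U x) (h x)"
    and P: "\<And>x. x \<in> topspace M \<Longrightarrow> openin M (P x)" "\<And>x. x \<in> topspace M \<Longrightarrow> x \<in> P x"
      "\<And>x. x \<in> topspace M \<Longrightarrow> M closure_of (P x) \<subseteq> U x"
    by metis
  have "\<exists>\<F>. finite \<F> \<and> \<F> \<subseteq> P ` topspace M \<and> topspace M \<subseteq> \<Union>\<F>"
    using compact P unfolding compact_space_def by (intro compactinD) auto
  then obtain \<F> where \<F>: "finite \<F>" "\<F> \<subseteq> P ` topspace M" "topspace M \<subseteq> \<Union>\<F>" by blast
  then obtain F where F: "finite F" "F \<subseteq> topspace M" "topspace M \<subseteq> \<Union>(P ` F)"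
    using finite_subset_image[OF \<F>(1,2)] by blast
  \<comment> \<open>\<open>extend_smooth_system\<close> wants the part covered so far to be closed
    and invariant, so the induction runs over the saturations of the closures. It covers only the
    new closure itself; \<open>cov_act\<close> spreads this along orbits.\<close>
  define E where "E x = (\<Union>g\<in>carrier G. act g ` (M closure_of (P x)))" for x
  have Ecl: "closedin M (E x)" for x
    unfolding E_def using finite_G closedin_act by (intro closedin_Union) auto
  have Eact: "act g y \<in> E x" if g: "g \<in> carrier G" and y: "y \<in> E x" for g x y
  proof -
    obtain k d where k: "k \<in> carrier G" "d \<in> M closure_of (P x)" "y = act k d" using y by (auto simp: E_def)
    have "d \<in> topspace M" using k(2) closure_of_subset_topspace by fast
    then have "act g y = act (g \<otimes> k) d" using composition_rule[of d g k] g k by auto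
    then show ?thesis using k m_closed[OF g k(1)] by (auto simp: E_def)
  qed
  have cov_act: "covered S y" if cv: "covered S (act g y)" and g: "g \<in> carrier G" and y: "y \<in> topspace M" for S g y
  proof -
    obtain V \<psi> k where V: "(V, \<psi>) \<in> S" "k \<in> carrier G" "act k (act g y) \<in> V"
      using cv unfolding covered_def by blast
    then have "act (k \<otimes> g) y \<in> V" using composition_rule[OF y _ g, of k] by simp
    then show ?thesis unfolding covered_def using V m_closed[OF V(2) g] by blast
  qed
  have "\<exists>S. smooth_system S \<and> (\<forall>y\<in>\<Union>(E ` F). covered S y)"
    using F(1,2)
  proof (induction F)
    case empty
    have "smooth_system {}" by (simp add: smooth_system_def)
    then show ?case by blast
  next
    case (insert x F)
    then obtain S where S: "smooth_system S" "\<forall>y\<in>\<Union>(E ` F). covered S y" by auto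
    have x: "x \<in> topspace M" using insert.prems by blast
    have cl: "closedin M (\<Union>(E ` F))" using Ecl insert.hyps(1) by (intro closedin_Union) auto
    have ea: "act g y \<in> \<Union>(E ` F)" if "g \<in> carrier G" "y \<in> \<Union>(E ` F)" for g y
      using Eact that by blast
    have ec: "covered S y" if "y \<in> \<Union>(E ` F)" for y using S(2) that by blast
    obtain S' where S': "smooth_system S'" "\<And>y. y \<in> \<Union>(E ` F) \<union> M closure_of (P x) \<Longrightarrow> covered S' y"
      by (rule extend_smooth_system[OF S(1) cl ea ec L[OF x] closedin_closure_of P(3)[OF x]])
        (assumption, assumption, assumption, rule that)
    have "covered S' y" if y: "y \<in> E x" for y
    proof -
      obtain k d where k: "k \<in> carrier G" "d \<in> M closure_of (P x)" "y = act k d" using y by (auto simp: E_def)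
      have dM: "d \<in> topspace M" using k(2) closure_of_subset_topspace by fast
      have "covered S' (act (inv k) y)" using S'(2)[of d] k act_inv(1)[OF k(1) dM] by simp
      then show ?thesis using cov_act k dM act_closed by blast
    qed
    then show ?case using S' by (intro exI[of _ S']) auto
  qed
  then obtain S where S: "smooth_system S" "\<forall>y\<in>\<Union>(E ` F). covered S y" by blast
  have "covered S x" if x: "x \<in> topspace M" for x
  proof -
    obtain y where y: "y \<in> F" "x \<in> P y" using F(3) x by blast
    then have "P y \<subseteq> topspace M" using P(1) F(2) openin_subset by blast
    then have "x \<in> M closure_of (P y)" using y closure_of_subset by blast
    then have "x \<in> E y" unfolding E_def using one_closed act_one[OF x] by (metis UN_I image_eqI)
    then show ?thesis using S(2) y by blast
  qed
  then show ?thesis using that S by blast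
qed


text \<open>Adding all translates makes the domains contain the points themselves, where
  \<open>covered\<close> only asks that their orbits be met.\<close>

lemma smooth_system_covering:
  obtains S where "smooth_system S" "\<And>x. x \<in> topspace M \<Longrightarrow> \<exists>U \<phi>. (U, \<phi>) \<in> S \<and> x \<in> U"
proof -
  obtain S where S: "smooth_system S" and cov: "\<And>x. x \<in> topspace M \<Longrightarrow> covered S x"
    by (rule global_smooth_system) (rule that)
  define tr where "tr U \<phi> g = ({y \<in> topspace M. act g y \<in> U}, \<lambda>y. \<phi> (act g y))"
    for U g and \<phi> :: "'a \<Rightarrow> 'e"
  define S' where "S' = {tr U \<phi> g |U \<phi> g. (U, \<phi>) \<in> S \<and> g \<in> carrier G}"
  have "smooth_system S'"
    unfolding smooth_system_def
  proof (intro conjI allI impI)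
    show "C1chart V \<psi>" if "(V, \<psi>) \<in> S'" for V \<psi>
      using that chart_translate(1)[OF smooth_systemD(1)[OF S]] by (auto simp: S'_def tr_def)
    fix V1 \<psi>1 V2 \<psi>2 k y
    assume 1: "(V1, \<psi>1) \<in> S'" and 2: "(V2, \<psi>2) \<in> S'" and k: "k \<in> carrier G"
      and y: "y \<in> V1" "act k y \<in> V2"
    from 1 obtain U1 \<phi>1 g1 where U1: "(U1, \<phi>1) \<in> S" "g1 \<in> carrier G"
      "V1 = {y \<in> topspace M. act g1 y \<in> U1}" "\<psi>1 = (\<lambda>y. \<phi>1 (act g1 y))" by (auto simp: S'_def tr_def)
    from 2 obtain U2 \<phi>2 g2 where U2: "(U2, \<phi>2) \<in> S" "g2 \<in> carrier G"
      "V2 = {y \<in> topspace M. act g2 y \<in> U2}" "\<psi>2 = (\<lambda>y. \<phi>2 (act g2 y))" by (auto simp: S'_def tr_def)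
    have yM: "y \<in> topspace M" and g1y: "act g1 y \<in> U1" using y U1 by auto
    \<comment> \<open>Between the translates by \<open>g1\<close> and by \<open>g2\<close>, the map
      \<open>act k\<close> becomes \<open>act (g2 \<otimes> k \<otimes> inv g1)\<close> between the
      original charts.\<close>
    have c: "act (g2 \<otimes> k \<otimes> inv g1) u = act g2 (act k (act (inv g1) u))" if "u \<in> topspace M" for u
      using that composition_rule act_closed U1(2) U2(2) k by simp
    note C1 = smooth_systemD(1)[OF S U1(1)]
    have "fun_at \<infinity> U1 \<phi>1 (\<lambda>u. \<phi>2 (act (g2 \<otimes> k \<otimes> inv g1) u)) (act g1 y)"
      by (rule smooth_systemD(2)[OF S U1(1) U2(1) _ g1y])
        (use U1 U2 k y yM c act_closed act_inv in auto)
    then have "fun_at \<infinity> U1 \<phi>1 (\<lambda>u. \<psi>2 (act k (act (inv g1) u))) (act g1 y)"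
      by (rule fun_at_cong[OF C1chart_imp_chart[OF C1] _ openin_topspace])
        (use g1y yM act_closed U1(2) c in \<open>auto simp: U2(4)\<close>)
    then show "fun_at \<infinity> V1 \<psi>1 (\<lambda>y. \<psi>2 (act k y)) y"
      unfolding U1(3,4) using chart_translate(2)[OF C1 U1(2), of y \<infinity> "\<lambda>y. \<psi>2 (act k y)"] yM g1y by simp
  qed
  moreover have "\<exists>U \<phi>. (U, \<phi>) \<in> S' \<and> x \<in> U" if x: "x \<in> topspace M" for x
  proof -
    obtain U \<phi> g where "(U, \<phi>) \<in> S" "g \<in> carrier G" "act g x \<in> U"
      using cov[OF x] unfolding covered_def by blast
    then show ?thesis using x
      by (intro exI[of _ "{y \<in> topspace M. act g y \<in> U}"] exI[of _ "\<lambda>y. \<phi> (act g y)"]) (auto simp: S'_def tr_def)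
  qed
  ultimately show ?thesis using that by blast
qed

end

section \<open>The orbit space\<close>

context C1_action begin

lemma orbit_eq_iff:
  assumes "x \<in> topspace M" "y \<in> topspace M"
  shows "orbit G act x = orbit G act y \<longleftrightarrow> (\<exists>g\<in>carrier G. act g x = y)"
proof
  assume "orbit G act x = orbit G act y"
  then have "y \<in> orbit G act x" using orbit_refl[OF assms(2)] by simp
  then show "\<exists>g\<in>carrier G. act g x = y" by (auto simp: orbit_def)
next
  assume "\<exists>g\<in>carrier G. act g x = y"
  then obtain g where g: "g \<in> carrier G" "act g x = y" by blast
  have "z \<in> orbit G act x \<longleftrightarrow> z \<in> orbit G act y" for z
  proof
    assume "z \<in> orbit G act x"
    then obtain k where k: "k \<in> carrier G" "z = act k x" by (auto simp: orbit_def)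
    have "act (k \<otimes> inv g) y = z"
      using composition_rule[of y k "inv g"] act_inv(1)[OF g(1) assms(1)] g k assms by simp
    moreover have "k \<otimes> inv g \<in> carrier G" using g k by blast
    ultimately show "z \<in> orbit G act y" unfolding orbit_def by blast
  next
    assume "z \<in> orbit G act y"
    then obtain k where k: "k \<in> carrier G" "z = act k y" by (auto simp: orbit_def)
    have "act (k \<otimes> g) x = z" using composition_rule[of x k g] g k assms by simp
    moreover have "k \<otimes> g \<in> carrier G" using g k by blast
    ultimately show "z \<in> orbit G act x" unfolding orbit_def by blast
  qed
  then show "orbit G act x = orbit G act y" by blast
qed

lemma orbit_preimage_image:
  assumes "W \<subseteq> topspace M"
  shows "{x \<in> topspace M. orbit G act x \<in> orbit G act ` W} = (\<Union>g\<in>carrier G. act g ` W)"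
proof -
  have "x \<in> (\<Union>g\<in>carrier G. act g ` W)" if x: "x \<in> topspace M" "orbit G act x \<in> orbit G act ` W" for x
  proof -
    obtain w where w: "w \<in> W" "orbit G act w = orbit G act x" using x(2) by force
    then obtain g where "g \<in> carrier G" "act g w = x"
      using orbit_eq_iff[of w x] x(1) assms by blast
    then show ?thesis using w by blast
  qed
  moreover have "act g w \<in> topspace M" "orbit G act (act g w) \<in> orbit G act ` W"
    if "g \<in> carrier G" "w \<in> W" for g w
  proof -
    have w: "w \<in> topspace M" using that assms by blast
    then show "act g w \<in> topspace M" using act_closed that by blast
    then have "orbit G act w = orbit G act (act g w)" using orbit_eq_iff[OF w] that by blast
    then show "orbit G act (act g w) \<in> orbit G act ` W" using that by (metis imageI)
  qed
  ultimately show ?thesis by blast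
qed

lemma openin_orbit_image: "openin M W \<Longrightarrow> openin (orbit_space M G act) (orbit G act ` W)"
  using orbit_preimage_image[OF openin_subset, of W] openin_act openin_subset[of M W]
  by (auto simp: openin_orbit_space orbits_def)

text \<open>The saturation of a closed set is a finite union of closed translates, so the projection
  is a closed map, and closed continuous images of normal Hausdorff spaces are Hausdorff.\<close>

lemma Hausdorff_orbit_space: "Hausdorff_space (orbit_space M G act)"
proof -
  let ?Y = "orbit_space M G act"
  have q: "quotient_map M ?Y (orbit G act)" by (rule quotient_map_orbit_space)
  have "closed_map M ?Y (orbit G act)"
    unfolding closed_map_def
  proof (intro allI impI)
    fix D assume D: "closedin M D"
    have DM: "D \<subseteq> topspace M" using closedin_subset[OF D] .
    have "closedin M {x \<in> topspace M. orbit G act x \<in> orbit G act ` D}"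
      unfolding orbit_preimage_image[OF DM] using finite_G closedin_act[OF _ D]
      by (intro closedin_Union) auto
    moreover have "orbit G act ` D \<subseteq> topspace ?Y"
      using quotient_imp_surjective_map[OF q] DM by blast
    ultimately show "closedin ?Y (orbit G act ` D)"
      using q[unfolded quotient_map_closedin] by blast
  qed
  then show ?thesis
    using normal Hausdorff normal_Hausdorff_space_closed_continuous_map_image quotient_imp_continuous_map[OF q]
      quotient_imp_surjective_map[OF q] by blast
qed

lemma second_countable_orbit_space: "second_countable (orbit_space M G act)"
proof (rule second_countable_open_map_image)
  show "second_countable M" using manifold by (simp add: smooth_manifold_def)
  show "open_map M (orbit_space M G act) (orbit G act)"
    using openin_orbit_image by (auto simp: open_map_def)
  show "continuous_map M (orbit_space M G act) (orbit G act)"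
    by (rule quotient_imp_continuous_map[OF quotient_map_orbit_space])
  show "orbit G act ` topspace M = topspace (orbit_space M G act)"
    by (rule quotient_imp_surjective_map[OF quotient_map_orbit_space])
qed

section \<open>Orbifold charts from neighbourhoods preserved by stabilisers\<close>

definition good_nhd :: "('a set \<times> ('a \<Rightarrow> 'e)) set \<Rightarrow> 'a set \<Rightarrow> ('a \<Rightarrow> 'e) \<Rightarrow> 'a \<Rightarrow> 'a set \<Rightarrow> bool" where
  "good_nhd S U h x B \<longleftrightarrow> (U, h) \<in> S \<and> openin M B \<and> x \<in> B \<and> B \<subseteq> U \<and> connected (h ` B) \<and>
     (\<forall>g\<in>carrier G. act g x = x \<longrightarrow> (\<forall>y\<in>B. act g y \<in> B)) \<and>
     (\<forall>g\<in>carrier G. act g x \<noteq> x \<longrightarrow> (\<forall>y\<in>B. act g y \<notin> B))"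

lemma good_nhd_exists:
  assumes S: "smooth_system S" and U: "(U, h) \<in> S" and N: "openin M N" "x \<in> N" "N \<subseteq> U"
  obtains B where "good_nhd S U h x B" "B \<subseteq> N"
proof -
  note c = manifold_chartD[OF C1chart_imp_chart[OF smooth_systemD(1)[OF S U]]]
  have x: "x \<in> topspace M" using N c(6) by blast
  obtain N0 where N0: "openin M N0" "x \<in> N0" "N0 \<subseteq> N"
    "\<And>g y. g \<in> carrier G \<Longrightarrow> act g x \<noteq> x \<Longrightarrow> y \<in> N0 \<Longrightarrow> act g y \<notin> N0"
    by (rule separating_nhd[OF x subset_refl N(1,2)]) (rule that)
  define H where "H = stabilizer G act x"
  have H: "subgroup H G" unfolding H_def by (rule stabilizer_subgroup[OF x])
  have Hx: "g \<in> H \<longleftrightarrow> g \<in> carrier G \<and> act g x = x" for g by (simp add: H_def stabilizer_def)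
  have finH: "finite H" using finite_subset[OF subgroup.subset[OF H] finite_G] .
  \<comment> \<open>Intersecting the preimages under the stabiliser gives invariance but may lose
    connectedness; passing to the component of \<open>h x\<close> restores it.\<close>
  define N1 where "N1 = N0 \<inter> \<Inter>((\<lambda>g. {y \<in> topspace M. act g y \<in> N0}) ` H)"
  have N1: "openin M N1" "x \<in> N1" "N1 \<subseteq> N0"
    unfolding N1_def using finH N0 Hx x subgroup.one_closed[OF H]
    by (auto intro!: openin_Int openin_Inter openin_act_preimage)
  have N1H: "act k y \<in> N1" if k: "k \<in> H" and y: "y \<in> N1" for k y
  proof -
    have yM: "y \<in> topspace M" using y N1(1) openin_subset by blast
    have "act g (act k y) \<in> N0" if g: "g \<in> H" for g
    proof -
      have "act (g \<otimes> k) y \<in> N0" using subgroup.m_closed[OF H g k] y unfolding N1_def by blast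
      then show ?thesis using composition_rule[OF yM, of g k] g k Hx by simp
    qed
    moreover have "act k y \<in> N0" using y k by (auto simp: N1_def)
    ultimately show ?thesis using act_closed[OF _ yM] k Hx by (auto simp: N1_def)
  qed
  have N1U: "N1 \<subseteq> U" using N1(3) N0(3) N(3) by blast
  define V where "V = connected_component_set (h ` N1) (h x)"
  have opN: "open (h ` N1)" using c(3)[OF N1(1) N1U] .
  have V: "open V" "connected V" "h x \<in> V" "V \<subseteq> h ` N1"
    using opN N1(2) by (auto simp: V_def open_connected_component connected_component_subset)
  define B where "B = {y \<in> N1. h y \<in> V}"
  have B: "openin M B"
  proof -
    have "B = N1 \<inter> {y \<in> U. h y \<in> V}" using N1U by (auto simp: B_def)
    then show ?thesis using N1(1) c(4)[OF V(1)] by auto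
  qed
  have hB: "h ` B = V" using V(4) by (auto simp: B_def)
  have inv: "act g y \<in> B" if g: "g \<in> H" and y: "y \<in> B" for g y
  proof -
    have yN: "y \<in> N1" "act g y \<in> N1" using y N1H[OF g] by (auto simp: B_def)
    define f where "f z = h (act g (inv_into U h z))" for z
    have gG: "g \<in> carrier G" using g Hx by blast
    have ih: "inv_into U h (h b) = b" if "b \<in> N1" for b using that N1U c(2) by auto
    have "isCont f z" if z: "z \<in> V" for z
    proof -
      obtain b where b: "b \<in> B" "z = h b" using z hB by blast
      then have bN: "b \<in> N1" by (simp add: B_def)
      have "fun_at \<infinity> U h (\<lambda>y. h (act g y)) b"
        by (rule smooth_systemD(2)[OF S U U gG]) (use bN N1H[OF g bN] N1U in auto)
      then have "Ck_at \<infinity> f z" by (simp add: fun_at_def f_def[abs_def] b(2))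
      then show ?thesis by (rule Ck_at_isCont)
    qed
    then have f1: "connected (f ` V)"
      using V(2) by (intro connected_continuous_image continuous_at_imp_continuous_on) auto
    have f2: "h x \<in> f ` V"
    proof -
      have "f (h x) = h x" using ih[OF N1(2)] g Hx by (simp add: f_def)
      then show ?thesis using V(3) by (metis imageI)
    qed
    have f3: "f ` V \<subseteq> h ` N1"
      unfolding hB[symmetric] using ih N1H[OF g] by (auto simp: f_def B_def)
    \<comment> \<open>The moved component is connected and still contains \<open>h x\<close>,
      because the stabiliser fixes \<open>x\<close>; so it stays within the component.\<close>
    have "f ` V \<subseteq> connected_component_set (h ` N1) (h x)"
      by (rule connected_component_maximal[OF f2 f1 f3])
    then have "f ` V \<subseteq> V" by (simp only: V_def)
    moreover have "f (h y) = h (act g y)" using ih[OF yN(1)] by (simp add: f_def)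
    ultimately have "h (act g y) \<in> V" using y by (auto simp: B_def)
    then show ?thesis using yN(2) by (simp add: B_def)
  qed
  have "good_nhd S U h x B"
    unfolding good_nhd_def
  proof (intro conjI ballI impI)
    show "connected (h ` B)" by (simp add: hB V)
    show "act g y \<notin> B" if "g \<in> carrier G" "act g x \<noteq> x" "y \<in> B" for g y
      using N0(4)[OF that(1,2), of y] that(3) N1(3) by (auto simp: B_def)
  qed (use U B N1 N1U V inv Hx in \<open>auto simp: B_def\<close>)
  moreover have "B \<subseteq> N" using N1(3) N0(3) by (auto simp: B_def)
  ultimately show ?thesis using that by blast
qed

text \<open>The image of the stabiliser among the self-maps of the chart domain, so elements that
  act alike there become one map. The restriction makes the maps extensional, as
  \<open>BijGroup\<close> demands.\<close>

definition local_group :: "('a \<Rightarrow> 'e) \<Rightarrow> 'a \<Rightarrow> 'a set \<Rightarrow> ('e \<Rightarrow> 'e) set" where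
  "local_group h x B = (\<lambda>g. \<lambda>v\<in>h ` B. h (act g (inv_into B h v))) ` {g \<in> carrier G. act g x = x}"

definition local_projection :: "('a \<Rightarrow> 'e) \<Rightarrow> 'a set \<Rightarrow> 'e \<Rightarrow> 'a set" where
  "local_projection h B v = orbit G act (inv_into B h v)"

lemma good_nhdD:
  assumes S: "smooth_system S" and g: "good_nhd S U h x B"
  shows "(U, h) \<in> S" "openin M B" "x \<in> B" "B \<subseteq> U" "connected (h ` B)" "manifold_chart M B h"
    "inj_on h B" "open (h ` B)" "\<And>b. b \<in> B \<Longrightarrow> inv_into B h (h b) = b" "B \<subseteq> topspace M"
    "\<And>g y. g \<in> carrier G \<Longrightarrow> act g x = x \<Longrightarrow> y \<in> B \<Longrightarrow> act g y \<in> B"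
    "\<And>g y. g \<in> carrier G \<Longrightarrow> y \<in> B \<Longrightarrow> act g y \<in> B \<Longrightarrow> act g x = x"
proof -
  show 1: "(U, h) \<in> S" "openin M B" "x \<in> B" "B \<subseteq> U" "connected (h ` B)"
    using g by (auto simp: good_nhd_def)
  show m: "manifold_chart M B h"
    by (rule C1chart_imp_chart[OF C1chart_restrict[OF smooth_systemD(1)[OF S 1(1)] 1(2,4)]])
  show "inj_on h B" "open (h ` B)" "B \<subseteq> topspace M" using manifold_chartD[OF m] by auto
  then show "\<And>b. b \<in> B \<Longrightarrow> inv_into B h (h b) = b" by simp
qed (use g in \<open>auto simp: good_nhd_def\<close>)

lemma smooth_system_fun_at:
  assumes S: "smooth_system S" and U: "(U, h) \<in> S" "(V, k) \<in> S" and B: "openin M B" "B \<subseteq> U"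
    and g: "g \<in> carrier G" and y: "y \<in> B" "act g y \<in> V"
  shows "Ck_at \<infinity> (\<lambda>z. k (act g (inv_into B h z))) (h y)"
proof -
  have "fun_at \<infinity> U h (\<lambda>y. k (act g y)) y" using smooth_systemD(2)[OF S U g _ y(2)] y(1) B(2) by blast
  then have "fun_at \<infinity> B h (\<lambda>y. k (act g y)) y"
    using fun_at_restrict[OF C1chart_imp_chart[OF smooth_systemD(1)[OF S U(1)]] B y(1)] by blast
  then show ?thesis by (simp add: fun_at_def)
qed

text \<open>Each group element that carries \<open>B\<close> into \<open>B'\<close> induces an
  embedding of charts, with inverse the coordinate form of \<open>inv k\<close>. It is compatible
  with the projections since \<open>act k\<close> preserves orbits.\<close>

lemma embedding_of_good_nhd:
  assumes S: "smooth_system S" and B: "openin M B" "B \<subseteq> U" "(U, h) \<in> S"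
    and B': "openin M B'" "B' \<subseteq> U'" "(U', h') \<in> S" and k: "k \<in> carrier G"
    and kB: "\<And>y. y \<in> B \<Longrightarrow> act k y \<in> B'"
  shows "orbifold_chart_embedding (h ` B) (local_projection h B) (h' ` B') (local_projection h' B')
           (\<lambda>w. h' (act k (inv_into B h w)))"
proof -
  have c: "C1chart B h" and c': "C1chart B' h'"
    using C1chart_restrict smooth_systemD(1)[OF S] B B' by blast+
  note m = manifold_chartD[OF C1chart_imp_chart[OF c]]
  note m' = manifold_chartD[OF C1chart_imp_chart[OF c']]
  define j where "j w = h' (act k (inv_into B h w))" for w
  have jh: "j (h y) = h' (act k y)" if "y \<in> B" for y using that m(2) by (simp add: j_def)
  have img: "j ` h ` B = h' ` act k ` B" using jh by (auto simp: image_image)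
  have op: "open (j ` h ` B)"
    unfolding img by (rule m'(3)[OF openin_act[OF k m(1)]]) (use kB in auto)
  have inj: "inj_on j (h ` B)"
  proof (rule inj_onI)
    fix z z' assume z: "z \<in> h ` B" "z' \<in> h ` B" "j z = j z'"
    then obtain y y' where y: "y \<in> B" "z = h y" "y' \<in> B" "z' = h y'" by blast
    then have "h' (act k y) = h' (act k y')" using z(3) jh by simp
    then have "act k y = act k y'" using inj_onD[OF m'(2)] kB y by blast
    then have "y = y'" using inj_onD[OF inj_prop[OF k]] y m(6) by blast
    then show "z = z'" using y by simp
  qed
  have ij: "inv_into (h ` B) j z = h (act (inv k) (inv_into B' h' z))" if z: "z \<in> j ` h ` B" for z
  proof -
    obtain y where y: "y \<in> B" "z = h' (act k y)" using z jh by auto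
    have "inv_into (h ` B) j z = h y"
      using inv_into_f_f[OF inj, of "h y"] y jh by simp
    moreover have "inv_into B' h' z = act k y" using y kB m'(2) by simp
    ultimately show ?thesis using act_inv(1)[OF k, of y] y m(6) by auto
  qed
  show ?thesis
    unfolding orbifold_chart_embedding_def j_def[symmetric]
  proof (intro conjI ballI)
    show "j ` h ` B \<subseteq> h' ` B'" unfolding img using kB by auto
    show "smooth_on j (h ` B)"
      unfolding smooth_on_iff_Ck_at[OF m(5)] j_def
      using smooth_system_fun_at[OF S B(3) B'(3) B(1,2) k] kB B'(2) by auto
    show "smooth_on (inv_into (h ` B) j) (j ` h ` B)"
      unfolding smooth_on_iff_Ck_at[OF op]
    proof
      fix z assume z: "z \<in> j ` h ` B"
      obtain y where y: "y \<in> B" "z = h' (act k y)" using z jh by auto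
      have "act (inv k) (act k y) = y" using act_inv(1)[OF k, of y] y(1) m(6) by blast
      then have *: "act (inv k) (act k y) \<in> U" using y(1) B(2) by auto
      have "Ck_at \<infinity> (\<lambda>z. h (act (inv k) (inv_into B' h' z))) (h' (act k y))"
        by (rule smooth_system_fun_at[OF S B'(3) B(3) B'(1,2)])
          (use k kB y * in auto)
      then show "Ck_at \<infinity> (inv_into (h ` B) j) z"
        unfolding y(2)[symmetric] by (rule Ck_at_cong[OF _ op z]) (use ij in auto)
    qed
    show "local_projection h' B' (j w) = local_projection h B w" if w: "w \<in> h ` B" for w
    proof -
      obtain y where y: "y \<in> B" "w = h y" using w by blast
      have "orbit G act y = orbit G act (act k y)"
        using orbit_eq_iff[of y "act k y"] y m(6) k act_closed[OF k] by blast
      then show ?thesis using y jh kB m(2) m'(2) by (simp add: local_projection_def)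
    qed
  qed (use op inj in auto)
qed


lemma local_group:
  assumes S: "smooth_system S" and good: "good_nhd S U h x B"
  defines "\<gamma> \<equiv> \<lambda>g. \<lambda>v\<in>h ` B. h (act g (inv_into B h v))"
  shows "subgroup (local_group h x B) (BijGroup (h ` B))" "finite (local_group h x B)"
    "\<forall>\<gamma>\<in>local_group h x B. smooth_on \<gamma> (h ` B)"
proof -
  note d = good_nhdD[OF S good]
  define H where "H = stabilizer G act x"
  have H: "subgroup H G" unfolding H_def using d(3,10) by (intro stabilizer_subgroup) blast
  have Hx: "H = {g \<in> carrier G. act g x = x}" by (auto simp: H_def stabilizer_def)
  have HG: "g \<in> carrier G" if "g \<in> H" for g using that Hx by simp
  have lg: "local_group h x B = \<gamma> ` H" by (simp add: local_group_def \<gamma>_def Hx)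
  have HB: "act g b \<in> B" if "g \<in> H" "b \<in> B" for g b using that Hx d(11) by blast
  have \<gamma>h: "\<gamma> g (h b) = h (act g b)" if "b \<in> B" for g b using that d(9) by (simp add: \<gamma>_def)
  have \<gamma>V: "\<gamma> g v \<in> h ` B" if "g \<in> H" "v \<in> h ` B" for g v using that \<gamma>h HB by auto
  have \<gamma>ext: "\<gamma> g \<in> extensional (h ` B)" for g by (simp add: \<gamma>_def)
  have \<gamma>m: "compose (h ` B) (\<gamma> g) (\<gamma> k) = \<gamma> (g \<otimes> k)" if "g \<in> H" "k \<in> H" for g k
  proof (rule extensionalityI[OF compose_extensional \<gamma>ext])
    fix v assume v: "v \<in> h ` B"
    then obtain b where b: "b \<in> B" "v = h b" by blast
    then show "compose (h ` B) (\<gamma> g) (\<gamma> k) v = \<gamma> (g \<otimes> k) v"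
      using composition_rule[of b g k] HG that d(10) HB \<gamma>h by (auto simp: compose_def)
  qed
  have \<gamma>1: "\<gamma> \<one> = (\<lambda>v\<in>h ` B. v)"
  proof (rule extensionalityI[OF \<gamma>ext])
    fix v assume "v \<in> h ` B"
    then show "\<gamma> \<one> v = (\<lambda>v\<in>h ` B. v) v" using \<gamma>h act_one d(10) by auto
  qed simp
  have invH: "inv g \<in> H" if "g \<in> H" for g using subgroup.m_inv_closed[OF H that] .
  have inv1: "compose (h ` B) (\<gamma> (inv g)) (\<gamma> g) = (\<lambda>v\<in>h ` B. v)"
    "compose (h ` B) (\<gamma> g) (\<gamma> (inv g)) = (\<lambda>v\<in>h ` B. v)" if "g \<in> H" for g
    using \<gamma>m[OF invH[OF that] that] \<gamma>m[OF that invH[OF that]] HG[OF that] \<gamma>1 by auto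
  have \<gamma>bij: "\<gamma> g \<in> Bij (h ` B)" if g: "g \<in> H" for g
  proof -
    have "bij_betw (\<gamma> g) (h ` B) (h ` B)"
    proof (rule bij_betw_byWitness[where f'="\<gamma> (inv g)"])
      show "\<forall>v\<in>h ` B. \<gamma> (inv g) (\<gamma> g v) = v"
      proof
        fix v assume v: "v \<in> h ` B"
        show "\<gamma> (inv g) (\<gamma> g v) = v" using fun_cong[OF inv1(1)[OF g], of v] v by (simp only: compose_eq restrict_apply if_True)
      qed
      show "\<forall>v\<in>h ` B. \<gamma> g (\<gamma> (inv g) v) = v"
      proof
        fix v assume v: "v \<in> h ` B"
        show "\<gamma> g (\<gamma> (inv g) v) = v" using fun_cong[OF inv1(2)[OF g], of v] v by (simp only: compose_eq restrict_apply if_True)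
      qed
    qed (use \<gamma>V g invH in blast)+
    then show ?thesis using \<gamma>ext by (simp add: Bij_def)
  qed
  show "subgroup (local_group h x B) (BijGroup (h ` B))"
  proof (rule group.subgroupI[OF group_BijGroup])
    show "local_group h x B \<subseteq> carrier (BijGroup (h ` B))"
      unfolding lg using \<gamma>bij by (auto simp: BijGroup_def)
    show "local_group h x B \<noteq> {}" using subgroup.one_closed[OF H] by (auto simp: lg)
    fix a assume "a \<in> local_group h x B"
    then obtain g where g: "g \<in> H" "a = \<gamma> g" by (auto simp: lg)
    have "inv\<^bsub>BijGroup (h ` B)\<^esub> \<gamma> g = \<gamma> (inv g)"
      by (rule group.inv_equality[OF group_BijGroup])
        (use \<gamma>bij g invH inv1(1) in \<open>auto simp: BijGroup_def\<close>)
    then show "inv\<^bsub>BijGroup (h ` B)\<^esub> a \<in> local_group h x B" using g invH by (auto simp: lg)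
    fix b assume "b \<in> local_group h x B"
    then obtain k where k: "k \<in> H" "b = \<gamma> k" by (auto simp: lg)
    have "a \<otimes>\<^bsub>BijGroup (h ` B)\<^esub> b = \<gamma> (g \<otimes> k)"
      using \<gamma>m[OF g(1) k(1)] \<gamma>bij g k by (simp add: BijGroup_def)
    then show "a \<otimes>\<^bsub>BijGroup (h ` B)\<^esub> b \<in> local_group h x B"
      using subgroup.m_closed[OF H g(1) k(1)] by (auto simp: lg)
  qed
  show "finite (local_group h x B)" using finite_G by (simp add: local_group_def)
  show "\<forall>\<gamma>\<in>local_group h x B. smooth_on \<gamma> (h ` B)"
    unfolding lg smooth_on_iff_Ck_at[OF d(8)]
  proof (intro ballI)
    fix a v assume "a \<in> \<gamma> ` H" and v: "v \<in> h ` B"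
    then obtain g b where g: "g \<in> H" "a = \<gamma> g" and b: "b \<in> B" "v = h b" by blast
    have "Ck_at \<infinity> (\<lambda>z. h (act g (inv_into B h z))) v"
      unfolding b(2) by (rule smooth_system_fun_at[OF S d(1,1,2,4) HG[OF g(1)] b(1)]) (use HB g b d(4) in blast)
    then show "Ck_at \<infinity> a v"
      by (rule Ck_at_cong[OF _ d(8) v]) (simp add: g(2) \<gamma>_def)
  qed
qed

text \<open>Only stabiliser elements return a point of \<open>B\<close> to \<open>B\<close>, so
  inside \<open>B\<close> the orbits of the stabiliser are the traces of the full orbits. This makes
  the local quotient inject into the orbit space.\<close>

lemma orbit_local_group:
  assumes S: "smooth_system S" and good: "good_nhd S U h x B" and b: "b \<in> B"
  shows "orbit ((BijGroup (h ` B))\<lparr>carrier := local_group h x B\<rparr>) (\<lambda>\<gamma>. \<gamma>) (h b) = h ` (orbit G act b \<inter> B)"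
proof -
  note d = good_nhdD[OF S good]
  have "orbit ((BijGroup (h ` B))\<lparr>carrier := local_group h x B\<rparr>) (\<lambda>\<gamma>. \<gamma>) (h b) =
      {h (act g b) |g. g \<in> carrier G \<and> act g x = x}"
  proof -
    have "orbit ((BijGroup (h ` B))\<lparr>carrier := local_group h x B\<rparr>) (\<lambda>\<gamma>. \<gamma>) (h b) = (\<lambda>\<gamma>. \<gamma> (h b)) ` local_group h x B"
      by (auto simp: orbit_def)
    then show ?thesis using b d(9)[OF b] by (auto simp: local_group_def image_image)
  qed
  also have "\<dots> = h ` (orbit G act b \<inter> B)"
    using d(11,12) b by (auto simp: orbit_def)
  finally show ?thesis .
qed

lemma embedding_inv_chart:
  assumes c: "manifold_chart M B h"
  shows "embedding_map (top_of_set (h ` B)) M (inv_into B h)" "inv_into B h ` h ` B = B"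
proof -
  note m = manifold_chartD[OF c]
  show im: "inv_into B h ` h ` B = B" using m(2) by simp
  show "embedding_map (top_of_set (h ` B)) M (inv_into B h)"
  proof (rule injective_open_imp_embedding_map)
    show "continuous_map (top_of_set (h ` B)) M (inv_into B h)"
      unfolding continuous_map_def
    proof (intro conjI allI impI)
      show "inv_into B h \<in> topspace (top_of_set (h ` B)) \<rightarrow> topspace M" using m(2,6) by auto
      fix W assume "openin M W"
      then have "open (h ` (W \<inter> B))" using m(1,3) by (simp add: openin_Int)
      moreover have "{v \<in> topspace (top_of_set (h ` B)). inv_into B h v \<in> W} = h ` (W \<inter> B)"
        using m(2) by auto
      ultimately show "openin (top_of_set (h ` B)) {v \<in> topspace (top_of_set (h ` B)). inv_into B h v \<in> W}"
        by (simp add: open_subset image_mono)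
    qed
    show "open_map (top_of_set (h ` B)) M (inv_into B h)"
      unfolding open_map_def
    proof (intro allI impI)
      fix T assume T: "openin (top_of_set (h ` B)) T"
      then have "open T" "T \<subseteq> h ` B" using m(5) by (auto simp: openin_open_eq)
      have "inv_into B h ` T = {y \<in> B. h y \<in> T}"
      proof (intro equalityI subsetI)
        fix y assume "y \<in> inv_into B h ` T"
        then obtain t where t: "t \<in> T" "y = inv_into B h t" by blast
        then obtain b where "b \<in> B" "t = h b" using \<open>T \<subseteq> h ` B\<close> by blast
        then show "y \<in> {y \<in> B. h y \<in> T}" using t m(2) by simp
      next
        fix y assume "y \<in> {y \<in> B. h y \<in> T}"
        then have "inv_into B h (h y) = y" "h y \<in> T" using m(2) by auto
        then show "y \<in> inv_into B h ` T" by (metis imageI)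
      qed
      then show "openin M (inv_into B h ` T)" using m(4)[OF \<open>open T\<close>] by simp
    qed
    show "inj_on (inv_into B h) (topspace (top_of_set (h ` B)))" by (simp add: inj_on_inv_into)
  qed
qed

text \<open>The projection onto the local quotient and the projection to the orbit space are
  quotient maps on the same domain with the same fibres. The induced map is therefore an injective
  quotient map, that is, a homeomorphism.\<close>

lemma good_nhd_orbifold_chart:
  assumes S: "smooth_system S" and good: "good_nhd S U h x B"
  shows "orbifold_chart (orbit_space M G act) (h ` B) (local_group h x B) (local_projection h B)"
proof -
  note d = good_nhdD[OF S good]
  let ?V = "h ` B" and ?Y = "orbit_space M G act" and ?p = "local_projection h B"
  let ?\<Gamma> = "(BijGroup (h ` B))\<lparr>carrier := local_group h x B\<rparr>"
  let ?q = "orbit ?\<Gamma> (\<lambda>\<gamma>. \<gamma>)"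
  have ph: "?p (h b) = orbit G act b" if "b \<in> B" for b using d(9)[OF that] by (simp add: local_projection_def)
  have pV: "?p ` ?V = orbit G act ` B" using ph by (auto simp: image_image)
  have opV: "openin ?Y (?p ` ?V)" unfolding pV by (rule openin_orbit_image[OF d(2)])
  have emb: "embedding_map (top_of_set ?V) M (inv_into B h)" by (rule embedding_inv_chart(1)[OF d(6)])
  have ts: "topspace (subtopology ?Y (?p ` ?V)) = ?p ` ?V"
    by (intro topspace_subtopology_subset openin_subset opV)
  have pq: "quotient_map (top_of_set ?V) (subtopology ?Y (?p ` ?V)) ?p"
  proof (rule continuous_open_imp_quotient_map)
    have "continuous_map (top_of_set ?V) M (inv_into B h)"
      using emb homeomorphic_imp_continuous_map continuous_map_in_subtopology
      unfolding embedding_map_def by blast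
    then have "continuous_map (top_of_set ?V) ?Y (orbit G act \<circ> inv_into B h)"
      using quotient_imp_continuous_map[OF quotient_map_orbit_space] by (rule continuous_map_compose)
    then show "continuous_map (top_of_set ?V) (subtopology ?Y (?p ` ?V)) ?p"
      by (simp add: continuous_map_in_subtopology local_projection_def[abs_def] o_def)
    show "open_map (top_of_set ?V) (subtopology ?Y (?p ` ?V)) ?p"
      unfolding open_map_def
    proof (intro allI impI)
      fix T assume T: "openin (top_of_set ?V) T"
      then have T': "open T" "T \<subseteq> ?V" using d(8) by (auto simp: openin_open_eq)
      have "?p ` T = orbit G act ` {y \<in> B. h y \<in> T}"
        using T'(2) ph by (force simp: image_iff)
      then have "openin ?Y (?p ` T)" using openin_orbit_image manifold_chartD(4)[OF d(6) T'(1)] by simp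
      then show "openin (subtopology ?Y (?p ` ?V)) (?p ` T)"
        using opV T'(2) by (simp add: openin_open_subtopology image_mono)
    qed
    show "?p ` topspace (top_of_set ?V) = topspace (subtopology ?Y (?p ` ?V))" unfolding ts by simp
  qed
  have qq: "quotient_map (top_of_set ?V) (orbit_space (top_of_set ?V) ?\<Gamma> (\<lambda>\<gamma>. \<gamma>)) ?q"
    by (rule quotient_map_orbit_space)
  have qp: "?q v = ?q w \<longleftrightarrow> ?p v = ?p w" if v: "v \<in> ?V" and w: "w \<in> ?V" for v w
  proof -
    obtain b c where b: "b \<in> B" "v = h b" and c: "c \<in> B" "w = h c" using v w by blast
    have bc: "b \<in> topspace M" "c \<in> topspace M" using b c d(10) by auto
    have "orbit G act b = orbit G act c" if "h ` (orbit G act b \<inter> B) = h ` (orbit G act c \<inter> B)"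
    proof -
      have "h c \<in> h ` (orbit G act b \<inter> B)" unfolding that using orbit_refl[OF bc(2)] c by blast
      then have "c \<in> orbit G act b" using inj_onD[OF d(7)] c(1) by auto
      then show ?thesis using orbit_eq_iff[OF bc] by (auto simp: orbit_def)
    qed
    then show ?thesis
      unfolding b(2) c(2) orbit_local_group[OF S good b(1)] orbit_local_group[OF S good c(1)]
        ph[OF b(1)] ph[OF c(1)] by auto
  qed
  obtain f where f: "continuous_map (orbit_space (top_of_set ?V) ?\<Gamma> (\<lambda>\<gamma>. \<gamma>)) (subtopology ?Y (?p ` ?V)) f"
    "\<And>v. v \<in> topspace (top_of_set ?V) \<Longrightarrow> f (?q v) = ?p v"
    by (rule quotient_map_lift_exists[OF qq quotient_imp_continuous_map[OF pq]]) (use qp in auto)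
  have "quotient_map (orbit_space (top_of_set ?V) ?\<Gamma> (\<lambda>\<gamma>. \<gamma>)) (subtopology ?Y (?p ` ?V)) f"
  proof (rule quotient_map_from_composition[OF quotient_imp_continuous_map[OF qq] f(1)])
    show "quotient_map (top_of_set ?V) (subtopology ?Y (?p ` ?V)) (f \<circ> ?q)"
      by (rule quotient_map_eq[OF pq]) (use f(2) in auto)
  qed
  moreover have "inj_on f (topspace (orbit_space (top_of_set ?V) ?\<Gamma> (\<lambda>\<gamma>. \<gamma>)))"
    unfolding quotient_imp_surjective_map[OF qq, symmetric]
  proof (rule inj_onI)
    fix s t assume "s \<in> ?q ` topspace (top_of_set ?V)" "t \<in> ?q ` topspace (top_of_set ?V)" "f s = f t"
    then obtain v w where "v \<in> ?V" "w \<in> ?V" "s = ?q v" "t = ?q w" "f (?q v) = f (?q w)" by auto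
    then show "s = t" using f(2) qp by auto
  qed
  ultimately have "homeomorphic_map (orbit_space (top_of_set ?V) ?\<Gamma> (\<lambda>\<gamma>. \<gamma>)) (subtopology ?Y (?p ` ?V)) f"
    by (simp add: homeomorphic_map_def)
  then show ?thesis
    unfolding orbifold_chart_def Let_def
    using d(5,8) opV local_group[OF S good] f(2) by auto
qed

theorem quotient_orbifold:
  "\<exists>\<O>. quotient_orbifold_atlas M G act (\<O> :: ('e set \<times> ('e \<Rightarrow> 'e) set \<times> ('e \<Rightarrow> 'a set)) set)"
proof -
  obtain S where S: "smooth_system S" and cov: "\<And>x. x \<in> topspace M \<Longrightarrow> \<exists>U \<phi>. (U, \<phi>) \<in> S \<and> x \<in> U"
    by (rule smooth_system_covering) (rule that)
  let ?Y = "orbit_space M G act"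
  define \<O> where "\<O> = {(h ` B, local_group h x B, local_projection h B) |U h x B. good_nhd S U h x B}"
  have OE: thesis if "(V, \<Gamma>, \<phi>) \<in> \<O>" "\<And>U h x B. good_nhd S U h x B \<Longrightarrow> V = h ` B \<Longrightarrow>
      \<Gamma> = local_group h x B \<Longrightarrow> \<phi> = local_projection h B \<Longrightarrow> thesis" for V \<Gamma> \<phi> thesis
    using that by (auto simp: \<O>_def)
  have pV: "local_projection h B ` h ` B = orbit G act ` B" if "good_nhd S U h x B" for U h x B
    using good_nhdD(9)[OF S that] by (force simp: local_projection_def image_image)
  have "(\<Union>(V, \<Gamma>, \<phi>)\<in>\<O>. \<phi> ` V) = topspace ?Y"
  proof
    show "(\<Union>(V, \<Gamma>, \<phi>)\<in>\<O>. \<phi> ` V) \<subseteq> topspace ?Y"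
    proof
      fix y assume "y \<in> (\<Union>(V, \<Gamma>, \<phi>)\<in>\<O>. \<phi> ` V)"
      then obtain V \<Gamma> \<phi> where V: "(V, \<Gamma>, \<phi>) \<in> \<O>" "y \<in> \<phi> ` V" by blast
      from V(1) show "y \<in> topspace ?Y"
      proof (rule OE)
        fix U h x B assume B: "good_nhd S U h x B" "V = h ` B" "\<phi> = local_projection h B"
        have "y \<in> orbit G act ` B" using V(2) unfolding B(2,3) pV[OF B(1)] .
        then show ?thesis using good_nhdD(10)[OF S B(1)] by (auto simp: topspace_orbit_space orbits_def)
      qed
    qed
    show "topspace ?Y \<subseteq> (\<Union>(V, \<Gamma>, \<phi>)\<in>\<O>. \<phi> ` V)"
    proof
      fix y assume "y \<in> topspace ?Y"
      then obtain x where x: "x \<in> topspace M" "y = orbit G act x" by (auto simp: topspace_orbit_space orbits_def)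
      obtain U h where U: "(U, h) \<in> S" "x \<in> U" using cov[OF x(1)] by blast
      have "openin M U" using manifold_chartD(1)[OF C1chart_imp_chart[OF smooth_systemD(1)[OF S U(1)]]] .
      then obtain B where B: "good_nhd S U h x B" by (rule good_nhd_exists[OF S U(1) _ U(2) subset_refl])
      have "y \<in> local_projection h B ` h ` B" unfolding pV[OF B] using good_nhdD(3)[OF S B] x(2) by blast
      moreover have "(h ` B, local_group h x B, local_projection h B) \<in> \<O>" using B by (auto simp: \<O>_def)
      ultimately show "y \<in> (\<Union>(V, \<Gamma>, \<phi>)\<in>\<O>. \<phi> ` V)" by blast
    qed
  qed
  moreover have "orbifold_chart ?Y V \<Gamma> \<phi>" if "(V, \<Gamma>, \<phi>) \<in> \<O>" for V \<Gamma> \<phi>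
    using that by (rule OE) (simp add: good_nhd_orbifold_chart[OF S])
  moreover have compat: "\<exists>W \<Delta> \<xi> j j'. orbifold_chart ?Y W \<Delta> \<xi> \<and> y \<in> \<xi> ` W \<and>
          orbifold_chart_embedding W \<xi> V \<phi> j \<and> orbifold_chart_embedding W \<xi> V' \<phi>' j'"
    if 1: "(V, \<Gamma>, \<phi>) \<in> \<O>" and 2: "(V', \<Gamma>', \<phi>') \<in> \<O>" and y: "y \<in> \<phi> ` V" "y \<in> \<phi>' ` V'"
    for V \<Gamma> \<phi> V' \<Gamma>' \<phi>' y
  proof -
    obtain U h x B where B: "good_nhd S U h x B" "V = h ` B" "\<phi> = local_projection h B"
      using 1 by (rule OE)
    obtain U' h' x' B' where B': "good_nhd S U' h' x' B'" "V' = h' ` B'" "\<phi>' = local_projection h' B'"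
      using 2 by (rule OE)
    note d = good_nhdD[OF S B(1)] and d' = good_nhdD[OF S B'(1)]
    obtain b b' where b: "b \<in> B" "y = orbit G act b" and b': "b' \<in> B'" "y = orbit G act b'"
      using y pV[OF B(1)] pV[OF B'(1)] B B' by auto
    \<comment> \<open>The common point has a representative in each chart, and \<open>k\<close>
      joins them. The refining chart is centred at \<open>b\<close>, so its local group comes from
      the stabiliser of \<open>b\<close>; the unit embeds it in the first chart and \<open>k\<close>
      in the second.\<close>
    then obtain k where k: "k \<in> carrier G" "act k b = b'"
      using orbit_eq_iff[of b b'] d(10) d'(10) by blast
    have N: "openin M (B \<inter> {z \<in> topspace M. act k z \<in> B'})" "b \<in> B \<inter> {z \<in> topspace M. act k z \<in> B'}"
        "B \<inter> {z \<in> topspace M. act k z \<in> B'} \<subseteq> U"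
      using openin_act_preimage[OF k(1) d'(2)] d(2,4,10) b b' k(2) by auto
    obtain C where C: "good_nhd S U h b C" "C \<subseteq> B \<inter> {z \<in> topspace M. act k z \<in> B'}"
      by (rule good_nhd_exists[OF S d(1) N])
    note dC = good_nhdD[OF S C(1)]
    have "y \<in> local_projection h C ` h ` C" unfolding pV[OF C(1)] using dC(3) b(2) by blast
    moreover have "orbifold_chart_embedding (h ` C) (local_projection h C) V \<phi> (\<lambda>w. h (act \<one> (inv_into C h w)))"
      unfolding B(2,3)
      by (rule embedding_of_good_nhd[OF S dC(2,4,1) d(2,4,1)]) (use C(2) act_one in \<open>auto simp: subset_iff\<close>)
    moreover have "orbifold_chart_embedding (h ` C) (local_projection h C) V' \<phi>' (\<lambda>w. h' (act k (inv_into C h w)))"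
      unfolding B'(2,3)
      by (rule embedding_of_good_nhd[OF S dC(2,4,1) d'(2,4,1) k(1)]) (use C(2) in auto)
    ultimately show ?thesis using good_nhd_orbifold_chart[OF S C(1)] by blast
  qed
  ultimately have "orbifold_atlas ?Y \<O>"
    unfolding orbifold_atlas_def
  proof (intro conjI)
    show "\<forall>(V, \<Gamma>, \<phi>)\<in>\<O>. \<forall>(V', \<Gamma>', \<phi>')\<in>\<O>. \<forall>x \<in> \<phi> ` V \<inter> \<phi>' ` V'.
        \<exists>W \<Delta> \<xi> j j'. orbifold_chart ?Y W \<Delta> \<xi> \<and> x \<in> \<xi> ` W \<and>
          orbifold_chart_embedding W \<xi> V \<phi> j \<and> orbifold_chart_embedding W \<xi> V' \<phi>' j'"
      by (intro ballI case_prodI2, rule compat) auto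
  qed (use Hausdorff_orbit_space second_countable_orbit_space in auto)
  moreover have "\<exists>\<psi>. embedding_map (top_of_set V) M \<psi> \<and> openin M (\<psi> ` V) \<and> (\<forall>v\<in>V. \<phi> v = orbit G act (\<psi> v))"
    if "(V, \<Gamma>, \<phi>) \<in> \<O>" for V \<Gamma> \<phi>
    using that
  proof (rule OE)
    fix U h x B assume B: "good_nhd S U h x B" "V = h ` B" "\<phi> = local_projection h B"
    note d = good_nhdD[OF S B(1)]
    show ?thesis
      using embedding_inv_chart[OF d(6)] d(2) unfolding B(2,3) local_projection_def
      by (intro exI[of _ "inv_into B h"]) auto
  qed
  ultimately have "quotient_orbifold_atlas M G act \<O>"
    unfolding quotient_orbifold_atlas_def by auto
  then show ?thesis by blast
qed

end

theorem corollary1: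
  fixes M :: "'a topology"
    and A :: "('a set \<times> ('a \<Rightarrow> real ^ 3)) set"
    and G :: "('g, 'm) monoid_scheme"
    and act :: "'g \<Rightarrow> 'a \<Rightarrow> 'a"
  assumes "smooth_manifold M A" and "compact_space M"
    and "group G" and "finite (carrier G)" and "cyclic_group G"
    and "group_action G (topspace M) act"
    and "\<forall>g\<in>carrier G. Ck_diffeomorphism 1 M A M A (act g)"
  shows "\<exists>\<O> :: ((real ^ 3) set \<times> (real ^ 3 \<Rightarrow> real ^ 3) set \<times> (real ^ 3 \<Rightarrow> 'a set)) set.
           quotient_orbifold_atlas M G act \<O>"
proof -
  interpret C1_action G M act A
    using assms by (intro C1_action.intro C1_action_axioms.intro) auto
  show ?thesis by (rule quotient_orbifold)
qed

end
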